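(* Let $f:\mathbb{R}^n\times\mathbb{R}^m\to\mathbb{R}^n$ and $g:\mathbb{R}^n\times\mathbb{R}^m\to\mathbb{R}^{n\times l}$ be smooth with $f(0,0)=0$, $g(0,0)=0$. Let $k:\mathbb{R}^l\times\mathbb{R}^n\to\mathbb{R}^m$ be smooth with $k(\theta,0)=0$ for all $\theta\in\mathbb{R}^l$. Let $V_\theta,Q_\theta:\mathbb{R}^n\to\mathbb{R}_+$ ($\theta\in\mathbb{R}^l$) be two families of continuous, positive definite and radially unbounded functions such that the mappings $(\theta,x)\mapsto V_\theta(x)$ and $(\theta,x)\mapsto Q_\theta(x)$ are continuous on $\mathbb{R}^l\times\mathbb{R}^n$. Assume: (i) For each $\theta\in\mathbb{R}^l$, $0\in\mathbb{R}^n$ is globally asymptotically stable for $\dot x=f(x,k(\theta,x))+g(x,k(\theta,x))\theta$. Moreover, for every $\theta\in\mathbb{R}^l$, $x_0\in\mathbb{R}^n$ the solution $x(t)$ of this system with $x(0)=x_0$ satisfies $V_\theta(x(t))\le Q_\theta(x_0)$ for all $t\ge 0$. (ii) For every non-empty compact set $\Theta\subset\mathbb{R}^l$ and every $M\ge 0$ there exists $R>0$ such that $V_\theta(x)\le M$, $\theta\in\Theta$ imply $|x|\le R$. (iii) $N$ is a positive integer for which the following implication holds: if there exist times $0=\tau_0<\tau_1<\dots<\tau_N$, vectors $\theta,d_0,\dots,d_N\in\mathbb{R}^l$ with $d_i\neq 0$ for $i=0,\dots,N$, and a right differentiable mapping $x\in C^0([0,\tau_N];\mathbb{R}^n)\cap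 C^1([0,\tau_N]\setminus\{\tau_0,\dots,\tau_N\};\mathbb{R}^n)$ satisfying $\dot x(t)=f(x(t),k(\theta+d_i,x(t)))+g(x(t),k(\theta+d_i,x(t)))\theta$ for $t\in[\tau_i,\tau_{i+1})$, $i=0,\dots,N-1$, and $g(x(t),k(\theta+d_j,x(t)))\,d_{i+1}=0$ for all $t\in[\tau_j,\tau_{j+1}]$, $i=0,\dots,N-1$, $j=0,\dots,i$, then $x(t)=0$ for all $t\in[0,\tau_N]$. Let $T>0$, let $a:\mathbb{R}^n\to\mathbb{R}_+$ be continuous and positive definite, and let $\tilde N>N$ be an integer. Then there exists a family of functions $\tilde\sigma_{\theta,\hat\theta}\in KL$, parameterized by $\theta\in\mathbb{R}^l$, $\hat\theta\in\mathbb{R}^l$, such that for every $\theta\in\mathbb{R}^l$, $x_0\in\mathbb{R}^n$, $\hat\theta_0\in\mathbb{R}^l$ the solution of the hybrid closed-loop system (described in the context, with true parameter $\theta$) with initial conditions $x(0)=x_0$, $\hat\theta(0)=\hat\theta_0$ is unique, is defined for all $t\ge 0$ and satisfies $$|x(t)|\le\tilde\sigma_{\theta,\hat\theta_0}(|x_0|,t)\quad\text{for all } t\ge 0.$$ Moreover, if $x_0\neq 0$ then $\hat\theta(t)=\theta$ for all $t\ge NT$.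
   Context: Notation. $|\cdot|$ is the Euclidean norm, a prime denotes transpose, $\mathbb{R}_+=[0,\infty)$, $\mathbb{Z}_+=\{0,1,2,\dots\}$. $V:\mathbb{R}^n\to\mathbb{R}_+$ is positive definite if $V(0)=0$ and $V(x)>0$ for $x\ne0$; a continuous $V$ is radially unbounded if $\{x: V(x)\le M\}$ is compact for every $M>0$. $K$ is the class of strictly increasing continuous $\alpha:\mathbb{R}_+\to\mathbb{R}_+$ with $\alpha(0)=0$. $KL$ is the class of continuous $\sigma:\mathbb{R}_+\times\mathbb{R}_+\to\mathbb{R}_+$ such that $\sigma(\cdot,t)\in K$ for each $t\ge0$ and, for each $s\ge0$, $\sigma(s,\cdot)$ is non-increasing with $\lim_{t\to\infty}\sigma(s,t)=0$. Hybrid closed-loop system. Given the data $f,g,k,V_\theta,Q_\theta,a,T,\tilde N$ and the (constant, unknown to the controller) parameter $\theta\in\mathbb{R}^l$, the plant is $$\dot x=f(x,u)+g(x,u)\theta,\qquad x\in\mathbb{R}^n,\ u\in\mathbb{R}^m.$$ The state $x(t)$ is continuous, and there is a sequence of event times $\tau_0=0<\tau_1<\tau_2<\dots$ such that for all $i\in\mathbb{Z}_+$: (1) Control: for $t\in[\tau_i,\tau_{i+1})$, $u(t)=k(\hat\theta(\tau_i),x(t))$ and $\hat\theta(t)=\hat\theta(\tau_i)$. (2) Event times: $\tau_{i+1}=\min(\tau_i+T,r_i)$, where, if $x(\tau_i)\ne0$, $$r_i=\inf\{t>\tau_i:\ V_{\hat\theta(\tau_i)}(x(t))=Q_{\hat\theta(\tau_i)}(x(\tau_i))+a(x(\tau_i))\}$$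 with $x(t)$ the solution of the plant with $u(t)=k(\hat\theta(\tau_i),x(t))$ ($r_i=+\infty$ if no such $t$ exists), and $r_i=\tau_i+T$ if $x(\tau_i)=0$. (3) Parameter update: let $\mu_{i+1}=\min\{\tau_j:\ j\in\{0,\dots,i\},\ \tau_j\ge\tau_{i+1}-\tilde N T\}$, $$p(t,\sigma)=x(t)-x(\sigma)-\int_\sigma^t f(x(s),u(s))\,ds,\qquad q(t,\sigma)=\int_\sigma^t g(x(s),u(s))\,ds,$$ $$G(\tau_{i+1},\mu_{i+1})=\int_{\mu_{i+1}}^{\tau_{i+1}}\!\int_{\mu_{i+1}}^{\tau_{i+1}}q'(t,\sigma)q(t,\sigma)\,d\sigma\,dt,\qquad Z(\tau_{i+1},\mu_{i+1})=\int_{\mu_{i+1}}^{\tau_{i+1}}\!\int_{\mu_{i+1}}^{\tau_{i+1}}q'(t,\sigma)p(t,\sigma)\,d\sigma\,dt.$$ Then $\hat\theta(\tau_{i+1})$ is the unique minimizer $$\hat\theta(\tau_{i+1})=\arg\min\{|\vartheta-\hat\theta(\tau_i)|^2:\ \vartheta\in\mathbb{R}^l,\ Z(\tau_{i+1},\mu_{i+1})=G(\tau_{i+1},\mu_{i+1})\vartheta\}.$$ *)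

theory Defs
  imports "HOL-Analysis.Analysis"
begin

text \<open>On a finite-dimensional domain the recursion below is the usual notion of class
  \<open>C\<^sup>r\<close>: all iterated directional derivatives up to order \<open>r\<close> exist and are continuous.\<close>

primrec differentiable_of_class ::
    "nat \<Rightarrow> ('a::real_normed_vector \<Rightarrow> 'b::real_normed_vector) \<Rightarrow> bool" where
  "differentiable_of_class 0 h \<longleftrightarrow> continuous_on UNIV h"
| "differentiable_of_class (Suc r) h \<longleftrightarrow>
     (\<forall>x. h differentiable (at x)) \<and>
     (\<forall>v. differentiable_of_class r (\<lambda>x. frechet_derivative h (at x) v))"

definition smooth :: "('a::real_normed_vector \<Rightarrow> 'b::real_normed_vector) \<Rightarrow> bool" where
  "smooth h \<longleftrightarrow> (\<forall>r. differentiable_of_class r h)"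

text \<open>Nonnegativity of a positive definite function is implied by its two defining clauses.\<close>

definition positive_definite :: "('a::zero \<Rightarrow> real) \<Rightarrow> bool" where
  "positive_definite W \<longleftrightarrow> W 0 = 0 \<and> (\<forall>x. x \<noteq> 0 \<longrightarrow> 0 < W x)"

definition radially_unbounded :: "('a::topological_space \<Rightarrow> real) \<Rightarrow> bool" where
  "radially_unbounded W \<longleftrightarrow> (\<forall>M>0. compact {x. W x \<le> M})"

text \<open>Functions on \<open>[0,\<infinity>)\<close> are encoded as functions on the reals whose values at negative
  arguments are irrelevant.\<close>

definition class_K :: "(real \<Rightarrow> real) \<Rightarrow> bool" where
  "class_K \<alpha> \<longleftrightarrow>
     (\<forall>s\<ge>0. 0 \<le> \<alpha> s) \<and> continuous_on {0..} \<alpha> \<and> strict_mono_on {0..} \<alpha> \<and> \<alpha> 0 = 0"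

definition class_KL :: "(real \<Rightarrow> real \<Rightarrow> real) \<Rightarrow> bool" where
  "class_KL \<sigma> \<longleftrightarrow>
     continuous_on ({0..} \<times> {0..}) (\<lambda>(s, t). \<sigma> s t) \<and>
     (\<forall>t\<ge>0. class_K (\<lambda>s. \<sigma> s t)) \<and>
     (\<forall>s\<ge>0. antimono_on {0..} (\<sigma> s) \<and> (\<sigma> s \<longlongrightarrow> 0) at_top)"

text \<open>The derivative is one-sided at an endpoint belonging to the interval \<open>I\<close>.\<close>

definition ode_solution_on ::
    "('a::real_normed_vector \<Rightarrow> 'a) \<Rightarrow> real set \<Rightarrow> (real \<Rightarrow> 'a) \<Rightarrow> bool" where
  "ode_solution_on F I x \<longleftrightarrow> (\<forall>t\<in>I. (x has_vector_derivative F (x t)) (at t within I))"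

text \<open>Equilibrium, forward completeness, Lyapunov stability and global attractivity.\<close>

definition globally_asymptotically_stable :: "('a::real_normed_vector \<Rightarrow> 'a) \<Rightarrow> bool" where
  "globally_asymptotically_stable F \<longleftrightarrow>
     F 0 = 0 \<and>
     (\<forall>x0. \<exists>x. ode_solution_on F {0..} x \<and> x 0 = x0) \<and>
     (\<forall>\<epsilon>>0. \<exists>\<delta>>0. \<forall>x. ode_solution_on F {0..} x \<and> norm (x 0) < \<delta> \<longrightarrow>
        (\<forall>t\<ge>0. norm (x t) < \<epsilon>)) \<and>
     (\<forall>x. ode_solution_on F {0..} x \<longrightarrow> (x \<longlongrightarrow> 0) at_top)"

text \<open>Throughout, \<open>f :: real^'n \<Rightarrow> real^'m \<Rightarrow> real^'n\<close>, the values of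
  \<open>g :: real^'n \<Rightarrow> real^'m \<Rightarrow> real^'l^'n\<close> are matrices with \<open>CARD('n)\<close> rows and
  \<open>CARD('l)\<close> columns, \<open>\<theta>\<close> is the true parameter and \<open>\<eta>\<close> an estimate of it.\<close>

definition closed_loop ::
    "(real^'n \<Rightarrow> real^'m \<Rightarrow> real^'n) \<Rightarrow> (real^'n \<Rightarrow> real^'m \<Rightarrow> real^'l^'n) \<Rightarrow>
     (real^'l \<Rightarrow> real^'n \<Rightarrow> real^'m) \<Rightarrow> real^'l \<Rightarrow> real^'l \<Rightarrow> real^'n \<Rightarrow> real^'n" where
  "closed_loop f g k \<theta> \<eta> x = f x (k \<eta> x) + g x (k \<eta> x) *v \<theta>"

text \<open>At the break points \<open>\<tau> i\<close> the differential equation is understood with the right derivative;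
  elsewhere the right derivative is the derivative, since \<open>x\<close> is \<open>C\<^sup>1\<close> there.\<close>

definition parameter_observable ::
    "(real^'n \<Rightarrow> real^'m \<Rightarrow> real^'n) \<Rightarrow> (real^'n \<Rightarrow> real^'m \<Rightarrow> real^'l^'n) \<Rightarrow>
     (real^'l \<Rightarrow> real^'n \<Rightarrow> real^'m) \<Rightarrow> nat \<Rightarrow> bool" where
  "parameter_observable f g k N \<longleftrightarrow>
     (\<forall>\<tau> \<theta> d x.
        \<tau> 0 = 0 \<and> (\<forall>i<N. \<tau> i < \<tau> (Suc i)) \<and>
        (\<forall>i\<le>N. d i \<noteq> 0) \<and>
        continuous_on {0..\<tau> N} x \<and>
        x C1_differentiable_on ({0..\<tau> N} - \<tau> ` {0..N}) \<and>
        (\<forall>t\<in>{0..<\<tau> N}. \<exists>D. (x has_vector_derivative D) (at_right t)) \<and>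
        (\<forall>i<N. \<forall>t\<in>{\<tau> i..<\<tau> (Suc i)}.
           (x has_vector_derivative closed_loop f g k \<theta> (\<theta> + d i) (x t)) (at_right t)) \<and>
        (\<forall>i<N. \<forall>j\<le>i. \<forall>t\<in>{\<tau> j..\<tau> (Suc j)}. g (x t) (k (\<theta> + d j) (x t)) *v d (Suc i) = 0)
        \<longrightarrow> (\<forall>t\<in>{0..\<tau> N}. x t = 0))"

text \<open>The event time \<open>r\<^sub>i\<close> determined by the state \<open>\<xi>\<close> and the estimate \<open>\<eta>\<close> at time \<open>s = \<tau>\<^sub>i\<close>.
  The trajectory \<open>z\<close> is the flow started at \<open>\<xi>\<close> with frozen estimate, on its interval of existence;
  in \<open>ereal\<close> the infimum of the empty set is \<open>\<infinity>\<close>.\<close>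

definition trigger_time ::
    "(real^'n \<Rightarrow> real^'m \<Rightarrow> real^'n) \<Rightarrow> (real^'n \<Rightarrow> real^'m \<Rightarrow> real^'l^'n) \<Rightarrow>
     (real^'l \<Rightarrow> real^'n \<Rightarrow> real^'m) \<Rightarrow> (real^'l \<Rightarrow> real^'n \<Rightarrow> real) \<Rightarrow>
     (real^'l \<Rightarrow> real^'n \<Rightarrow> real) \<Rightarrow> (real^'n \<Rightarrow> real) \<Rightarrow> real \<Rightarrow>
     real^'l \<Rightarrow> real^'l \<Rightarrow> real \<Rightarrow> real^'n \<Rightarrow> ereal" where
  "trigger_time f g k V Q a T \<theta> \<eta> s \<xi> =
     (if \<xi> \<noteq> 0 then
        Inf (ereal ` {t. s < t \<and>
          (\<exists>z. ode_solution_on (closed_loop f g k \<theta> \<eta>) {s..t} z \<and> z s = \<xi> \<and>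
               V \<eta> (z t) = Q \<eta> \<xi> + a \<xi>)})
      else ereal (s + T))"

text \<open>The integral \<open>LBINT s=\<sigma>..t\<close> is oriented, so both signals are defined for \<open>t < \<sigma>\<close> as well.\<close>

definition p_signal ::
    "(real^'n \<Rightarrow> real^'m \<Rightarrow> real^'n) \<Rightarrow> (real \<Rightarrow> real^'n) \<Rightarrow> (real \<Rightarrow> real^'m) \<Rightarrow>
     real \<Rightarrow> real \<Rightarrow> real^'n" where
  "p_signal f x u t \<sigma> = x t - x \<sigma> - (LBINT s=ereal \<sigma>..ereal t. f (x s) (u s))"

definition q_signal ::
    "(real^'n \<Rightarrow> real^'m \<Rightarrow> real^'l^'n) \<Rightarrow> (real \<Rightarrow> real^'n) \<Rightarrow> (real \<Rightarrow> real^'m) \<Rightarrow>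
     real \<Rightarrow> real \<Rightarrow> real^'l^'n" where
  "q_signal g x u t \<sigma> = (LBINT s=ereal \<sigma>..ereal t. g (x s) (u s))"

definition G_matrix ::
    "(real^'n \<Rightarrow> real^'m \<Rightarrow> real^'l^'n) \<Rightarrow> (real \<Rightarrow> real^'n) \<Rightarrow> (real \<Rightarrow> real^'m) \<Rightarrow>
     real \<Rightarrow> real \<Rightarrow> real^'l^'l" where
  "G_matrix g x u \<tau> \<mu> =
     (LBINT t=ereal \<mu>..ereal \<tau>. (LBINT \<sigma>=ereal \<mu>..ereal \<tau>.
        transpose (q_signal g x u t \<sigma>) ** q_signal g x u t \<sigma>))"

definition Z_vector ::
    "(real^'n \<Rightarrow> real^'m \<Rightarrow> real^'n) \<Rightarrow> (real^'n \<Rightarrow> real^'m \<Rightarrow> real^'l^'n) \<Rightarrow>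
     (real \<Rightarrow> real^'n) \<Rightarrow> (real \<Rightarrow> real^'m) \<Rightarrow> real \<Rightarrow> real \<Rightarrow> real^'l" where
  "Z_vector f g x u \<tau> \<mu> =
     (LBINT t=ereal \<mu>..ereal \<tau>. (LBINT \<sigma>=ereal \<mu>..ereal \<tau>.
        transpose (q_signal g x u t \<sigma>) *v p_signal f x u t \<sigma>))"

definition window_start :: "real \<Rightarrow> nat \<Rightarrow> (nat \<Rightarrow> real) \<Rightarrow> nat \<Rightarrow> real" where
  "window_start T Nt \<tau> i = Min {\<tau> j | j. j \<le> i \<and> \<tau> j \<ge> \<tau> (Suc i) - real Nt * T}"

text \<open>\<open>hybrid_solution f g k V Q a T Nt \<theta> b x u \<eta> \<tau>\<close>: the state \<open>x\<close>, input \<open>u\<close> and estimate \<open>\<eta>\<close> with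
  event times \<open>\<tau>\<close> form a solution of the hybrid closed-loop system on \<open>[0,b)\<close>, where \<open>0 < b \<le> \<infinity>\<close>.
  Values of the signals outside \<open>[0,b)\<close> play no role, and neither do event times after the first
  one in \<open>[b,\<infinity>)\<close>. Events do not accumulate inside \<open>[0,b)\<close>; a solution whose event times
  accumulate at a finite time is a solution on \<open>[0,b)\<close> with \<open>b\<close> at most the accumulation point,
  and is not defined for all \<open>t \<ge> 0\<close>.\<close>

definition hybrid_solution ::
    "(real^'n \<Rightarrow> real^'m \<Rightarrow> real^'n) \<Rightarrow> (real^'n \<Rightarrow> real^'m \<Rightarrow> real^'l^'n) \<Rightarrow>
     (real^'l \<Rightarrow> real^'n \<Rightarrow> real^'m) \<Rightarrow> (real^'l \<Rightarrow> real^'n \<Rightarrow> real) \<Rightarrow>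
     (real^'l \<Rightarrow> real^'n \<Rightarrow> real) \<Rightarrow> (real^'n \<Rightarrow> real) \<Rightarrow> real \<Rightarrow> nat \<Rightarrow> real^'l \<Rightarrow> ereal \<Rightarrow>
     (real \<Rightarrow> real^'n) \<Rightarrow> (real \<Rightarrow> real^'m) \<Rightarrow> (real \<Rightarrow> real^'l) \<Rightarrow> (nat \<Rightarrow> real) \<Rightarrow> bool" where
  "hybrid_solution f g k V Q a T Nt \<theta> b x u \<eta> \<tau> \<longleftrightarrow>
     0 < b \<and> \<tau> 0 = 0 \<and> strict_mono \<tau> \<and>
     (\<forall>t\<ge>0. ereal t < b \<longrightarrow> (\<exists>i. t < \<tau> i)) \<and>
     continuous_on {t. 0 \<le> t \<and> ereal t < b} x \<and>
     (\<forall>i. ereal (\<tau> i) < b \<longrightarrow>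
        (let I = {t. \<tau> i \<le> t \<and> t < \<tau> (Suc i) \<and> ereal t < b} in
           \<forall>t\<in>I. u t = k (\<eta> (\<tau> i)) (x t) \<and> \<eta> t = \<eta> (\<tau> i) \<and>
             (x has_vector_derivative f (x t) (u t) + g (x t) (u t) *v \<theta>) (at t within I)) \<and>
        ereal (\<tau> (Suc i)) =
          min (ereal (\<tau> i + T)) (trigger_time f g k V Q a T \<theta> (\<eta> (\<tau> i)) (\<tau> i) (x (\<tau> i)))) \<and>
     (\<forall>i. ereal (\<tau> (Suc i)) < b \<longrightarrow>
        (let \<mu> = window_start T Nt \<tau> i in
           {\<zeta>. is_arg_min (\<lambda>\<zeta>. (norm (\<zeta> - \<eta> (\<tau> i)))\<^sup>2)
                 (\<lambda>\<zeta>. Z_vector f g x u (\<tau> (Suc i)) \<mu> = G_matrix g x u (\<tau> (Suc i)) \<mu> *v \<zeta>) \<zeta>}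
           = {\<eta> (\<tau> (Suc i))}))"

end

theory Submission
  imports Defs
begin

text \<open>
  Let \<open>e\<^sub>i = \<eta>(\<tau>\<^sub>i) - \<theta>\<close> be the estimation error at the \<open>i\<close>-th event. Integrating the plant equation
  gives \<open>p = q \<theta>\<close>, so the solution set of the normal equation \<open>Z = G \<zeta>\<close> is \<open>\<theta> + ker G\<close>, and the
  update projects the old estimate onto it. Hence \<open>\<bar>e\<^sub>i\<bar>\<close> never grows, \<open>e\<^sub>i = 0\<close> persists, and
  \<open>e\<^sub>i\<^sub>+\<^sub>1 \<in> ker G\<close>. As \<open>e \<bullet> G e\<close> is the double integral of \<open>\<bar>q e\<bar>\<^sup>2\<close>, the latter means that
  \<open>g(x,u) e\<^sub>i\<^sub>+\<^sub>1\<close> vanishes on the whole window (\<open>true_parameter_solves_normal_equation\<close>,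
  \<open>normal_equation_kernel\<close>, \<open>hybrid_update\<close>).

  Events are at most \<open>T\<close> apart and the window is longer than \<open>N T\<close>, so the first \<open>N\<close> windows start
  at time \<open>0\<close>. If none of \<open>e\<^sub>0, \<dots>, e\<^sub>N\<close> were zero, the trajectory up to \<open>\<tau>\<^sub>N\<close> would satisfy the premises
  of the observability hypothesis and vanish. Thus a nonzero initial state forces \<open>e\<^sub>N = 0\<close>, and
  \<open>\<tau>\<^sub>N \<le> N T\<close> (\<open>hybrid_identification\<close>).

  With an exact estimate \<open>V \<le> Q < Q + a\<close> along the motion, so no event is triggered before the time
  \<open>T\<close> has passed; the same spacing holds at the zero state by definition. Events therefore do not
  accumulate, and from \<open>\<tau>\<^sub>N\<close> on the state follows the nominal closed loop, which is globally
  asymptotically stable (\<open>hybrid_nominal_after_identification\<close>).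

  Between events the triggering rule keeps \<open>V\<close> below \<open>Q + a\<close> at the last event. All estimates lie in a
  compact ball, on which this inequality turns bounds for the state at an event into bounds up to the
  next one, small bounds into small ones. Over \<open>N\<close> events, and once more for the nominal motion, this
  yields boundedness and stability uniformly on balls of initial states. A globally asymptotically
  stable equilibrium attracts uniformly on balls, because solutions depend continuously on the
  initial state (\<open>nominal_uniform_attraction\<close>). Out of these three uniform properties a majorant of
  class \<open>KL\<close> is built (\<open>class_KL_majorant\<close>).

  On a sampling interval the motion is confined to a compact sublevel set of \<open>V\<close>, so it exists by
  Picard's theorem for a vector field that is cut off outside a ball. Concatenating these motions and
  updates yields a solution up to the supremum of its event times, which the identification argument
  shows to be infinite (\<open>hybrid_solution_exists\<close>); determinism of each step yields uniqueness
  (\<open>hybrid_solution_unique\<close>).\<close>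

section \<open>Vector fields that are Lipschitz on balls\<close>

text \<open>This form of local Lipschitz continuity gives one constant for all trajectories inside a given
  ball, and it is closed under composition because a Lipschitz function maps balls into balls.\<close>

definition lipschitz_on_balls :: "('a::real_normed_vector \<Rightarrow> 'b::real_normed_vector) \<Rightarrow> bool" where
  "lipschitz_on_balls h \<longleftrightarrow> (\<forall>R. \<exists>L. L-lipschitz_on (cball 0 R) h)"

lemma lipschitz_on_balls_continuous:
  assumes "lipschitz_on_balls h" shows "continuous_on UNIV h"
proof -
  have "isCont h x" for x
  proof -
    obtain L where "L-lipschitz_on (cball 0 (norm x + 1)) h"
      using assms unfolding lipschitz_on_balls_def by blast
    then have "continuous_on (ball 0 (norm x + 1)) h"
      by (meson ball_subset_cball continuous_on_subset lipschitz_on_continuous_on)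
    then show ?thesis
      by (simp add: continuous_on_eq_continuous_at)
  qed
  then show ?thesis
    by (simp add: continuous_at_imp_continuous_on)
qed

text \<open>The partial derivatives are continuous, hence bounded on a compact ball, and their bounds add up
  to a bound for the operator norm of the derivative; the ball is convex, so the mean value
  inequality applies.\<close>

lemma smooth_lipschitz_on_balls:
  fixes h :: "'a::euclidean_space \<Rightarrow> 'b::real_normed_vector"
  assumes "smooth h"
  shows "lipschitz_on_balls h"
  unfolding lipschitz_on_balls_def
proof
  fix R :: real
  let ?D = "\<lambda>x. frechet_derivative h (at x)"
  have class1: "differentiable_of_class (Suc 0) h"
    using assms unfolding smooth_def by blast
  then have der: "(h has_derivative ?D x) (at x)" for x
    by (simp add: frechet_derivative_works)
  have "\<exists>C. \<forall>x\<in>cball 0 R. norm (?D x b) \<le> C" for b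
  proof -
    have "continuous_on UNIV (\<lambda>x. ?D x b)"
      using class1 by simp
    then have "compact ((\<lambda>x. ?D x b) ` cball 0 R)"
      by (intro compact_continuous_image compact_cball) (rule continuous_on_subset, auto)
    then have "bounded ((\<lambda>x. ?D x b) ` cball 0 R)"
      by (rule compact_imp_bounded)
    then show ?thesis
      by (simp add: bounded_iff)
  qed
  then have "\<forall>b. \<exists>C. \<forall>x\<in>cball 0 R. norm (?D x b) \<le> C"
    by simp
  from choice[OF this] obtain C where C: "\<And>b x. x \<in> cball 0 R \<Longrightarrow> norm (?D x b) \<le> C b"
    by blast
  define B where "B = (\<Sum>b\<in>Basis. \<bar>C b\<bar>)"
  have "onorm (?D x) \<le> B" if "x \<in> cball 0 R" for x
  proof (rule onorm_le)
    fix v :: 'a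
    interpret D: bounded_linear "?D x"
      using der has_derivative_bounded_linear by blast
    have "?D x v = ?D x (\<Sum>b\<in>Basis. (v \<bullet> b) *\<^sub>R b)"
      by (simp add: euclidean_representation)
    also have "\<dots> = (\<Sum>b\<in>Basis. (v \<bullet> b) *\<^sub>R ?D x b)"
      by (simp add: D.sum D.scaleR)
    also have "norm \<dots> \<le> (\<Sum>b\<in>Basis. \<bar>C b\<bar> * norm v)"
    proof (rule order_trans[OF norm_sum sum_mono])
      fix b :: 'a assume b: "b \<in> Basis"
      have "norm (?D x b) \<le> \<bar>C b\<bar>"
        using C[OF that, of b] by linarith
      moreover have "\<bar>v \<bullet> b\<bar> \<le> norm v"
        using b by (simp add: Basis_le_norm)
      ultimately show "norm ((v \<bullet> b) *\<^sub>R ?D x b) \<le> \<bar>C b\<bar> * norm v"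
        by (simp add: mult.commute mult_mono)
    qed
    finally show "norm (?D x v) \<le> B * norm v"
      by (simp add: B_def sum_distrib_right)
  qed
  then have "norm (h x - h y) \<le> B * norm (x - y)" if "x \<in> cball 0 R" "y \<in> cball 0 R" for x y
    using differentiable_bound[of "cball 0 R" h ?D B x y] der that
    by (meson convex_cball has_derivative_at_withinI)
  moreover have "B \<ge> 0"
    by (simp add: B_def sum_nonneg)
  ultimately have "B-lipschitz_on (cball 0 R) h"
    by (intro lipschitz_onI) (simp_all add: dist_norm)
  then show "\<exists>L. L-lipschitz_on (cball 0 R) h" ..
qed

lemma lipschitz_on_balls_bounded:
  assumes "lipschitz_on_balls h"
  obtains B where "\<And>x. norm x \<le> R \<Longrightarrow> norm (h x) \<le> B"
proof -
  obtain L where L: "L-lipschitz_on (cball 0 \<bar>R\<bar>) h"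
    using assms unfolding lipschitz_on_balls_def by blast
  have "norm (h x) \<le> norm (h 0) + L * \<bar>R\<bar>" if "norm x \<le> R" for x
  proof -
    have "dist (h x) (h 0) \<le> L * dist x 0"
      using L that by (intro lipschitz_onD[OF L]) auto
    also have "\<dots> \<le> L * \<bar>R\<bar>"
      using that lipschitz_on_nonneg[OF L] by (intro mult_left_mono) auto
    finally show ?thesis
      using norm_triangle_sub[of "h x" "h 0"] by (simp add: dist_norm)
  qed
  then show thesis using that by blast
qed

lemma lipschitz_on_balls_compose:
  assumes h: "lipschitz_on_balls h" and e: "lipschitz_on_balls e"
  shows "lipschitz_on_balls (\<lambda>x. e (h x))"
  unfolding lipschitz_on_balls_def
proof
  fix R
  obtain B where B: "\<And>x. norm x \<le> R \<Longrightarrow> norm (h x) \<le> B"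
    using lipschitz_on_balls_bounded[OF h] by blast
  obtain L where L: "L-lipschitz_on (cball 0 R) h"
    using h unfolding lipschitz_on_balls_def by blast
  obtain M where "M-lipschitz_on (cball 0 B) e"
    using e unfolding lipschitz_on_balls_def by blast
  then have "M-lipschitz_on (h ` cball 0 R) e"
    by (rule lipschitz_on_subset) (auto simp: B)
  then show "\<exists>L. L-lipschitz_on (cball 0 R) (\<lambda>x. e (h x))"
    using lipschitz_on_compose2[OF L] by blast
qed

lemma lipschitz_on_balls_Pair:
  assumes "lipschitz_on_balls h" "lipschitz_on_balls e"
  shows "lipschitz_on_balls (\<lambda>x. (h x, e x))"
  unfolding lipschitz_on_balls_def
proof
  fix R
  obtain L M where "L-lipschitz_on (cball 0 R) h" "M-lipschitz_on (cball 0 R) e"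
    using assms unfolding lipschitz_on_balls_def by blast
  from lipschitz_on_Pair[OF this] show "\<exists>L. L-lipschitz_on (cball 0 R) (\<lambda>x. (h x, e x))" ..
qed

lemma lipschitz_on_balls_add:
  assumes "lipschitz_on_balls h" "lipschitz_on_balls e"
  shows "lipschitz_on_balls (\<lambda>x. h x + e x)"
  unfolding lipschitz_on_balls_def
proof
  fix R
  obtain L M where "L-lipschitz_on (cball 0 R) h" "M-lipschitz_on (cball 0 R) e"
    using assms unfolding lipschitz_on_balls_def by blast
  from lipschitz_on_add[OF this] show "\<exists>L. L-lipschitz_on (cball 0 R) (\<lambda>x. h x + e x)" ..
qed

lemma bounded_linear_lipschitz_on_balls:
  assumes "bounded_linear h"
  shows "lipschitz_on_balls h"
proof -
  obtain B where "B-lipschitz_on UNIV h"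
    using bounded_linear.lipschitz_boundE[OF assms] by blast
  then show ?thesis
    unfolding lipschitz_on_balls_def by (meson lipschitz_on_subset subset_UNIV)
qed

lemma bounded_linear_matrix_vector_mult_left:
  "bounded_linear (\<lambda>A :: real^'l^'n. A *v d)"
  by (rule linear_conv_bounded_linear[THEN iffD1])
     (auto intro!: linearI simp: matrix_vector_mult_add_rdistrib scaleR_matrix_vector_assoc)

lemma lipschitz_on_balls_closed_loop:
  fixes f :: "real^'n \<Rightarrow> real^'m \<Rightarrow> real^'n" and g :: "real^'n \<Rightarrow> real^'m \<Rightarrow> real^'l^'n"
    and k :: "real^'l \<Rightarrow> real^'n \<Rightarrow> real^'m"
  assumes "smooth (\<lambda>(x, u). f x u)" "smooth (\<lambda>(x, u). g x u)" "smooth (\<lambda>(\<theta>, x). k \<theta> x)"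
  shows "lipschitz_on_balls (closed_loop f g k \<theta> \<eta>)"
proof -
  have id: "lipschitz_on_balls (\<lambda>x :: real^'n. x)"
    by (intro bounded_linear_lipschitz_on_balls bounded_linear_ident)
  have "lipschitz_on_balls (\<lambda>x :: real^'n. (\<eta>, x))"
    unfolding lipschitz_on_balls_def by (auto intro!: exI[of _ 1] lipschitz_onI simp: dist_Pair_Pair)
  from lipschitz_on_balls_compose[OF this smooth_lipschitz_on_balls[OF assms(3)]]
  have "lipschitz_on_balls (\<lambda>x. (x, k \<eta> x))"
    by (intro lipschitz_on_balls_Pair id) simp
  note * = this
  have "lipschitz_on_balls (\<lambda>x. f x (k \<eta> x))"
    using lipschitz_on_balls_compose[OF * smooth_lipschitz_on_balls[OF assms(1)]] by simp
  moreover have "lipschitz_on_balls (\<lambda>x. g x (k \<eta> x) *v \<theta>)"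
    using lipschitz_on_balls_compose[OF lipschitz_on_balls_compose[OF * smooth_lipschitz_on_balls[OF assms(2)]]
        bounded_linear_lipschitz_on_balls[OF bounded_linear_matrix_vector_mult_left[of \<theta>]]] by simp
  ultimately show ?thesis
    unfolding closed_loop_def[abs_def] by (rule lipschitz_on_balls_add)
qed

lemma ode_solution_on_subset:
  "ode_solution_on F I x \<Longrightarrow> J \<subseteq> I \<Longrightarrow> ode_solution_on F J x"
  unfolding ode_solution_on_def by (meson has_vector_derivative_within_subset subsetD)

lemma ode_solution_on_continuous: "ode_solution_on F I x \<Longrightarrow> continuous_on I x"
  unfolding ode_solution_on_def
  by (meson continuous_on_eq_continuous_within has_vector_derivative_continuous)

lemma ode_solution_on_shift:
  assumes "ode_solution_on F I x" and "\<And>t. t \<in> J \<Longrightarrow> t + c \<in> I"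
  shows "ode_solution_on F J (\<lambda>t. x (t + c))"
  unfolding ode_solution_on_def
proof
  fix t assume t: "t \<in> J"
  have "(x has_vector_derivative F (x (t + c))) (at (t + c) within I)"
    using assms t unfolding ode_solution_on_def by blast
  then have "(x has_vector_derivative F (x (t + c))) (at (t + c) within (\<lambda>t. t + c) ` J)"
    by (rule has_vector_derivative_within_subset) (use assms(2) in auto)
  moreover have "((\<lambda>t. t + c) has_vector_derivative 1) (at t within J)"
    by (auto intro!: derivative_eq_intros)
  ultimately show "((\<lambda>t. x (t + c)) has_vector_derivative F (x (t + c))) (at t within J)"
    using vector_diff_chain_within[of "\<lambda>t. t + c" 1 t J x "F (x (t + c))"] by (simp add: o_def)
qed

lemma ode_solution_on_cong:
  assumes "ode_solution_on F I x" and "\<And>t. t \<in> I \<Longrightarrow> y t = x t"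
  shows "ode_solution_on F I y"
  using assms unfolding ode_solution_on_def
  by (metis has_vector_derivative_transform)

text \<open>Gronwall's inequality without integrals: \<open>\<bar>x - y\<bar>\<^sup>2 e\<^bsup>-2L(t-s)\<^esup>\<close> has a nonpositive derivative. It
  serves both for uniqueness and for Lipschitz dependence on the initial state.\<close>

lemma ode_solutions_separate_exponentially:
  fixes x y :: "real \<Rightarrow> 'a::real_inner"
  assumes F: "L-lipschitz_on S F" and "s \<le> t"
    and x: "ode_solution_on F {s..t} x" "\<And>r. r \<in> {s..t} \<Longrightarrow> x r \<in> S"
    and y: "ode_solution_on F {s..t} y" "\<And>r. r \<in> {s..t} \<Longrightarrow> y r \<in> S"
  shows "norm (x t - y t) \<le> exp (L * (t - s)) * norm (x s - y s)"
proof -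
  have rearrange: "2 * A * E + - 2 * L * E * B = (2 * A - 2 * L * B) * E" for A B E :: real
    by (simp add: algebra_simps)
  let ?w = "\<lambda>r. x r - y r"
  let ?\<phi> = "\<lambda>r. (?w r \<bullet> ?w r) * exp (- 2 * L * (r - s))"
  have "?\<phi> t \<le> ?\<phi> s"
  proof (rule DERIV_nonpos_imp_decreasing_open[OF \<open>s \<le> t\<close>])
    show "continuous_on {s..t} ?\<phi>"
      by (intro continuous_intros ode_solution_on_continuous[OF x(1)] ode_solution_on_continuous[OF y(1)])
  next
    fix r assume r: "s < r" "r < t"
    then have at: "at r within {s..t} = at r"
      by (simp add: at_within_Icc_at)
    have dx: "(x has_vector_derivative F (x r)) (at r)" and dy: "(y has_vector_derivative F (y r)) (at r)"
      using bspec[OF x(1)[unfolded ode_solution_on_def], of r]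
        bspec[OF y(1)[unfolded ode_solution_on_def], of r] r at by simp_all
    let ?v = "F (x r) - F (y r)"
    have dw: "(?w has_vector_derivative ?v) (at r)"
      by (intro has_vector_derivative_diff dx dy)
    have "((\<lambda>r. ?w r \<bullet> ?w r) has_vector_derivative (?w r \<bullet> ?v + ?v \<bullet> ?w r)) (at r)"
      by (rule bounded_bilinear.has_vector_derivative[OF bounded_bilinear_inner dw dw])
    then have "((\<lambda>r. ?w r \<bullet> ?w r) has_real_derivative 2 * (?w r \<bullet> ?v)) (at r)"
      by (simp add: has_real_derivative_iff_has_vector_derivative inner_commute)
    moreover have "((\<lambda>r. exp (- 2 * L * (r - s))) has_real_derivative - 2 * L * exp (- 2 * L * (r - s))) (at r)"
      by (auto intro!: derivative_eq_intros)
    ultimately have d\<phi>: "(?\<phi> has_real_derivative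
        2 * (?w r \<bullet> ?v) * exp (- 2 * L * (r - s)) + - 2 * L * exp (- 2 * L * (r - s)) * (?w r \<bullet> ?w r)) (at r)"
      by (rule DERIV_mult)
    have "?w r \<bullet> ?v \<le> norm (?w r) * norm ?v"
      by (rule norm_cauchy_schwarz)
    also have "\<dots> \<le> norm (?w r) * (L * norm (?w r))"
      using lipschitz_onD[OF F x(2) y(2), of r r] r by (intro mult_left_mono) (simp_all add: dist_norm)
    also have "\<dots> = L * (?w r \<bullet> ?w r)"
      by (simp only: power2_norm_eq_inner[symmetric] power2_eq_square mult_ac)
    finally have "?w r \<bullet> ?v \<le> L * (?w r \<bullet> ?w r)" .
    then have "(2 * (?w r \<bullet> ?v) - 2 * L * (?w r \<bullet> ?w r)) * exp (- 2 * L * (r - s)) \<le> 0"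
      by (intro mult_nonpos_nonneg) auto
    then have "2 * (?w r \<bullet> ?v) * exp (- 2 * L * (r - s)) + - 2 * L * exp (- 2 * L * (r - s)) * (?w r \<bullet> ?w r) \<le> 0"
      by (simp only: rearrange)
    with d\<phi> show "\<exists>z. (?\<phi> has_real_derivative z) (at r) \<and> z \<le> 0"
      by blast
  qed
  then have "(norm (?w t))\<^sup>2 * exp (- 2 * L * (t - s)) \<le> (norm (?w s))\<^sup>2"
    by (simp add: power2_norm_eq_inner)
  then have le: "(norm (?w t))\<^sup>2 * exp (- (2 * (L * (t - s)))) \<le> (norm (?w s))\<^sup>2"
    by (simp add: mult_ac)
  have "(norm (?w t))\<^sup>2 = (norm (?w t))\<^sup>2 * exp (- (2 * (L * (t - s)))) * exp (2 * (L * (t - s)))"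
    by (simp only: mult.assoc flip: exp_add) simp
  also have "\<dots> \<le> (norm (?w s))\<^sup>2 * exp (2 * (L * (t - s)))"
    by (rule mult_right_mono[OF le]) simp
  also have "\<dots> = (exp (L * (t - s)) * norm (?w s))\<^sup>2"
    by (simp only: exp_double power_mult_distrib mult.commute)
  finally have "(norm (?w t))\<^sup>2 \<le> (exp (L * (t - s)) * norm (?w s))\<^sup>2" .
  then show ?thesis
    by (rule power2_le_imp_le) simp
qed

lemma ode_solution_on_unique:
  fixes x y :: "real \<Rightarrow> 'a::euclidean_space"
  assumes F: "lipschitz_on_balls F" and "s \<le> t"
    and x: "ode_solution_on F {s..t} x" and y: "ode_solution_on F {s..t} y" and "x s = y s"
  shows "x t = y t"
proof -
  have "bounded (x ` {s..t} \<union> y ` {s..t})"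
    by (intro compact_imp_bounded compact_Un compact_continuous_image ode_solution_on_continuous[OF x]
        ode_solution_on_continuous[OF y] compact_Icc)
  then obtain R where "\<forall>z \<in> x ` {s..t} \<union> y ` {s..t}. norm z \<le> R"
    unfolding bounded_iff by blast
  then have R: "x r \<in> cball 0 R" "y r \<in> cball 0 R" if "r \<in> {s..t}" for r
    using that by auto
  obtain L where "L-lipschitz_on (cball 0 R) F"
    using F unfolding lipschitz_on_balls_def by blast
  from ode_solutions_separate_exponentially[OF this \<open>s \<le> t\<close> x _ y] R \<open>x s = y s\<close>
  show ?thesis by simp
qed

section \<open>Existence of solutions\<close>

lemma integral_has_vector_derivative_atLeast:
  fixes h :: "real \<Rightarrow> 'a::banach"
  assumes "continuous_on {a..} h" and "a \<le> t"
  shows "((\<lambda>u. integral {a..u} h) has_vector_derivative h t) (at t within {a..})"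
proof -
  have "continuous_on {a..t + 1} h"
    using assms(1) by (rule continuous_on_subset) auto
  then have "((\<lambda>u. integral {a..u} h) has_vector_derivative h t) (at t within {a..t + 1})"
    using assms(2) by (intro integral_has_vector_derivative) auto
  moreover have "at t within {a..t + 1} = at t within {a..}"
    by (rule at_within_nhd[of t "{..<t + 1}"]) auto
  ultimately show ?thesis by simp
qed

text \<open>Picard iteration on the whole half-line at once: the substitution \<open>x(t) = e\<^bsup>ct\<^esup> y(t)\<close> turns the
  integral equation into a fixed point equation for a bounded continuous function \<open>y\<close>, and for large
  \<open>c\<close> the exponential weight makes the Picard operator a contraction in the supremum norm.\<close>

lemma bounded_lipschitz_ode_solution_exists:
  fixes F :: "'a::euclidean_space \<Rightarrow> 'a"
  assumes F: "L-lipschitz_on UNIV F" and B: "\<And>x. norm (F x) \<le> B"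
  shows "\<exists>x. ode_solution_on F {0..} x \<and> x 0 = \<xi>"
proof -
  have L: "L \<ge> 0" using F by (rule lipschitz_on_nonneg)
  have B0: "B \<ge> 0" using B[of 0] norm_ge_zero[of "F 0"] by linarith
  \<comment> \<open>any rate \<open>c > 0\<close> with \<open>L / c \<le> 1/2\<close> works; the summand \<open>1\<close> covers \<open>L = 0\<close>\<close>
  define c where "c = 2 * (L + 1)"
  have c: "c > 0" "L / c \<le> 1 / 2" using L by (auto simp: c_def field_simps)
  have contF: "continuous_on UNIV F" using F by (rule lipschitz_on_continuous_on)
  define I where "I y s = F (exp (c * s) *\<^sub>R apply_bcontfun y s)" for y :: "real \<Rightarrow>\<^sub>C 'a" and s
  have contI: "continuous_on S (I y)" for y S
    unfolding I_def[abs_def]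
    by (rule continuous_on_compose2[OF contF]) (auto intro!: continuous_intros)
  have intI: "I y integrable_on {a..b}" for y a b
    using contI by (rule integrable_continuous_real)
  define J where "J y t = integral {0..t} (I y)" for y t
  have dJ: "(J y has_vector_derivative I y t) (at t within {0..})" if "t \<ge> 0" for y t
    unfolding J_def[abs_def] using contI that by (rule integral_has_vector_derivative_atLeast)
  have contJ: "continuous_on {0..} (J y)" for y
    using dJ unfolding continuous_on_eq_continuous_within
    by (meson atLeast_iff has_vector_derivative_continuous)
  \<comment> \<open>\<open>max 0 t\<close> extends the Picard operator to a function on all reals, constant on the negative ones\<close>
  define P where "P y t = exp (- c * max 0 t) *\<^sub>R (\<xi> + J y (max 0 t))" for y t
  have contP: "continuous_on UNIV (P y)" for y
    unfolding P_def[abs_def]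
    by (intro continuous_intros continuous_on_compose2[OF contJ]) auto
  have "norm (P y t) \<le> norm \<xi> + B / c" for y t
  proof -
    let ?t = "max 0 t"
    have "norm (J y ?t) \<le> B * ?t"
      unfolding J_def using integral_bound[of 0 ?t "I y" B] contI B by (simp add: I_def)
    then have "norm (P y t) \<le> exp (- c * ?t) * (norm \<xi> + B * ?t)"
      unfolding P_def norm_scaleR using norm_triangle_ineq[of \<xi> "J y ?t"]
      by (simp add: mult_left_mono)
    also have "\<dots> = exp (- c * ?t) * norm \<xi> + B * (exp (- c * ?t) * ?t)"
      by (simp add: algebra_simps)
    also have "\<dots> \<le> 1 * norm \<xi> + B * (1 / c)"
    proof (intro add_mono mult_mono mult_left_mono)
      have "1 + c * ?t \<le> exp (c * ?t)" by (rule exp_ge_add_one_self)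
      then have "c * ?t \<le> exp (c * ?t)" by linarith
      then show "exp (- c * ?t) * ?t \<le> 1 / c"
        using c by (simp add: exp_minus field_simps)
    qed (use c B0 in \<open>auto simp: zero_le_mult_iff\<close>)
    finally show ?thesis by simp
  qed
  then have "P y \<in> bcontfun" for y
    unfolding bcontfun_def using contP by (auto simp: bounded_iff)
  then have P: "apply_bcontfun (Bcontfun (P y)) = P y" for y
    by (rule Bcontfun_inverse)
  have contraction: "dist (Bcontfun (P y)) (Bcontfun (P z)) \<le> 1 / 2 * dist y z" for y z
  proof (rule dist_bound, unfold P)
    fix t :: real
    let ?t = "max 0 t" and ?D = "dist y z"
    have "norm (J y ?t - J z ?t) = norm (integral {0..?t} (\<lambda>s. I y s - I z s))"
      unfolding J_def by (simp add: integral_diff intI)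
    also have "\<dots> \<le> integral {0..?t} (\<lambda>s. L * ?D * exp (c * s))"
    proof (rule integral_norm_bound_integral)
      show "(\<lambda>s. I y s - I z s) integrable_on {0..?t}"
        by (intro integrable_diff intI)
      show "(\<lambda>s. L * ?D * exp (c * s)) integrable_on {0..?t}"
        by (intro integrable_continuous_real continuous_intros)
      fix s :: real
      have "norm (I y s - I z s) \<le> L * dist (exp (c * s) *\<^sub>R y s) (exp (c * s) *\<^sub>R z s)"
        unfolding I_def dist_norm[symmetric] by (rule lipschitz_onD[OF F]) auto
      also have "\<dots> = L * (exp (c * s) * dist (y s) (z s))"
        by (simp add: dist_norm flip: scaleR_diff_right)
      also have "\<dots> \<le> L * (exp (c * s) * ?D)"
        using L dist_bounded[of y s z] by (intro mult_left_mono) auto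
      finally show "norm (I y s - I z s) \<le> L * ?D * exp (c * s)"
        by (simp add: mult_ac)
    qed
    also have "\<dots> = L * ?D * ((exp (c * ?t) - 1) / c)"
    proof -
      have "((\<lambda>s. exp (c * s)) has_integral exp (c * ?t) / c - exp (c * 0) / c) {0..?t}"
        using c by (intro fundamental_theorem_of_calculus)
          (auto intro!: derivative_eq_intros simp flip: has_real_derivative_iff_has_vector_derivative)
      then have "integral {0..?t} (\<lambda>s. exp (c * s)) = (exp (c * ?t) - 1) / c"
        by (simp add: integral_unique diff_divide_distrib)
      then show ?thesis by simp
    qed
    also have "\<dots> \<le> L * ?D * (exp (c * ?t) / c)"
      using c L by (intro mult_left_mono divide_right_mono) auto
    finally have "exp (- c * ?t) * norm (J y ?t - J z ?t) \<le> exp (- c * ?t) * (L * ?D * (exp (c * ?t) / c))"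
      by (rule mult_left_mono) simp
    also have "\<dots> = L / c * ?D"
      using c by (simp add: exp_minus field_simps)
    also have "\<dots> \<le> 1 / 2 * ?D"
      using c(2) by (rule mult_right_mono) simp
    finally show "dist (P y t) (P z t) \<le> 1 / 2 * ?D"
      unfolding P_def dist_norm by (simp flip: scaleR_diff_right)
  qed
  have "\<exists>!y. Bcontfun (P y) = y"
    using contraction by (intro banach_fix_type[of "1/2"]) auto
  then obtain y where "Bcontfun (P y) = y" by blast
  with P[of y] have y: "y t = P y t" for t by simp
  define x where "x t = exp (c * t) *\<^sub>R y t" for t
  have x: "x t = \<xi> + J y t" if "t \<ge> 0" for t
    unfolding x_def y P_def using that by (simp flip: exp_add)
  have "ode_solution_on F {0..} x"
    unfolding ode_solution_on_def
  proof
    fix t :: real assume t: "t \<in> {0..}"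
    have "((\<lambda>t. \<xi> + J y t) has_vector_derivative F (x t)) (at t within {0..})"
      using dJ[of t y] t has_vector_derivative_add[OF has_vector_derivative_const[of \<xi>]]
      by (fastforce simp: I_def x_def)
    then show "(x has_vector_derivative F (x t)) (at t within {0..})"
      by (rule has_vector_derivative_transform[OF t, rotated]) (simp add: x)
  qed
  moreover have "x 0 = \<xi>"
    using x[of 0] by (simp add: J_def)
  ultimately show ?thesis by blast
qed

text \<open>Composing the vector field with the metric projection onto the ball makes it bounded and globally
  Lipschitz and leaves it unchanged inside the ball.\<close>

lemma ode_solution_while_in_ball_exists:
  fixes F :: "'a::euclidean_space \<Rightarrow> 'a"
  assumes F: "lipschitz_on_balls F" and R: "R \<ge> 0"
  obtains x where "x 0 = \<xi>" "continuous_on {0..} x"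
    "\<And>t. (\<forall>r\<in>{0..t}. norm (x r) \<le> R) \<Longrightarrow> ode_solution_on F {0..t} x"
proof -
  let ?p = "closest_point (cball (0::'a) R)"
  have ne: "cball (0::'a) R \<noteq> {}" using R by simp
  have p: "?p x \<in> cball 0 R" for x
    using ne by (intro closest_point_in_set) auto
  obtain L where L: "L-lipschitz_on (cball 0 R) F"
    using F unfolding lipschitz_on_balls_def by blast
  obtain B where B: "\<And>x. norm x \<le> R \<Longrightarrow> norm (F x) \<le> B"
    using lipschitz_on_balls_bounded[OF F] by blast
  have "1-lipschitz_on UNIV ?p"
    using ne by (intro lipschitz_onI) (auto intro: closest_point_lipschitz)
  moreover have "L-lipschitz_on (range ?p) F"
    using L by (rule lipschitz_on_subset) (use p in auto)
  ultimately have "(L * 1)-lipschitz_on UNIV (\<lambda>x. F (?p x))"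
    by (rule lipschitz_on_compose2)
  moreover have "norm (F (?p x)) \<le> B" for x
    using p B by simp
  ultimately obtain x where x: "ode_solution_on (\<lambda>x. F (?p x)) {0..} x" "x 0 = \<xi>"
    using bounded_lipschitz_ode_solution_exists by blast
  show thesis
  proof
    show "x 0 = \<xi>" by fact
    show "continuous_on {0..} x" using x(1) by (rule ode_solution_on_continuous)
    fix t assume in_ball: "\<forall>r\<in>{0..t}. norm (x r) \<le> R"
    have "ode_solution_on (\<lambda>x. F (?p x)) {0..t} x"
      using x(1) by (rule ode_solution_on_subset) auto
    moreover have "?p (x r) = x r" if "r \<in> {0..t}" for r
      using in_ball that by (intro closest_point_self) auto
    ultimately show "ode_solution_on F {0..t} x"
      unfolding ode_solution_on_def by auto
  qed
qed

text \<open>As long as \<open>W\<close> has not exceeded the level \<open>c\<close>, the solution stays in a bounded sublevel set and so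
  cannot escape. The time \<open>h\<close> is the first time at which the level is reached, or \<open>T\<close> if that
  happens only later.\<close>

lemma ode_solution_until_level_exists:
  fixes F :: "'a::euclidean_space \<Rightarrow> 'a" and W :: "'a \<Rightarrow> real"
  assumes F: "lipschitz_on_balls F" and W: "continuous_on UNIV W" and bounded: "bounded {x. W x \<le> c}"
    and \<xi>: "W \<xi> < c" and T: "0 < T"
  obtains x h where "0 < h" "h \<le> T" "x 0 = \<xi>" "ode_solution_on F {0..h} x"
    "\<And>t. t \<in> {0..<h} \<Longrightarrow> W (x t) < c" "W (x h) \<le> c" "W (x h) = c \<or> h = T"
proof -
  obtain R where R: "\<And>x. W x \<le> c \<Longrightarrow> norm x \<le> R"
    using bounded unfolding bounded_iff by blast
  have "R \<ge> 0" using order_trans[OF norm_ge_zero R[of \<xi>]] \<xi> by simp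
  then obtain x where x: "x 0 = \<xi>" "continuous_on {0..} x"
    "\<And>t. (\<forall>r\<in>{0..t}. norm (x r) \<le> R) \<Longrightarrow> ode_solution_on F {0..t} x"
    using ode_solution_while_in_ball_exists[OF F] by metis
  have contW: "continuous_on {0..t} (\<lambda>t. W (x t))" for t
    by (rule continuous_on_compose2[OF W]) (auto intro: continuous_on_subset[OF x(2)])
  have sol: "ode_solution_on F {0..h} x" if "\<And>t. t \<in> {0..<h} \<Longrightarrow> W (x t) < c" "W (x h) \<le> c" for h
    using that by (intro x(3)) (force intro!: R simp: less_le)
  have crossing: "\<exists>r\<in>{0..t}. W (x r) = c" if "t \<ge> 0" "W (x t) \<ge> c" for t
    using IVT'[of "\<lambda>t. W (x t)" 0 c t] contW x(1) \<xi> that by force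
  let ?A = "{t \<in> {0..T}. W (x t) = c}"
  show thesis
  proof (cases "?A = {}")
    case True
    then have less: "W (x t) < c" if "t \<in> {0..T}" for t
      using crossing[of t] that by (force simp: not_le[symmetric])
    show thesis
    proof (rule that[of T x, OF T order_refl x(1)])
      show "ode_solution_on F {0..T} x"
        by (rule sol) (use less T in \<open>auto intro: less_imp_le\<close>)
    qed (use less T in \<open>auto intro: less_imp_le\<close>)
  next
    case False
    have "compact ?A"
      unfolding compact_eq_bounded_closed
      using continuous_closed_preimage_constant[OF contW closed_atLeastAtMost]
      by (auto intro: bounded_subset[of "{0..T}"])
    from compact_attains_inf[OF this False] obtain h where
      h: "h \<in> ?A" "\<And>t. t \<in> ?A \<Longrightarrow> h \<le> t" by blast
    have less: "W (x t) < c" if "t \<in> {0..<h}" for t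
    proof (rule ccontr)
      assume "\<not> W (x t) < c"
      with crossing[of t] that obtain r where "r \<in> {0..t}" "W (x r) = c" by auto
      with h(1) h(2)[of r] that show False by auto
    qed
    have "h \<noteq> 0" using h(1) x(1) \<xi> by auto
    show thesis
    proof (rule that[of h x, OF _ _ x(1)])
      show "ode_solution_on F {0..h} x"
        by (rule sol) (use less h(1) in auto)
    qed (use less h(1) \<open>h \<noteq> 0\<close> in auto)
  qed
qed

section \<open>Majorants of class KL\<close>

text \<open>Uniform boundedness, uniform stability and uniform attractivity of a family of signals
  \<open>h a\<close> with sizes \<open>\<rho> a\<close> yield one function of class \<open>KL\<close> above all of them. The supremum of
  \<open>h a \<tau>\<close> over all \<open>\<rho> a \<le> s\<close> and \<open>\<tau> \<ge> t\<close> is a monotone majorant, but it may jump. Therefore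
  \<open>\<psi> s t\<close> also admits somewhat larger signals and earlier times, with a weight that is locally
  Lipschitz in \<open>s\<close> and a weight whose logarithm is Lipschitz in \<open>t\<close>; both properties survive the
  supremum. The
  weight in \<open>s\<close> vanishes for \<open>\<rho> a \<ge> 2s\<close>, so that the supremum is finite however fast \<open>h\<close> grows with
  \<open>\<rho>\<close>. The summand \<open>s e\<^bsup>-t\<^esup>\<close> makes the majorant strictly increasing.\<close>

lemma class_KL_majorant:
  fixes h :: "'a \<Rightarrow> real \<Rightarrow> real" and \<rho> :: "'a \<Rightarrow> real"
  assumes \<rho>: "\<And>a. \<rho> a \<ge> 0" and h: "\<And>a t. t \<ge> 0 \<Longrightarrow> h a t \<ge> 0"
    and bounded: "\<And>R. \<exists>M. \<forall>a t. t \<ge> 0 \<longrightarrow> \<rho> a \<le> R \<longrightarrow> h a t \<le> M"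
    and small: "\<And>\<epsilon>. \<epsilon> > 0 \<Longrightarrow> \<exists>\<delta>>0. \<forall>a t. t \<ge> 0 \<longrightarrow> \<rho> a \<le> \<delta> \<longrightarrow> h a t \<le> \<epsilon>"
    and decay: "\<And>R \<epsilon>. \<epsilon> > 0 \<Longrightarrow> \<exists>t0. \<forall>a t. t \<ge> t0 \<longrightarrow> t \<ge> 0 \<longrightarrow> \<rho> a \<le> R \<longrightarrow> h a t \<le> \<epsilon>"
  obtains \<sigma> where "class_KL \<sigma>" "\<And>a t. t \<ge> 0 \<Longrightarrow> h a t \<le> \<sigma> (\<rho> a) t"
proof -
  define c where "c s r = (if s \<le> 0 then 0 else min 1 (max 0 (2 - r / s)))" for s r :: real
  define w where "w a s t \<tau> = h a \<tau> * c s (\<rho> a) * exp (- max 0 (t - \<tau>))" for a s t \<tau>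
  define A :: "('a \<times> real) set" where "A = UNIV \<times> {0..}"
  define \<psi> where "\<psi> s t = (SUP (a, \<tau>) \<in> A. w a s t \<tau>)" for s t
  have c01: "0 \<le> c s r" "c s r \<le> 1" for s r by (auto simp: c_def)
  have c_zero: "c s r = 0" if "r > 2 * s" "r \<ge> 0" for s r
    using that by (auto simp: c_def field_simps)
  have c_mono: "c s r \<le> c s' r" if "s \<le> s'" "r \<ge> 0" for s s' r
  proof (cases "s \<le> 0")
    case False
    then have "r / s' \<le> r / s" using that by (simp add: frac_le)
    then show ?thesis using False that by (auto simp: c_def)
  qed (use c01 in \<open>auto simp: c_def\<close>)
  have w0: "0 \<le> w a s t \<tau>" if "\<tau> \<ge> 0" for a s t \<tau>
    unfolding w_def using that h c01 by (intro mult_nonneg_nonneg) auto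
  have w_le_h: "w a s t \<tau> \<le> h a \<tau>" if "\<tau> \<ge> 0" for a s t \<tau>
  proof -
    have "c s (\<rho> a) * exp (- max 0 (t - \<tau>)) \<le> 1 * 1"
      using c01 by (intro mult_mono) auto
    then have "h a \<tau> * (c s (\<rho> a) * exp (- max 0 (t - \<tau>))) \<le> h a \<tau> * 1"
      using h[OF that] by (intro mult_left_mono) auto
    then show ?thesis by (simp add: w_def mult.assoc)
  qed
  have w_zero: "w a s t \<tau> = 0" if "\<rho> a > 2 * s" for a s t \<tau>
    using c_zero[OF that \<rho>] by (simp add: w_def)
  have w_bound: "w a s t \<tau> \<le> M" if "\<tau> \<ge> 0" "M \<ge> 0" "\<And>a t. t \<ge> 0 \<Longrightarrow> \<rho> a \<le> 2 * s \<Longrightarrow> h a t \<le> M" for a s t \<tau> M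
  proof (cases "\<rho> a > 2 * s")
    case False
    then show ?thesis using w_le_h[OF that(1), of a s t] that(3)[OF that(1), of a] by linarith
  qed (use w_zero that in simp)
  have A: "A \<noteq> {}" by (auto simp: A_def)
  have psi_le: "\<psi> s t \<le> M" if "\<And>a \<tau>. \<tau> \<ge> 0 \<Longrightarrow> w a s t \<tau> \<le> M" for s t M
    unfolding \<psi>_def using that A by (intro cSUP_least) (auto simp: A_def)
  have bdd: "bdd_above ((\<lambda>(a, \<tau>). w a s t \<tau>) ` A)" for s t
  proof -
    obtain M where "\<forall>a t. t \<ge> 0 \<longrightarrow> \<rho> a \<le> 2 * s \<longrightarrow> h a t \<le> M" using bounded by blast
    then have "w a s t \<tau> \<le> max 0 M" if "\<tau> \<ge> 0" for a \<tau>
      using that by (intro w_bound) (auto simp: le_max_iff_disj)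
    then show ?thesis by (intro bdd_aboveI[of _ "max 0 M"]) (auto simp: A_def)
  qed
  have psi_ge: "w a s t \<tau> \<le> \<psi> s t" if "\<tau> \<ge> 0" for a s t \<tau>
    unfolding \<psi>_def using cSUP_upper[OF _ bdd, of "(a, \<tau>)" s t] that by (simp add: A_def)
  have psi0: "0 \<le> \<psi> s t" for s t
    using order_trans[OF w0 psi_ge, of 0] by simp
  have psi_mono: "\<psi> s t \<le> \<psi> s' t'" if "s \<le> s'" "t' \<le> t" for s s' t t'
  proof (rule psi_le)
    fix a and \<tau> :: real assume \<tau>: "\<tau> \<ge> 0"
    have "w a s t \<tau> \<le> w a s' t' \<tau>"
      unfolding w_def using c_mono[OF that(1) \<rho>] h[OF \<tau>] c01 that
      by (intro mult_mono mult_left_mono mult_nonneg_nonneg) auto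
    then show "w a s t \<tau> \<le> \<psi> s' t'" using psi_ge[OF \<tau>] order_trans by blast
  qed
  \<comment> \<open>the weight in time loses at most the factor \<open>e\<^bsup>-(t'-t)\<^esup>\<close>\<close>
  have psi_time: "exp (- (t' - t)) * \<psi> s t \<le> \<psi> s t'" if "t \<le> t'" for s t t'
  proof -
    have "\<psi> s t \<le> exp (t' - t) * \<psi> s t'"
    proof (rule psi_le)
      fix a and \<tau> :: real assume \<tau>: "\<tau> \<ge> 0"
      have "exp (- max 0 (t - \<tau>)) \<le> exp (t' - t) * exp (- max 0 (t' - \<tau>))"
        using that by (simp flip: exp_add)
      then have "w a s t \<tau> \<le> h a \<tau> * c s (\<rho> a) * (exp (t' - t) * exp (- max 0 (t' - \<tau>)))"
        unfolding w_def using h[OF \<tau>] c01 by (intro mult_left_mono mult_nonneg_nonneg) auto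
      also have "\<dots> = exp (t' - t) * w a s t' \<tau>"
        by (simp add: w_def mult_ac)
      also have "\<dots> \<le> exp (t' - t) * \<psi> s t'"
        using psi_ge[OF \<tau>] by (intro mult_left_mono) auto
      finally show "w a s t \<tau> \<le> exp (t' - t) * \<psi> s t'" .
    qed
    then have "exp (- (t' - t)) * \<psi> s t \<le> exp (- (t' - t)) * (exp (t' - t) * \<psi> s t')"
      by (intro mult_left_mono) auto
    also have "\<dots> = \<psi> s t'"
      by (simp add: mult.assoc[symmetric] flip: exp_add)
    finally show ?thesis .
  qed
  \<comment> \<open>at \<open>s'\<close> only signals with \<open>\<rho> a \<le> 2s'\<close> count, and for these the weight differs from the one
    at \<open>s\<close> by at most \<open>\<rho> a (1/s - 1/s')\<close>\<close>
  have psi_space: "\<psi> s' t \<le> \<psi> s t + M * (2 * (s' - s) / s)"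
    if s: "0 < s" "s \<le> s'" and M: "M \<ge> 0" "\<And>a t. t \<ge> 0 \<Longrightarrow> \<rho> a \<le> 2 * s' \<Longrightarrow> h a t \<le> M" for s s' t M
  proof (rule psi_le)
    fix a and \<tau> :: real assume \<tau>: "\<tau> \<ge> 0"
    show "w a s' t \<tau> \<le> \<psi> s t + M * (2 * (s' - s) / s)"
    proof (cases "\<rho> a > 2 * s'")
      case True
      then show ?thesis using w_zero[OF True] psi0 s M by simp
    next
      case False
      then have h_le: "h a \<tau> \<le> M" using M(2)[OF \<tau>] by simp
      have "c s' (\<rho> a) \<le> c s (\<rho> a) + (\<rho> a / s - \<rho> a / s')"
      proof -
        have "\<rho> a / s' \<le> \<rho> a / s" using s \<rho>[of a] by (simp add: frac_le)
        then have "min 1 (max 0 (2 - \<rho> a / s')) \<le> min 1 (max 0 (2 - \<rho> a / s)) + (\<rho> a / s - \<rho> a / s')"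
          by linarith
        then show ?thesis using s by (simp add: c_def)
      qed
      also have "\<rho> a / s - \<rho> a / s' = (\<rho> a / s') * ((s' - s) / s)"
        using s by (simp add: field_simps)
      also have "\<dots> \<le> 2 * ((s' - s) / s)"
        using s False by (intro mult_right_mono) (auto simp: field_simps)
      finally have "w a s' t \<tau> \<le> h a \<tau> * (c s (\<rho> a) + 2 * ((s' - s) / s)) * exp (- max 0 (t - \<tau>))"
        unfolding w_def using h[OF \<tau>] by (intro mult_right_mono mult_left_mono) auto
      also have "\<dots> = w a s t \<tau> + h a \<tau> * (2 * ((s' - s) / s)) * exp (- max 0 (t - \<tau>))"
        by (simp add: w_def algebra_simps)
      also have "\<dots> \<le> \<psi> s t + M * (2 * ((s' - s) / s)) * 1"
        using h_le h[OF \<tau>] s M by (intro add_mono psi_ge \<tau> mult_mono mult_nonneg_nonneg) auto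
      finally show ?thesis by simp
    qed
  qed
  have psi_0: "\<psi> 0 t = 0" for t
    using psi0[of 0 t] psi_le[of 0 t 0] by (simp add: w_def c_def)
  have time: "isCont (\<psi> s) t" for s t
  proof -
    have lower: "exp (- \<bar>t' - t\<bar>) * \<psi> s t \<le> \<psi> s t'" for t t'
    proof (cases "t \<le> t'")
      case False
      have "exp (- \<bar>t' - t\<bar>) * \<psi> s t \<le> 1 * \<psi> s t"
        using psi0 by (intro mult_right_mono) auto
      then show ?thesis using psi_mono[of s s t' t] False by simp
    qed (use psi_time[of t t' s] in simp)
    have upper: "\<psi> s t' \<le> exp \<bar>t' - t\<bar> * \<psi> s t" for t'
    proof -
      have "exp \<bar>t' - t\<bar> * (exp (- \<bar>t - t'\<bar>) * \<psi> s t') \<le> exp \<bar>t' - t\<bar> * \<psi> s t"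
        by (intro mult_left_mono lower) auto
      then show ?thesis
        by (simp add: mult.assoc[symmetric] abs_minus_commute flip: exp_add)
    qed
    have "(\<psi> s \<longlongrightarrow> \<psi> s t) (at t)"
    proof (rule tendsto_sandwich)
      show "\<forall>\<^sub>F t' in at t. exp (- \<bar>t' - t\<bar>) * \<psi> s t \<le> \<psi> s t'"
        using lower by simp
      show "\<forall>\<^sub>F t' in at t. \<psi> s t' \<le> exp \<bar>t' - t\<bar> * \<psi> s t"
        using upper by simp
    qed (auto intro!: tendsto_eq_intros)
    then show ?thesis by (simp add: isCont_def)
  qed
  have cont: "continuous_on ({0..} \<times> {0..}) (\<lambda>(s, t). \<psi> s t)"
    unfolding continuous_on_def
  proof
    fix z :: "real \<times> real" assume z: "z \<in> {0..} \<times> {0..}"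
    define s0 t0 where "s0 = fst z" and "t0 = snd z"
    have z_eq: "z = (s0, t0)" and s0: "s0 \<ge> 0"
      using z by (auto simp: s0_def t0_def)
    let ?F = "at (s0, t0) within {0..} \<times> {0..}"
    have tendsto_s: "(fst \<longlongrightarrow> s0) ?F" and tendsto_t: "(snd \<longlongrightarrow> t0) ?F"
      by (auto intro!: tendsto_eq_intros)
    have "((\<lambda>z. \<psi> (fst z) (snd z)) \<longlongrightarrow> \<psi> s0 t0) ?F"
    proof (cases "s0 = 0")
      case True
      show ?thesis
      proof (rule tendstoI)
        fix \<epsilon> :: real assume \<epsilon>: "\<epsilon> > 0"
        then obtain \<delta> where \<delta>: "\<delta> > 0" "\<And>a t. t \<ge> 0 \<Longrightarrow> \<rho> a \<le> \<delta> \<Longrightarrow> h a t \<le> \<epsilon> / 2"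
          using small[of "\<epsilon> / 2"] by auto
        have "\<psi> s t \<le> \<epsilon> / 2" if "s < \<delta> / 2" for s t
        proof (intro psi_le w_bound)
          show "h a t \<le> \<epsilon> / 2" if "t \<ge> 0" "\<rho> a \<le> 2 * s" for a t
            using \<delta>(2)[OF that(1), of a] that(2) \<open>s < \<delta> / 2\<close> by simp
        qed (use \<epsilon> in auto)
        moreover have "\<forall>\<^sub>F z in ?F. fst z < \<delta> / 2"
          using order_tendstoD(2)[OF tendsto_s, of "\<delta> / 2"] True \<delta>(1) by simp
        ultimately show "\<forall>\<^sub>F z in ?F. dist (\<psi> (fst z) (snd z)) (\<psi> s0 t0) < \<epsilon>"
        proof (elim eventually_mono)
          fix z :: "real \<times> real"
          assume *: "\<And>s t. s < \<delta> / 2 \<Longrightarrow> \<psi> s t \<le> \<epsilon> / 2" "fst z < \<delta> / 2"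
          have "\<psi> (fst z) (snd z) \<le> \<epsilon> / 2" using * by blast
          then show "dist (\<psi> (fst z) (snd z)) (\<psi> s0 t0) < \<epsilon>"
            using True psi0[of "fst z" "snd z"] \<epsilon> by (simp add: psi_0 dist_real_def)
        qed
      qed
    next
      case False
      then have pos: "s0 > 0" using s0 by auto
      obtain M0 where M0: "\<And>a t. t \<ge> 0 \<Longrightarrow> \<rho> a \<le> 4 * s0 \<Longrightarrow> h a t \<le> M0"
        using bounded by blast
      define M where "M = max 0 M0"
      have M: "M \<ge> 0" "\<And>a t. t \<ge> 0 \<Longrightarrow> \<rho> a \<le> 4 * s0 \<Longrightarrow> h a t \<le> M"
        using M0 by (auto simp: M_def le_max_iff_disj)
      define K where "K = M * (4 / s0)"
      have one_sided: "\<bar>\<psi> s t - \<psi> s' t\<bar> \<le> K * \<bar>s - s'\<bar>"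
        if "s0 / 2 < s" "s \<le> s'" "s' < 2 * s0" for s s' t
      proof -
        have "M * (2 * (s' - s) / s) \<le> M * (2 * (s' - s) / (s0 / 2))"
          using that M(1) pos by (intro mult_left_mono divide_left_mono) auto
        moreover have "\<psi> s' t \<le> \<psi> s t + M * (2 * (s' - s) / s)"
          using that pos by (intro psi_space M) auto
        moreover have "\<psi> s t \<le> \<psi> s' t"
          using that by (intro psi_mono) auto
        moreover have "M * (2 * (s' - s) / (s0 / 2)) = K * (s' - s)"
          by (simp add: K_def)
        ultimately show ?thesis using that by simp
      qed
      show ?thesis
      proof (rule metric_tendsto_imp_tendsto)
        have "((\<lambda>z. \<psi> s0 (snd z)) \<longlongrightarrow> \<psi> s0 t0) ?F"
          by (rule isCont_tendsto_compose[OF time tendsto_t])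
        then show "((\<lambda>z. K * \<bar>fst z - s0\<bar> + \<bar>\<psi> s0 (snd z) - \<psi> s0 t0\<bar>) \<longlongrightarrow> 0) ?F"
          using tendsto_s by (auto intro!: tendsto_eq_intros)
        have "\<forall>\<^sub>F z in ?F. s0 / 2 < fst z" "\<forall>\<^sub>F z in ?F. fst z < 2 * s0"
          using order_tendstoD(1)[OF tendsto_s, of "s0 / 2"] order_tendstoD(2)[OF tendsto_s, of "2 * s0"] pos
          by simp_all
        then show "\<forall>\<^sub>F z in ?F. dist (\<psi> (fst z) (snd z)) (\<psi> s0 t0)
            \<le> dist (K * \<bar>fst z - s0\<bar> + \<bar>\<psi> s0 (snd z) - \<psi> s0 t0\<bar>) 0"
        proof eventually_elim
          case (elim z)
          have "\<bar>\<psi> (fst z) (snd z) - \<psi> s0 (snd z)\<bar> \<le> K * \<bar>fst z - s0\<bar>"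
            using one_sided[of "fst z" s0 "snd z"] one_sided[of s0 "fst z" "snd z"] elim pos
            by (cases "fst z \<le> s0") (auto simp: abs_minus_commute)
          then show ?case by (simp add: dist_real_def)
        qed
      qed
    qed
    then show "((\<lambda>(s, t). \<psi> s t) \<longlongrightarrow> (case z of (s, t) \<Rightarrow> \<psi> s t)) (at z within {0..} \<times> {0..})"
      by (simp add: case_prod_unfold z_eq)
  qed
  have exp_vanishes: "((\<lambda>t. exp (t0 - t)) \<longlongrightarrow> 0) at_top" for t0 :: real
  proof -
    have "((\<lambda>t. exp t0 * exp (- t)) \<longlongrightarrow> exp t0 * 0) at_top"
      by (intro tendsto_intros filterlim_compose[OF exp_at_bot filterlim_uminus_at_bot_at_top])
    then show ?thesis by (simp add: exp_diff exp_minus divide_inverse)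
  qed
  have lim: "(\<psi> s \<longlongrightarrow> 0) at_top" for s
  proof (rule tendstoI)
    fix \<epsilon> :: real assume \<epsilon>: "\<epsilon> > 0"
    obtain t0 where t0: "\<And>a t. t \<ge> t0 \<Longrightarrow> t \<ge> 0 \<Longrightarrow> \<rho> a \<le> 2 * s \<Longrightarrow> h a t \<le> \<epsilon> / 2"
      using decay[of "\<epsilon> / 2" "2 * s"] \<epsilon> by auto
    obtain M where M: "\<And>a t. t \<ge> 0 \<Longrightarrow> \<rho> a \<le> 2 * s \<Longrightarrow> h a t \<le> M"
      using bounded by blast
    have le: "\<psi> s t \<le> \<epsilon> / 2 + \<bar>M\<bar> * exp (t0 - t)" if "t \<ge> t0" for t
    proof (rule psi_le)
      fix a and \<tau> :: real assume \<tau>: "\<tau> \<ge> 0"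
      consider "\<rho> a > 2 * s" | "\<rho> a \<le> 2 * s" "\<tau> \<ge> t0" | "\<rho> a \<le> 2 * s" "\<tau> < t0" by linarith
      then show "w a s t \<tau> \<le> \<epsilon> / 2 + \<bar>M\<bar> * exp (t0 - t)"
      proof cases
        case 1
        then show ?thesis using w_zero[OF 1] \<epsilon> by simp
      next
        case 2
        then show ?thesis using w_le_h[OF \<tau>, of a s t] t0[of \<tau> a] \<tau> by (smt (verit) exp_ge_zero mult_nonneg_nonneg)
      next
        case 3
        have "h a \<tau> * c s (\<rho> a) * exp (- max 0 (t - \<tau>)) \<le> \<bar>M\<bar> * 1 * exp (t0 - t)"
          using M[OF \<tau> 3(1)] h[OF \<tau>] c01 3 that by (intro mult_mono) auto
        then show ?thesis using \<epsilon> by (simp add: w_def)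
      qed
    qed
    have "((\<lambda>t. \<epsilon> / 2 + \<bar>M\<bar> * exp (t0 - t)) \<longlongrightarrow> \<epsilon> / 2 + \<bar>M\<bar> * 0) at_top"
      by (intro tendsto_intros exp_vanishes)
    then have "\<forall>\<^sub>F t in at_top. \<epsilon> / 2 + \<bar>M\<bar> * exp (t0 - t) < \<epsilon>"
      by (rule order_tendstoD) (use \<epsilon> in simp)
    then show "\<forall>\<^sub>F t in at_top. dist (\<psi> s t) 0 < \<epsilon>"
      using eventually_ge_at_top[of t0]
      by eventually_elim (use le psi0 in \<open>force simp: dist_real_def intro: le_less_trans\<close>)
  qed
  define \<sigma> where "\<sigma> s t = \<psi> s t + s * exp (- t)" for s t
  have "class_KL \<sigma>"
    unfolding class_KL_def class_K_def
  proof (intro conjI allI impI)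
    show cont\<sigma>: "continuous_on ({0..} \<times> {0..}) (\<lambda>(s, t). \<sigma> s t)"
      unfolding \<sigma>_def using cont by (auto intro!: continuous_intros simp: case_prod_unfold)
    show "continuous_on {0..} (\<lambda>s. \<sigma> s t)" if "t \<ge> 0" for t
    proof -
      have "continuous_on {0..} (\<lambda>s. case (s, t) of (s, t) \<Rightarrow> \<sigma> s t)"
        by (rule continuous_on_compose2[OF cont\<sigma>]) (use that in \<open>auto intro!: continuous_intros\<close>)
      then show ?thesis by simp
    qed
    show "0 \<le> \<sigma> s t" if "s \<ge> 0" for s t
      using psi0 that by (simp add: \<sigma>_def)
    show "strict_mono_on {0..} (\<lambda>s. \<sigma> s t)" for t
      unfolding \<sigma>_def by (intro strict_mono_onI add_le_less_mono psi_mono) auto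
    show "\<sigma> 0 t = 0" for t
      by (simp add: \<sigma>_def psi_0)
    show "antimono_on {0..} (\<sigma> s)" if "s \<ge> 0" for s
      unfolding \<sigma>_def using that by (intro monotone_onI add_mono psi_mono mult_left_mono) auto
    have "((\<lambda>t. \<psi> s t + s * exp (0 - t)) \<longlongrightarrow> 0 + s * 0) at_top" for s
      by (intro tendsto_intros lim exp_vanishes)
    then show "(\<sigma> s \<longlongrightarrow> 0) at_top" for s
      by (simp add: \<sigma>_def[abs_def])
  qed
  moreover have "h a t \<le> \<sigma> (\<rho> a) t" if t: "t \<ge> 0" for a t
  proof (cases "\<rho> a = 0")
    case True
    have "h a t \<le> 0 + \<epsilon>" if "\<epsilon> > 0" for \<epsilon>
      using small[OF that] True t by (force simp: less_imp_le)
    then have "h a t \<le> 0" by (rule field_le_epsilon)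
    then show ?thesis by (simp add: \<sigma>_def psi_0 True)
  next
    case False
    then have "w a (\<rho> a) t t = h a t" using \<rho>[of a] by (simp add: w_def c_def)
    then show ?thesis using psi_ge[OF t, of a "\<rho> a" t] \<rho>[of a]
      by (simp add: \<sigma>_def add_increasing2)
  qed
  ultimately show thesis using that by blast
qed

section \<open>The kernel of an integrated Gram matrix\<close>

lemma LBINT_continuous_eq_integral:
  fixes h :: "real \<Rightarrow> 'a::euclidean_space"
  assumes "a \<le> b" "continuous_on {a..b} h"
  shows "(LBINT t=ereal a..ereal b. h t) = integral {a..b} h"
  using assms by (intro interval_integral_eq_integral borel_integrable_atLeastAtMost') auto

text \<open>Evaluated on a vector, a Gram matrix gives a squared norm. This identifies the kernel of the
  integrated Gram matrix \<open>G\<close> with the common kernel of all \<open>q(t,s)\<close>.\<close>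

lemma inner_gram_matrix:
  fixes A :: "real^'l^'n"
  shows "d \<bullet> ((transpose A ** A) *v d) = (A *v d) \<bullet> (A *v d)"
  by (simp add: matrix_vector_mul_assoc[symmetric] inner_commute[of d] dot_lmul_matrix)

lemma continuous_on_gram_matrix:
  fixes A :: "'a::topological_space \<Rightarrow> real^'l^'n"
  assumes "continuous_on S A"
  shows "continuous_on S (\<lambda>z. transpose (A z) ** A z)"
  using assms unfolding matrix_matrix_mult_def transpose_def
  by (auto intro!: continuous_intros)

text \<open>Here \<open>W t\<close> stands for the regressor integrated from \<open>0\<close> to \<open>t\<close>, so that \<open>q(t,s) = W t - W s\<close>.
  The interval integrals are turned into Henstock-Kurzweil integrals of continuous functions, for
  which constant vectors can be pulled out and a vanishing integral of a nonnegative function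
  forces the function to vanish.\<close>

context
  fixes W :: "real \<Rightarrow> real^'l^'n" and a b :: real and H :: "real \<Rightarrow> real^'l^'l"
  assumes W: "continuous_on {a..b} W" and ab: "a \<le> b"
  defines "H \<equiv> \<lambda>t. integral {a..b} (\<lambda>s. transpose (W t - W s) ** (W t - W s))"
begin

lemma continuous_on_gram_integrand:
  "continuous_on ({a..b} \<times> {a..b}) (\<lambda>(t, s). transpose (W t - W s) ** (W t - W s))"
proof -
  have "continuous_on ({a..b} \<times> {a..b}) (\<lambda>z. W (fst z) - W (snd z))"
    by (intro continuous_intros continuous_on_compose2[OF W]) auto
  then show ?thesis
    unfolding case_prod_unfold by (rule continuous_on_gram_matrix)
qed

lemma continuous_on_gram_slice:
  assumes "t \<in> {a..b}"
  shows "continuous_on {a..b} (\<lambda>s. transpose (W t - W s) ** (W t - W s))"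
  by (intro continuous_on_gram_matrix continuous_intros W)

lemma continuous_on_gram_inner_integral: "continuous_on {a..b} H"
  unfolding H_def
  using integral_continuous_on_param[of "{a..b}" a b "\<lambda>t s. transpose (W t - W s) ** (W t - W s)"]
    continuous_on_gram_integrand
  by simp

lemma integral_gram:
  "(LBINT t=ereal a..ereal b. (LBINT s=ereal a..ereal b. transpose (W t - W s) ** (W t - W s)))
     = integral {a..b} H"
proof -
  have "(LBINT t=ereal a..ereal b. (LBINT s=ereal a..ereal b. transpose (W t - W s) ** (W t - W s)))
     = (LBINT t=ereal a..ereal b. H t)"
    using ab unfolding H_def
    by (intro interval_integral_cong LBINT_continuous_eq_integral continuous_on_gram_slice)
      (auto simp: einterval_iff min_def max_def)
  then show ?thesis
    using LBINT_continuous_eq_integral[OF ab continuous_on_gram_inner_integral] by simp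
qed

lemma integral_gram_vector:
  "(LBINT t=ereal a..ereal b. (LBINT s=ereal a..ereal b. transpose (W t - W s) *v ((W t - W s) *v \<theta>)))
     = integral {a..b} H *v \<theta>"
proof -
  have blin: "bounded_linear (\<lambda>A :: real^'l^'l. A *v \<theta>)"
    by (rule bounded_linear_matrix_vector_mult_left)
  have slice: "(LBINT s=ereal a..ereal b. transpose (W t - W s) *v ((W t - W s) *v \<theta>)) = H t *v \<theta>"
    if t: "t \<in> {a..b}" for t
  proof -
    let ?h = "\<lambda>s. transpose (W t - W s) ** (W t - W s)"
    have cont: "continuous_on {a..b} ?h"
      using t by (rule continuous_on_gram_slice)
    have "(LBINT s=ereal a..ereal b. transpose (W t - W s) *v ((W t - W s) *v \<theta>))
        = (LBINT s=ereal a..ereal b. ?h s *v \<theta>)"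
      by (simp only: matrix_vector_mul_assoc)
    also have "\<dots> = integral {a..b} (\<lambda>s. ?h s *v \<theta>)"
      using ab bounded_linear.continuous_on[OF blin cont] by (rule LBINT_continuous_eq_integral)
    also have "\<dots> = H t *v \<theta>"
      using integral_linear[OF integrable_continuous_real[OF cont] blin] by (simp add: o_def H_def)
    finally show ?thesis .
  qed
  have "(LBINT t=ereal a..ereal b. (LBINT s=ereal a..ereal b. transpose (W t - W s) *v ((W t - W s) *v \<theta>)))
      = (LBINT t=ereal a..ereal b. H t *v \<theta>)"
    using ab by (intro interval_integral_cong slice) (auto simp: einterval_iff min_def max_def)
  also have "\<dots> = integral {a..b} (\<lambda>t. H t *v \<theta>)"
    using ab bounded_linear.continuous_on[OF blin continuous_on_gram_inner_integral]
    by (rule LBINT_continuous_eq_integral)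
  also have "\<dots> = integral {a..b} H *v \<theta>"
    using integral_linear[OF integrable_continuous_real[OF continuous_on_gram_inner_integral] blin]
    by (simp add: o_def)
  finally show ?thesis .
qed

text \<open>From \<open>G d = 0\<close> follows \<open>d \<bullet> G d = 0\<close>, the double integral of the continuous function
  \<open>\<bar>q(t,s) d\<bar>\<^sup>2\<close>, which therefore vanishes identically.\<close>

lemma integral_gram_kernel:
  assumes "a < b" and kernel: "integral {a..b} H *v d = 0" and t: "t \<in> {a..b}" and s: "s \<in> {a..b}"
  shows "(W t - W s) *v d = 0"
proof -
  have blin: "bounded_linear (\<lambda>A :: real^'l^'l. d \<bullet> (A *v d))"
    by (rule bounded_linear_compose[OF bounded_linear_inner_right bounded_linear_matrix_vector_mult_left])
  let ?q = "\<lambda>t s. ((W t - W s) *v d) \<bullet> ((W t - W s) *v d)"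
  have contq: "continuous_on {a..b} (?q t)" if "t \<in> {a..b}" for t
    using bounded_linear.continuous_on[OF blin continuous_on_gram_slice[OF that]]
    by (simp add: inner_gram_matrix)
  have slice: "integral {a..b} (?q t) = d \<bullet> (H t *v d)" if "t \<in> {a..b}" for t
    using integral_linear[OF integrable_continuous_real[OF continuous_on_gram_slice[OF that]] blin]
    by (simp add: o_def H_def inner_gram_matrix)
  have "integral {a..b} (\<lambda>t. d \<bullet> (H t *v d)) = d \<bullet> (integral {a..b} H *v d)"
    using integral_linear[OF integrable_continuous_real[OF continuous_on_gram_inner_integral] blin]
    by (simp add: o_def)
  also have "\<dots> = 0" using kernel by simp
  finally have "integral {a..b} (\<lambda>t. d \<bullet> (H t *v d)) = 0" .
  moreover have "0 \<le> d \<bullet> (H t *v d)" if "t \<in> {a..b}" for t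
    using integral_nonneg[OF integrable_continuous_real[OF contq[OF that]]] slice[OF that] by simp
  ultimately have "d \<bullet> (H t *v d) = 0"
    using t \<open>a < b\<close> integral_eq_0_iff[of a b "\<lambda>t. d \<bullet> (H t *v d)"]
      bounded_linear.continuous_on[OF blin continuous_on_gram_inner_integral]
    by simp
  then have "integral {a..b} (?q t) = 0"
    using slice[OF t] by simp
  then have "?q t s = 0"
    using s \<open>a < b\<close> integral_eq_0_iff[of a b "?q t"] contq[OF t] by simp
  then show ?thesis by simp
qed

end

section \<open>Signals along sampled solutions\<close>

text \<open>The continuous-time part of a run up to the event \<open>\<tau> n\<close>: how the estimates \<open>E i\<close> are chosen and
  how the events are triggered is left open. The statements below are thus available also while a
  run is still being constructed.\<close>

definition sampled_solution ::
    "(real^'n \<Rightarrow> real^'m \<Rightarrow> real^'n) \<Rightarrow> (real^'n \<Rightarrow> real^'m \<Rightarrow> real^'l^'n) \<Rightarrow>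
     (real^'l \<Rightarrow> real^'n \<Rightarrow> real^'m) \<Rightarrow> real^'l \<Rightarrow> (nat \<Rightarrow> real) \<Rightarrow> (nat \<Rightarrow> real^'l) \<Rightarrow> nat \<Rightarrow>
     (real \<Rightarrow> real^'n) \<Rightarrow> (real \<Rightarrow> real^'m) \<Rightarrow> bool" where
  "sampled_solution f g k \<theta> \<tau> E n x u \<longleftrightarrow>
     \<tau> 0 = 0 \<and> (\<forall>i<n. \<tau> i < \<tau> (Suc i)) \<and> continuous_on {0..\<tau> n} x \<and>
     (\<forall>i<n. \<forall>t\<in>{\<tau> i..<\<tau> (Suc i)}. u t = k (E i) (x t) \<and>
        (x has_vector_derivative closed_loop f g k \<theta> (E i) (x t)) (at t within {\<tau> i..<\<tau> (Suc i)}))"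

lemma has_vector_derivative_interior_of_Ico:
  assumes "(x has_vector_derivative D) (at t within {a..<b})" "a < t" "t < b"
  shows "(x has_vector_derivative D) (at (t :: real))"
proof -
  have "at t within {a..<b} = at t"
    using assms(2,3) by (intro at_within_interior) simp
  then show ?thesis using assms(1) by simp
qed

lemma times_increasing:
  fixes \<tau> :: "nat \<Rightarrow> real"
  assumes "\<And>i. i < n \<Longrightarrow> \<tau> i < \<tau> (Suc i)" "i \<le> j" "j \<le> n"
  shows "\<tau> i \<le> \<tau> j"
  using assms(2,3)
proof (induction rule: dec_induct)
  case (step m)
  then show ?case using assms(1)[of m] by simp
qed simp

lemma sampling_interval_exists:
  fixes \<tau> :: "nat \<Rightarrow> real"
  assumes "\<tau> 0 \<le> t" "t < \<tau> n"
  obtains i where "i < n" "\<tau> i \<le> t" "t < \<tau> (Suc i)"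
proof -
  have "\<exists>i<n. \<tau> i \<le> t \<and> t < \<tau> (Suc i)"
    using assms(2)
  proof (induction n)
    case (Suc n)
    then show ?case by (cases "t < \<tau> n") (auto simp: less_Suc_eq not_less)
  qed (use assms(1) in simp)
  then show thesis using that by blast
qed

context
  fixes f :: "real^'n \<Rightarrow> real^'m \<Rightarrow> real^'n" and g :: "real^'n \<Rightarrow> real^'m \<Rightarrow> real^'l^'n"
    and k :: "real^'l \<Rightarrow> real^'n \<Rightarrow> real^'m" and \<theta> :: "real^'l"
    and \<tau> :: "nat \<Rightarrow> real" and E :: "nat \<Rightarrow> real^'l" and n :: nat
    and x :: "real \<Rightarrow> real^'n" and u :: "real \<Rightarrow> real^'m"
  assumes f_cont: "continuous_on UNIV (\<lambda>(x, u). f x u)"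
    and g_cont: "continuous_on UNIV (\<lambda>(x, u). g x u)"
    and k_cont: "\<And>\<eta>. continuous_on UNIV (k \<eta>)"
    and sol: "sampled_solution f g k \<theta> \<tau> E n x u"
begin

lemma sampled_times: "\<tau> 0 = 0" "\<And>i. i < n \<Longrightarrow> \<tau> i < \<tau> (Suc i)"
    "\<And>i j. i \<le> j \<Longrightarrow> j \<le> n \<Longrightarrow> \<tau> i \<le> \<tau> j" "\<And>i. i \<le> n \<Longrightarrow> 0 \<le> \<tau> i"
proof -
  show *: "\<tau> 0 = 0" "\<And>i. i < n \<Longrightarrow> \<tau> i < \<tau> (Suc i)"
    using sol unfolding sampled_solution_def by auto
  show **: "\<And>i j. i \<le> j \<Longrightarrow> j \<le> n \<Longrightarrow> \<tau> i \<le> \<tau> j"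
    using times_increasing[of n \<tau>, OF *(2)] .
  show "0 \<le> \<tau> i" if "i \<le> n" for i
    using **[of 0 i] that *(1) by simp
qed

lemma sampled_continuous: "continuous_on {0..\<tau> n} x"
  using sol unfolding sampled_solution_def by blast

lemma sampled_input: "i < n \<Longrightarrow> t \<in> {\<tau> i..<\<tau> (Suc i)} \<Longrightarrow> u t = k (E i) (x t)"
  using sol unfolding sampled_solution_def by blast

lemma sampled_derivative:
  "i < n \<Longrightarrow> t \<in> {\<tau> i..<\<tau> (Suc i)} \<Longrightarrow>
    (x has_vector_derivative closed_loop f g k \<theta> (E i) (x t)) (at t within {\<tau> i..<\<tau> (Suc i)})"
  using sol unfolding sampled_solution_def by blast

lemma sampled_signal_continuous:
  fixes \<phi> :: "real^'n \<Rightarrow> real^'m \<Rightarrow> 'b::euclidean_space"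
  assumes \<phi>: "continuous_on UNIV (\<lambda>(x, u). \<phi> x u)" and i: "i < n"
  shows "continuous_on {\<tau> i..\<tau> (Suc i)} (\<lambda>s. \<phi> (x s) (k (E i) (x s)))"
proof -
  have "continuous_on {\<tau> i..\<tau> (Suc i)} x"
    using sampled_continuous by (rule continuous_on_subset)
      (use i sampled_times(3)[of "Suc i" n] sampled_times(4)[of i] in auto)
  then have "continuous_on {\<tau> i..\<tau> (Suc i)} (\<lambda>s. (x s, k (E i) (x s)))"
    by (intro continuous_intros continuous_on_compose2[OF k_cont]) auto
  then have "continuous_on {\<tau> i..\<tau> (Suc i)} (\<lambda>s. case (x s, k (E i) (x s)) of (x, u) \<Rightarrow> \<phi> x u)"
    by (rule continuous_on_compose2[OF \<phi>]) auto
  then show ?thesis by simp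
qed

text \<open>The input jumps at the events, but on each sampling interval the signal agrees, up to the right
  end point, with a continuous function.\<close>

lemma sampled_signal_integrable:
  fixes \<phi> :: "real^'n \<Rightarrow> real^'m \<Rightarrow> 'b::euclidean_space"
  assumes \<phi>: "continuous_on UNIV (\<lambda>(x, u). \<phi> x u)"
  shows "set_integrable lborel {0..\<tau> n} (\<lambda>s. \<phi> (x s) (u s))"
proof -
  have "set_integrable lborel {0..<\<tau> m} (\<lambda>s. \<phi> (x s) (u s))" if "m \<le> n" for m
    using that
  proof (induction m)
    case 0
    then show ?case by (simp add: sampled_times(1) set_integrable_def)
  next
    case (Suc m)
    have "set_integrable lborel {\<tau> m..\<tau> (Suc m)} (\<lambda>s. \<phi> (x s) (k (E m) (x s)))"
      using Suc by (intro borel_integrable_atLeastAtMost' sampled_signal_continuous[OF \<phi>]) simp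
    then have "set_integrable lborel {\<tau> m..<\<tau> (Suc m)} (\<lambda>s. \<phi> (x s) (k (E m) (x s)))"
      by (rule set_integrable_subset) auto
    then have "set_integrable lborel {\<tau> m..<\<tau> (Suc m)} (\<lambda>s. \<phi> (x s) (u s))"
      using Suc.prems sampled_input[of m] by (subst set_integrable_cong[OF refl]) auto
    then have "set_integrable lborel ({0..<\<tau> m} \<union> {\<tau> m..<\<tau> (Suc m)}) (\<lambda>s. \<phi> (x s) (u s))"
      using Suc by (intro set_integrable_Un) auto
    moreover have "{0..<\<tau> m} \<union> {\<tau> m..<\<tau> (Suc m)} = {0..<\<tau> (Suc m)}"
      using sampled_times(2)[of m] sampled_times(4)[of m] Suc.prems by auto
    ultimately show ?case by simp
  qed
  from this[of n] have Ico: "set_integrable lborel {0..<\<tau> n} (\<lambda>s. \<phi> (x s) (u s))"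
    by simp
  have "(\<lambda>s. indicator {\<tau> n} s *\<^sub>R \<phi> (x s) (u s)) = (\<lambda>s. indicator {\<tau> n} s *\<^sub>R \<phi> (x (\<tau> n)) (u (\<tau> n)))"
    by (auto simp: fun_eq_iff indicator_def)
  then have "set_integrable lborel {\<tau> n} (\<lambda>s. \<phi> (x s) (u s))"
    unfolding set_integrable_def by (simp add: integrable_scaleR_left)
  from set_integrable_Un[OF Ico this] show ?thesis
    using ivl_disj_un_singleton(6)[of 0 "\<tau> n"] sampled_times(4)[of n] by simp
qed

lemma sampled_signal_subinterval:
  fixes \<phi> :: "real^'n \<Rightarrow> real^'m \<Rightarrow> 'b::euclidean_space"
  assumes \<phi>: "continuous_on UNIV (\<lambda>(x, u). \<phi> x u)" and "s \<in> {0..\<tau> n}" "t \<in> {0..\<tau> n}"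
  shows "(LBINT r=ereal s..ereal t. \<phi> (x r) (u r))
           = integral {0..t} (\<lambda>r. \<phi> (x r) (u r)) - integral {0..s} (\<lambda>r. \<phi> (x r) (u r))"
proof -
  let ?\<phi> = "\<lambda>r. \<phi> (x r) (u r)"
  have integrable: "set_integrable lborel {a..b} ?\<phi>" if "0 \<le> a" "b \<le> \<tau> n" for a b
    using sampled_signal_integrable[OF \<phi>] by (rule set_integrable_subset) (use that in auto)
  have *: "(LBINT r=ereal s..ereal t. ?\<phi> r) = integral {0..t} ?\<phi> - integral {0..s} ?\<phi>"
    if "0 \<le> s" "s \<le> t" "t \<le> \<tau> n" for s t
  proof -
    have "(LBINT r=ereal s..ereal t. ?\<phi> r) = integral {s..t} ?\<phi>"
      using that integrable by (intro interval_integral_eq_integral) auto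
    moreover have "integral {0..s} ?\<phi> + integral {s..t} ?\<phi> = integral {0..t} ?\<phi>"
      using that integrable[of 0 t] by (intro Henstock_Kurzweil_Integration.integral_combine set_borel_integral_eq_integral) auto
    ultimately show ?thesis by (simp add: algebra_simps)
  qed
  show ?thesis
  proof (cases "s \<le> t")
    case False
    then show ?thesis
      using *[of t s] assms(2,3) by (subst interval_integral_endpoints_reverse) auto
  qed (use * assms(2,3) in auto)
qed

lemma sampled_state_integral:
  assumes t: "t \<in> {0..\<tau> n}"
  shows "x t - x 0 = integral {0..t} (\<lambda>s. f (x s) (u s)) + integral {0..t} (\<lambda>s. g (x s) (u s)) *v \<theta>"
proof -
  have integrable: "(\<lambda>s. \<phi> (x s) (u s)) integrable_on {0..t}"
    if "continuous_on UNIV (\<lambda>(x, u). \<phi> x u)" for \<phi> :: "real^'n \<Rightarrow> real^'m \<Rightarrow> 'b::euclidean_space"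
    by (rule set_borel_integral_eq_integral(1), rule set_integrable_subset[OF sampled_signal_integrable[OF that]])
       (use t in auto)
  have blin: "bounded_linear (\<lambda>A :: real^'l^'n. A *v \<theta>)"
    by (rule bounded_linear_matrix_vector_mult_left)
  have "((\<lambda>s. f (x s) (u s) + g (x s) (u s) *v \<theta>) has_integral (x t - x 0)) {0..t}"
  proof (rule fundamental_theorem_of_calculus_interior_strong)
    show "finite (\<tau> ` {..n})" by simp
    show "0 \<le> t" using t by simp
    show "continuous_on {0..t} x"
      using sampled_continuous by (rule continuous_on_subset) (use t in auto)
    fix s assume s: "s \<in> {0<..<t} - \<tau> ` {..n}"
    then obtain i where i: "i < n" "\<tau> i \<le> s" "s < \<tau> (Suc i)"
      using sampling_interval_exists[of \<tau> s n] sampled_times(1) t by force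
    with s have "\<tau> i < s" by (force simp: less_le)
    moreover have "(x has_vector_derivative closed_loop f g k \<theta> (E i) (x s)) (at s within {\<tau> i..<\<tau> (Suc i)})"
      using i by (intro sampled_derivative) auto
    ultimately show "(x has_vector_derivative f (x s) (u s) + g (x s) (u s) *v \<theta>) (at s)"
      using i has_vector_derivative_interior_of_Ico sampled_input[of i s]
      by (fastforce simp: closed_loop_def)
  qed
  moreover have "((\<lambda>s. f (x s) (u s) + g (x s) (u s) *v \<theta>) has_integral
      (integral {0..t} (\<lambda>s. f (x s) (u s)) + integral {0..t} (\<lambda>s. g (x s) (u s)) *v \<theta>)) {0..t}"
    using has_integral_linear[OF integrable_integral[OF integrable[OF g_cont]] blin]
    by (intro has_integral_add integrable_integral integrable f_cont) (simp add: o_def)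
  ultimately show ?thesis
    by (rule has_integral_unique)
qed

abbreviation (input) "accumulated_regressor t \<equiv> integral {0..t} (\<lambda>s. g (x s) (u s))"

lemma q_signal_eq_difference:
  assumes "s \<in> {0..\<tau> n}" "t \<in> {0..\<tau> n}"
  shows "q_signal g x u t s = accumulated_regressor t - accumulated_regressor s"
  unfolding q_signal_def using sampled_signal_subinterval[OF g_cont assms] .

text \<open>Integrating the plant equation: the part of the increment of \<open>x\<close> that \<open>f\<close> does not explain is
  linear in the unknown parameter.\<close>

lemma p_signal_eq_difference_times_parameter:
  assumes "s \<in> {0..\<tau> n}" "t \<in> {0..\<tau> n}"
  shows "p_signal f x u t s = (accumulated_regressor t - accumulated_regressor s) *v \<theta>"
proof -
  have "x t - x s = (x t - x 0) - (x s - x 0)" by simp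
  then show ?thesis
    unfolding p_signal_def sampled_signal_subinterval[OF f_cont assms]
      sampled_state_integral[OF assms(1)] sampled_state_integral[OF assms(2)]
    by (simp add: matrix_vector_mult_diff_rdistrib)
qed

lemma continuous_on_accumulated_regressor: "continuous_on {0..\<tau> n} accumulated_regressor"
  by (intro indefinite_integral_continuous_1 set_borel_integral_eq_integral(1)
      sampled_signal_integrable g_cont)

lemma G_matrix_eq:
  assumes "0 \<le> \<mu>" "\<mu> \<le> \<nu>" "\<nu> \<le> \<tau> n"
  shows "G_matrix g x u \<nu> \<mu> = integral {\<mu>..\<nu>} (\<lambda>t. integral {\<mu>..\<nu>}
    (\<lambda>s. transpose (accumulated_regressor t - accumulated_regressor s) **
         (accumulated_regressor t - accumulated_regressor s)))"
proof -
  have "continuous_on {\<mu>..\<nu>} accumulated_regressor"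
    using continuous_on_accumulated_regressor by (rule continuous_on_subset) (use assms in auto)
  from integral_gram[OF this assms(2)] show ?thesis
    unfolding G_matrix_def[of g x u] using assms
    by (subst interval_integral_cong[where g = "\<lambda>t. LBINT s=ereal \<mu>..ereal \<nu>.
         transpose (accumulated_regressor t - accumulated_regressor s) **
         (accumulated_regressor t - accumulated_regressor s)"])
       (auto intro!: interval_integral_cong simp: q_signal_eq_difference einterval_iff min_def max_def)
qed

text \<open>By \<open>p = q \<theta>\<close>, the integrand of \<open>Z\<close> is that of \<open>G\<close> applied to \<open>\<theta>\<close>. The update is thus always
  solvable, with solution set \<open>\<theta> + ker G\<close>.\<close>

lemma true_parameter_solves_normal_equation:
  assumes "0 \<le> \<mu>" "\<mu> \<le> \<nu>" "\<nu> \<le> \<tau> n"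
  shows "Z_vector f g x u \<nu> \<mu> = G_matrix g x u \<nu> \<mu> *v \<theta>"
proof -
  have "continuous_on {\<mu>..\<nu>} accumulated_regressor"
    using continuous_on_accumulated_regressor by (rule continuous_on_subset) (use assms in auto)
  from integral_gram_vector[OF this assms(2), of \<theta>] show ?thesis
    unfolding Z_vector_def G_matrix_eq[OF assms] using assms
    by (subst interval_integral_cong[where g = "\<lambda>t. LBINT s=ereal \<mu>..ereal \<nu>.
         transpose (accumulated_regressor t - accumulated_regressor s) *v
         ((accumulated_regressor t - accumulated_regressor s) *v \<theta>)"])
       (auto intro!: interval_integral_cong simp: q_signal_eq_difference
          p_signal_eq_difference_times_parameter einterval_iff min_def max_def
          simp del: transpose_matrix_vector)
qed

text \<open>If \<open>G d = 0\<close>, then the integral of \<open>g(x,u) d\<close> over every subinterval of the window vanishes.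
  Differentiating it inside one sampling interval gives the pointwise statement.\<close>

lemma normal_equation_kernel:
  assumes "0 \<le> \<mu>" "\<nu> \<le> \<tau> n" and d: "G_matrix g x u \<nu> \<mu> *v d = 0"
    and j: "j < n" "\<mu> \<le> \<tau> j" "\<tau> (Suc j) \<le> \<nu>" and t: "t \<in> {\<tau> j..\<tau> (Suc j)}"
  shows "g (x t) (k (E j) (x t)) *v d = 0"
proof -
  let ?I = "{\<tau> j..\<tau> (Suc j)}" and ?\<gamma> = "\<lambda>s. g (x s) (k (E j) (x s))"
  have less: "\<tau> j < \<tau> (Suc j)" using sampled_times(2)[OF j(1)] .
  have "\<mu> < \<nu>" using less j by linarith
  have cont: "continuous_on {\<mu>..\<nu>} accumulated_regressor"
    using continuous_on_accumulated_regressor by (rule continuous_on_subset) (use assms in auto)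
  have blin: "bounded_linear (\<lambda>A :: real^'l^'n. A *v d)"
    by (rule bounded_linear_matrix_vector_mult_left)
  have zero: "integral {\<tau> j..r} ?\<gamma> *v d = 0" if r: "r \<in> ?I" for r
  proof -
    have dom: "\<tau> j \<in> {0..\<tau> n}" "r \<in> {0..\<tau> n}"
      using j r sampled_times(3)[of "Suc j" n] sampled_times(4)[of j] by auto
    have "set_integrable lborel {\<tau> j..r} (\<lambda>s. g (x s) (u s))"
      using sampled_signal_integrable[OF g_cont] by (rule set_integrable_subset) (use dom in auto)
    then have "accumulated_regressor r - accumulated_regressor (\<tau> j) = integral {\<tau> j..r} (\<lambda>s. g (x s) (u s))"
      using sampled_signal_subinterval[OF g_cont dom] r by (subst interval_integral_eq_integral[symmetric]) auto
    also have "\<dots> = integral {\<tau> j..r} ?\<gamma>"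
      \<comment> \<open>the input at the right end point already belongs to the next sampling interval\<close>
      using r j(1) sampled_input[of j] by (intro integral_spike[of "{\<tau> (Suc j)}"]) auto
    finally show ?thesis
      using integral_gram_kernel[OF cont _ \<open>\<mu> < \<nu>\<close>, of d r "\<tau> j"] d \<open>\<mu> < \<nu>\<close> r j less
      unfolding G_matrix_eq[OF assms(1) less_imp_le[OF \<open>\<mu> < \<nu>\<close>] assms(2)] by auto
  qed
  have "((\<lambda>r. integral {\<tau> j..r} ?\<gamma>) has_vector_derivative ?\<gamma> t) (at t within ?I)"
    using sampled_signal_continuous[OF g_cont j(1)] t by (rule integral_has_vector_derivative)
  then have "((\<lambda>r. integral {\<tau> j..r} ?\<gamma> *v d) has_vector_derivative ?\<gamma> t *v d) (at t within ?I)"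
    by (rule bounded_linear.has_vector_derivative[OF blin])
  moreover have "((\<lambda>r. integral {\<tau> j..r} ?\<gamma> *v d) has_vector_derivative 0) (at t within ?I)"
    by (rule has_vector_derivative_transform[OF t zero has_vector_derivative_const])
  ultimately show ?thesis
    using vector_derivative_unique_within_closed_interval[OF less, of t _ "?\<gamma> t *v d" 0] t
    by (simp add: cbox_interval)
qed

end

section \<open>A single sampling interval\<close>

text \<open>The projection of \<open>e\<close> onto a convex set does not move away from any point \<open>\<theta>\<close> of that set; with
  the solution set of the normal equation this says that the estimation error never grows.\<close>

lemma minimizer_nonexpansive:
  fixes S :: "'a::euclidean_space set"
  assumes "convex S" "closed S" "\<theta> \<in> S" "p \<in> S" and min: "\<And>z. z \<in> S \<Longrightarrow> norm (p - e) \<le> norm (z - e)"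
  shows "norm (p - \<theta>) \<le> norm (e - \<theta>)"
proof -
  have "(e - p) \<bullet> (\<theta> - p) \<le> 0"
    using assms by (intro any_closest_point_dot[of S]) (auto simp: dist_norm norm_minus_commute)
  then have "(p - \<theta>) \<bullet> (p - \<theta>) \<le> (p - \<theta>) \<bullet> (e - \<theta>)"
    by (simp add: inner_diff_left inner_diff_right inner_commute)
  also have "\<dots> \<le> norm (p - \<theta>) * norm (e - \<theta>)"
    by (rule norm_cauchy_schwarz)
  finally have "norm (p - \<theta>) * norm (p - \<theta>) \<le> norm (p - \<theta>) * norm (e - \<theta>)"
    by (simp add: power2_norm_eq_inner[symmetric] power2_eq_square)
  then show ?thesis
    by (cases "norm (p - \<theta>) = 0") (auto simp: mult_le_cancel_left)
qed

lemma continuous_agree_at_right_end: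
  fixes x y :: "real \<Rightarrow> 'a::real_normed_vector"
  assumes "a < b" "continuous_on {a..b} x" "continuous_on {a..b} y" "\<And>t. t \<in> {a..<b} \<Longrightarrow> x t = y t"
  shows "x b = y b"
proof -
  have "closure {a..<b} = {a..b}" using assms(1) by simp
  moreover have "continuous_on (closure {a..<b}) (\<lambda>t. x t - y t)"
    using assms(2,3) \<open>closure {a..<b} = {a..b}\<close> by (simp add: continuous_on_diff)
  ultimately have "x b - y b = 0"
    using assms(1,4) continuous_constant_on_closure[of "{a..<b}" "\<lambda>t. x t - y t" 0 b] by simp
  then show ?thesis by simp
qed

text \<open>\<open>G\<close> and \<open>Z\<close> depend on the signals in the open window only: at the end of the window the input has
  already switched to the new estimate, which is determined by \<open>G\<close> and \<open>Z\<close>.\<close>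

lemma normal_equation_cong:
  assumes "\<mu> \<le> \<nu>" and eq: "\<And>t. \<mu> < t \<Longrightarrow> t < \<nu> \<Longrightarrow> x t = y t \<and> u t = v t"
  shows "G_matrix g x u \<nu> \<mu> = G_matrix g y v \<nu> \<mu>"
    and "Z_vector f g x u \<nu> \<mu> = Z_vector f g y v \<nu> \<mu>"
proof -
  have q: "q_signal g x u t s = q_signal g y v t s" if "t \<in> {\<mu><..<\<nu>}" "s \<in> {\<mu><..<\<nu>}" for t s
    unfolding q_signal_def using that
    by (intro interval_integral_cong) (auto simp: eq einterval_iff min_def max_def split: if_splits)
  have p: "p_signal f x u t s = p_signal f y v t s" if "t \<in> {\<mu><..<\<nu>}" "s \<in> {\<mu><..<\<nu>}" for t s
  proof -
    have "(LBINT r=ereal s..ereal t. f (x r) (u r)) = (LBINT r=ereal s..ereal t. f (y r) (v r))"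
      using that by (intro interval_integral_cong) (auto simp: eq einterval_iff min_def max_def split: if_splits)
    then show ?thesis unfolding p_signal_def using that eq by simp
  qed
  show "G_matrix g x u \<nu> \<mu> = G_matrix g y v \<nu> \<mu>"
    unfolding G_matrix_def using assms(1)
    by (intro interval_integral_cong) (auto intro!: arg_cong2[where f = "(**)"] arg_cong[where f = transpose]
        simp: q einterval_iff min_def max_def)
  show "Z_vector f g x u \<nu> \<mu> = Z_vector f g y v \<nu> \<mu>"
    unfolding Z_vector_def using assms(1)
    by (intro interval_integral_cong) (auto simp: p q einterval_iff min_def max_def)
qed

lemma window_start_cong:
  assumes "\<And>j. j \<le> Suc i \<Longrightarrow> \<tau> j = \<rho> j"
  shows "window_start T Nt \<tau> i = window_start T Nt \<rho> i"
proof -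
  have "{\<tau> j | j. j \<le> i \<and> \<tau> j \<ge> \<tau> (Suc i) - real Nt * T} = {\<rho> j | j. j \<le> i \<and> \<rho> j \<ge> \<rho> (Suc i) - real Nt * T}"
    using assms by (metis le_SucI order_refl)
  then show ?thesis unfolding window_start_def by simp
qed

text \<open>The standing data and hypotheses. In \<open>F \<theta> \<eta>\<close> below, \<open>\<theta>\<close> is the true parameter and \<open>\<eta>\<close> the
  frozen estimate; \<open>F \<theta> \<theta>\<close> is the nominal closed loop.\<close>

locale adaptive_loop =
  fixes f :: "real^'n \<Rightarrow> real^'m \<Rightarrow> real^'n"
    and g :: "real^'n \<Rightarrow> real^'m \<Rightarrow> real^'l^'n"
    and k :: "real^'l \<Rightarrow> real^'n \<Rightarrow> real^'m"
    and V Q :: "real^'l \<Rightarrow> real^'n \<Rightarrow> real"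
    and a :: "real^'n \<Rightarrow> real"
    and T :: real
    and N Nt :: nat
  assumes f_smooth: "smooth (\<lambda>(x, u). f x u)" and f_zero: "f 0 0 = 0"
    and g_smooth: "smooth (\<lambda>(x, u). g x u)" and g_zero: "g 0 0 = 0"
    and k_smooth: "smooth (\<lambda>(\<theta>, x). k \<theta> x)" and k_zero: "\<And>\<theta>. k \<theta> 0 = 0"
    and V_fun: "\<And>\<theta>. continuous_on UNIV (V \<theta>) \<and> positive_definite (V \<theta>) \<and> radially_unbounded (V \<theta>)"
    and Q_fun: "\<And>\<theta>. continuous_on UNIV (Q \<theta>) \<and> positive_definite (Q \<theta>) \<and> radially_unbounded (Q \<theta>)"
    and V_cont: "continuous_on UNIV (\<lambda>(\<theta>, x). V \<theta> x)"
    and Q_cont: "continuous_on UNIV (\<lambda>(\<theta>, x). Q \<theta> x)"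
    and gas: "\<And>\<theta>. globally_asymptotically_stable (closed_loop f g k \<theta> \<theta>)"
    and V_le_Q: "\<And>\<theta> x t. ode_solution_on (closed_loop f g k \<theta> \<theta>) {0..} x \<Longrightarrow> t \<ge> 0 \<Longrightarrow>
                   V \<theta> (x t) \<le> Q \<theta> (x 0)"
    and V_unif: "\<And>\<Theta> M. \<Theta> \<noteq> {} \<Longrightarrow> compact \<Theta> \<Longrightarrow> M \<ge> 0 \<Longrightarrow>
                   \<exists>R>0. \<forall>\<theta>\<in>\<Theta>. \<forall>x. V \<theta> x \<le> M \<longrightarrow> norm x \<le> R"
    and N_pos: "N > 0" and obs: "parameter_observable f g k N"
    and T_pos: "T > 0"
    and a_cont: "continuous_on UNIV a" and a_pd: "positive_definite a"
    and Nt_gt: "Nt > N"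
begin

abbreviation F where "F \<equiv> closed_loop f g k"
abbreviation level where "level \<eta> \<xi> \<equiv> Q \<eta> \<xi> + a \<xi>"

lemma f_cont: "continuous_on UNIV (\<lambda>(x, u). f x u)"
  and g_cont: "continuous_on UNIV (\<lambda>(x, u). g x u)"
  using f_smooth g_smooth smooth_lipschitz_on_balls lipschitz_on_balls_continuous by blast+

lemma k_cont: "continuous_on UNIV (k \<eta>)"
proof -
  have "continuous_on UNIV (\<lambda>(\<eta>, x). k \<eta> x)"
    using k_smooth smooth_lipschitz_on_balls lipschitz_on_balls_continuous by blast
  then have "continuous_on UNIV (\<lambda>x. case (\<eta>, x) of (\<eta>, x) \<Rightarrow> k \<eta> x)"
    by (rule continuous_on_compose2) (auto intro!: continuous_intros)
  then show ?thesis by simp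
qed

lemma F_lipschitz: "lipschitz_on_balls (F \<theta> \<eta>)"
  using f_smooth g_smooth k_smooth by (rule lipschitz_on_balls_closed_loop)

lemma F_zero: "F \<theta> \<eta> 0 = 0"
  by (simp add: closed_loop_def f_zero g_zero k_zero)

lemma V_zero_iff: "V \<eta> x \<le> 0 \<longleftrightarrow> x = 0"
  using V_fun[of \<eta>] unfolding positive_definite_def by (metis linorder_not_le order_refl)

lemma level_zero: "level \<eta> 0 = 0"
  using Q_fun[of \<eta>] a_pd unfolding positive_definite_def by simp

lemma a_pos: "\<xi> \<noteq> 0 \<Longrightarrow> 0 < a \<xi>"
  using a_pd unfolding positive_definite_def by blast

lemma a_nonneg: "0 \<le> a \<xi>"
  using a_pd a_pos[of \<xi>] unfolding positive_definite_def by (cases "\<xi> = 0") auto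

lemma nominal_solution_exists:
  obtains w where "ode_solution_on (F \<theta> \<theta>) {0..} w" "w 0 = \<xi>"
  using gas[of \<theta>] unfolding globally_asymptotically_stable_def by blast

lemma V_le_level: "V \<eta> \<xi> \<le> Q \<eta> \<xi>"
  using nominal_solution_exists[of \<eta> \<xi>] V_le_Q[of \<eta> _ 0] by fastforce

lemma V_below_level: "\<xi> \<noteq> 0 \<Longrightarrow> V \<eta> \<xi> < level \<eta> \<xi>"
  using V_le_level[of \<eta> \<xi>] a_pos[of \<xi>] by linarith

lemma bounded_sublevel: "bounded {x. V \<eta> x \<le> c}"
proof -
  have "compact {x. V \<eta> x \<le> max c 1}"
    using V_fun[of \<eta>] unfolding radially_unbounded_def by simp
  then have "bounded {x. V \<eta> x \<le> max c 1}"
    by (rule compact_imp_bounded)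
  then show ?thesis by (rule bounded_subset) auto
qed

text \<open>Along the nominal closed loop \<open>V \<le> Q\<close>, which lies strictly below the triggering level \<open>Q + a\<close>.\<close>

lemma no_trigger_at_true_parameter:
  assumes "\<xi> \<noteq> 0"
  shows "trigger_time f g k V Q a T \<theta> \<theta> s \<xi> = \<infinity>"
proof -
  have False if t: "s < t" and z: "ode_solution_on (F \<theta> \<theta>) {s..t} z" "z s = \<xi>"
    and level: "V \<theta> (z t) = level \<theta> \<xi>" for t z
  proof -
    obtain w where w: "ode_solution_on (F \<theta> \<theta>) {0..} w" "w 0 = \<xi>"
      by (rule nominal_solution_exists)
    have "ode_solution_on (F \<theta> \<theta>) {s..t} (\<lambda>r. w (r + - s))"
      by (rule ode_solution_on_shift[OF w(1)]) auto
    from ode_solution_on_unique[OF F_lipschitz less_imp_le[OF t] z(1) this] z(2) w(2)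
    have "z t = w (t - s)" by simp
    then show False
      using V_le_Q[OF w(1), of "t - s"] t level w(2) a_pos[OF assms] by simp
  qed
  then have none: "{t. s < t \<and> (\<exists>z. ode_solution_on (F \<theta> \<theta>) {s..t} z \<and> z s = \<xi> \<and> V \<theta> (z t) = level \<theta> \<xi>)} = {}"
    by blast
  have "trigger_time f g k V Q a T \<theta> \<theta> s \<xi> = Inf (ereal ` {t. s < t \<and>
      (\<exists>z. ode_solution_on (F \<theta> \<theta>) {s..t} z \<and> z s = \<xi> \<and> V \<theta> (z t) = level \<theta> \<xi>)})"
    using assms by (simp add: trigger_time_def)
  then show ?thesis
    unfolding none by (simp add: top_ereal_def)
qed

text \<open>One sampling interval started at time \<open>0\<close>: \<open>z\<close> is the motion and \<open>h\<close> the length of the interval.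
  The last clause links \<open>h\<close> to the event rule at an arbitrary starting time \<open>s\<close>, which is possible
  because the plant is time-invariant.\<close>

definition is_step where
  "is_step \<theta> \<eta> \<xi> z h \<longleftrightarrow> 0 < h \<and> h \<le> T \<and> z 0 = \<xi> \<and> ode_solution_on (F \<theta> \<eta>) {0..h} z \<and>
     (\<forall>t\<in>{0..h}. V \<eta> (z t) \<le> level \<eta> \<xi>) \<and>
     (\<forall>s. ereal (s + h) = min (ereal (s + T)) (trigger_time f g k V Q a T \<theta> \<eta> s \<xi>))"

text \<open>For \<open>\<xi> \<noteq> 0\<close> the motion starts strictly below the triggering level and is followed until it reaches
  that level or the time \<open>T\<close> has passed. By uniqueness every solution admitted in the event rule
  is this motion, so that the first crossing time is the infimum.\<close>

lemma step_exists: "\<exists>z h. is_step \<theta> \<eta> \<xi> z h"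
proof (cases "\<xi> = 0")
  case True
  have "ode_solution_on (F \<theta> \<eta>) {0..T} (\<lambda>_. 0)"
    unfolding ode_solution_on_def by (simp add: F_zero)
  moreover have "V \<eta> 0 \<le> level \<eta> 0"
    by (simp add: level_zero V_zero_iff)
  ultimately have "is_step \<theta> \<eta> \<xi> (\<lambda>_. 0) T"
    unfolding is_step_def using True T_pos by (simp add: trigger_time_def)
  then show ?thesis by blast
next
  case False
  have V_cont1: "continuous_on UNIV (V \<eta>)" using V_fun[of \<eta>] by blast
  obtain z h where z: "0 < h" "h \<le> T" "z 0 = \<xi>" "ode_solution_on (F \<theta> \<eta>) {0..h} z"
    "\<And>t. t \<in> {0..<h} \<Longrightarrow> V \<eta> (z t) < level \<eta> \<xi>" "V \<eta> (z h) \<le> level \<eta> \<xi>" "V \<eta> (z h) = level \<eta> \<xi> \<or> h = T"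
    using ode_solution_until_level_exists[OF F_lipschitz V_cont1 bounded_sublevel V_below_level[OF False] T_pos]
    by metis
  have "ereal (s + h) = min (ereal (s + T)) (trigger_time f g k V Q a T \<theta> \<eta> s \<xi>)" for s
  proof -
    let ?A = "{t. s < t \<and> (\<exists>z. ode_solution_on (F \<theta> \<eta>) {s..t} z \<and> z s = \<xi> \<and> V \<eta> (z t) = level \<eta> \<xi>)}"
    have trigger: "trigger_time f g k V Q a T \<theta> \<eta> s \<xi> = Inf (ereal ` ?A)"
      using False by (simp add: trigger_time_def)
    have late: "s + h \<le> t" if "t \<in> ?A" for t
    proof (rule ccontr)
      assume "\<not> s + h \<le> t"
      with that have t: "s < t" "t < s + h" by auto
      from that obtain y where y: "ode_solution_on (F \<theta> \<eta>) {s..t} y" "y s = \<xi>" "V \<eta> (y t) = level \<eta> \<xi>"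
        by blast
      have "ode_solution_on (F \<theta> \<eta>) {s..t} (\<lambda>r. z (r + - s))"
        by (rule ode_solution_on_shift[OF z(4)]) (use t in auto)
      from ode_solution_on_unique[OF F_lipschitz less_imp_le[OF t(1)] y(1) this] y(2) z(3)
      have "y t = z (t - s)" by simp
      then show False using z(5)[of "t - s"] t y(3) by simp
    qed
    have ge: "ereal (s + h) \<le> Inf (ereal ` ?A)"
    proof (rule Inf_greatest)
      fix r assume "r \<in> ereal ` ?A"
      then obtain t where "t \<in> ?A" "r = ereal t" by (rule imageE)
      then show "ereal (s + h) \<le> r" using late by simp
    qed
    show ?thesis
    proof (cases "h = T")
      case True
      then show ?thesis using ge unfolding trigger by simp
    next
      case not_T: False
      have "ode_solution_on (F \<theta> \<eta>) {s..s + h} (\<lambda>r. z (r + - s))"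
        by (rule ode_solution_on_shift[OF z(4)]) auto
      then have "s + h \<in> ?A"
        using not_T z(1,3,7) by (auto intro!: exI[of _ "\<lambda>r. z (r + - s)"])
      then have "Inf (ereal ` ?A) \<le> ereal (s + h)"
        by (intro Inf_lower) auto
      with ge have "Inf (ereal ` ?A) = ereal (s + h)" by (rule antisym[rotated])
      then show ?thesis unfolding trigger using z(2) by simp
    qed
  qed
  moreover have "V \<eta> (z t) \<le> level \<eta> \<xi>" if "t \<in> {0..h}" for t
    using z(5)[of t] z(6) that by (cases "t = h") auto
  ultimately have "is_step \<theta> \<eta> \<xi> z h"
    unfolding is_step_def using z(1-4) by blast
  then show ?thesis by blast
qed

text \<open>The motion is determined on \<open>[0,h]\<close> only. A fixed choice of a function on all reals makes the state
  inside a sampling interval a term in the estimate and the state at its beginning.\<close>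

definition step_flow where "step_flow \<theta> \<eta> \<xi> = (SOME z. \<exists>h. is_step \<theta> \<eta> \<xi> z h)"
definition step_length where "step_length \<theta> \<eta> \<xi> = (SOME h. is_step \<theta> \<eta> \<xi> (step_flow \<theta> \<eta> \<xi>) h)"

lemma is_step: "is_step \<theta> \<eta> \<xi> (step_flow \<theta> \<eta> \<xi>) (step_length \<theta> \<eta> \<xi>)"
proof -
  have "\<exists>h. is_step \<theta> \<eta> \<xi> (step_flow \<theta> \<eta> \<xi>) h"
    unfolding step_flow_def by (rule someI_ex[OF step_exists])
  then show ?thesis
    unfolding step_length_def by (rule someI_ex)
qed

lemma step_length_pos: "0 < step_length \<theta> \<eta> \<xi>"
  and step_length_le: "step_length \<theta> \<eta> \<xi> \<le> T"
  and step_flow_start: "step_flow \<theta> \<eta> \<xi> 0 = \<xi>"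
  and step_flow_solution: "ode_solution_on (F \<theta> \<eta>) {0..step_length \<theta> \<eta> \<xi>} (step_flow \<theta> \<eta> \<xi>)"
  and step_flow_level: "t \<in> {0..step_length \<theta> \<eta> \<xi>} \<Longrightarrow> V \<eta> (step_flow \<theta> \<eta> \<xi> t) \<le> level \<eta> \<xi>"
  and step_length_trigger: "ereal (s + step_length \<theta> \<eta> \<xi>) =
     min (ereal (s + T)) (trigger_time f g k V Q a T \<theta> \<eta> s \<xi>)"
  using is_step[of \<theta> \<eta> \<xi>] unfolding is_step_def by blast+

lemma step_length_zero_state: "step_length \<theta> \<eta> 0 = T"
  using step_length_trigger[of 0 \<theta> \<eta> 0] by (simp add: trigger_time_def)

lemma step_length_true_parameter: "step_length \<theta> \<theta> \<xi> = T"
proof (cases "\<xi> = 0")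
  case False
  then show ?thesis
    using step_length_trigger[of 0 \<theta> \<theta> \<xi>] no_trigger_at_true_parameter by simp
qed (simp add: step_length_zero_state)

end

section \<open>Identification and uniqueness\<close>

lemma ereal_less_downward: "ereal t < b \<Longrightarrow> s \<le> t \<Longrightarrow> ereal s < b"
  by (rule le_less_trans[of "ereal s" "ereal t"]) simp_all

lemma is_arg_min_distance_iff:
  "is_arg_min (\<lambda>\<zeta>. (norm (\<zeta> - e))\<^sup>2) P p \<longleftrightarrow> P p \<and> (\<forall>\<zeta>. P \<zeta> \<longrightarrow> norm (p - e) \<le> norm (\<zeta> - e))"
  unfolding is_arg_min_def by (auto simp: not_less)

lemma affine_solution_set:
  fixes G :: "real^'l^'l"
  shows "convex {\<zeta>. Z = G *v \<zeta>}" and "closed {\<zeta>. Z = G *v \<zeta>}"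
proof -
  show "convex {\<zeta>. Z = G *v \<zeta>}"
    unfolding convex_def
  proof (intro ballI allI impI)
    fix x y and s t :: real
    assume "x \<in> {\<zeta>. Z = G *v \<zeta>}" "y \<in> {\<zeta>. Z = G *v \<zeta>}" "0 \<le> s" "0 \<le> t" "s + t = 1"
    then have "G *v (s *\<^sub>R x + t *\<^sub>R y) = s *\<^sub>R Z + t *\<^sub>R Z"
      by (simp add: matrix_vector_right_distrib matrix_vector_mult_scaleR)
    also have "\<dots> = Z"
      using \<open>s + t = 1\<close> by (simp flip: scaleR_add_left)
    finally show "s *\<^sub>R x + t *\<^sub>R y \<in> {\<zeta>. Z = G *v \<zeta>}" by simp
  qed
  show "closed {\<zeta>. Z = G *v \<zeta>}"
    by (intro closed_Collect_eq continuous_intros linear_continuous_on matrix_vector_mul_bounded_linear)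
qed

text \<open>The admissible set of the update is affine and contains \<open>\<theta>\<close>; the minimizer is the metric
  projection of \<open>e\<close> onto it.\<close>

lemma least_squares_update_unique:
  fixes G :: "real^'l^'l"
  assumes "Z = G *v \<theta>"
  shows "{\<zeta>. is_arg_min (\<lambda>\<zeta>. (norm (\<zeta> - e))\<^sup>2) (\<lambda>\<zeta>. Z = G *v \<zeta>) \<zeta>} = {closest_point {\<zeta>. Z = G *v \<zeta>} e}"
proof -
  let ?S = "{\<zeta>. Z = G *v \<zeta>}"
  note S = affine_solution_set[of Z G]
  have "?S \<noteq> {}" using assms by blast
  then have c: "closest_point ?S e \<in> ?S"
    using S(2) by (rule closest_point_in_set[rotated])
  have le: "norm (closest_point ?S e - e) \<le> norm (z - e)" if "z \<in> ?S" for z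
    using closest_point_le[OF S(2) that, of e] by (simp add: dist_norm norm_minus_commute)
  have "p = closest_point ?S e" if "p \<in> ?S" "\<And>z. z \<in> ?S \<Longrightarrow> norm (p - e) \<le> norm (z - e)" for p
    using that by (intro closest_point_unique S) (auto simp: dist_norm norm_minus_commute)
  then show ?thesis
    using c le unfolding is_arg_min_distance_iff by blast
qed

lemma window_start_cases:
  assumes "\<tau> (Suc i) \<le> \<tau> i + real Nt * T"
  obtains j where "j \<le> i" "window_start T Nt \<tau> i = \<tau> j"
proof -
  let ?A = "{\<tau> j | j. j \<le> i \<and> \<tau> j \<ge> \<tau> (Suc i) - real Nt * T}"
  have fin: "finite ?A" by (rule finite_subset[of _ "\<tau> ` {..i}"]) auto
  have "\<tau> i \<in> ?A" using assms by auto
  then have "?A \<noteq> {}" by blast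
  from Min_in[OF fin this] have "window_start T Nt \<tau> i \<in> ?A"
    unfolding window_start_def .
  then obtain j where "j \<le> i" "window_start T Nt \<tau> i = \<tau> j" by auto
  then show thesis by (rule that)
qed

lemma window_start_eq_first:
  assumes "\<tau> (Suc i) \<le> \<tau> 0 + real Nt * T" "\<And>j. j \<le> i \<Longrightarrow> \<tau> 0 \<le> \<tau> j"
  shows "window_start T Nt \<tau> i = \<tau> 0"
  unfolding window_start_def
proof (rule Min_eqI)
  show "finite {\<tau> j | j. j \<le> i \<and> \<tau> j \<ge> \<tau> (Suc i) - real Nt * T}"
    by (rule finite_subset[of _ "\<tau> ` {..i}"]) auto
qed (use assms in auto)

text \<open>Solutions are analysed on an arbitrary interval \<open>[0,b)\<close>, since the facts below serve to rule
  out that events accumulate and so to show that \<open>b = \<infinity>\<close> is attained.\<close>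

context adaptive_loop
begin

context
  fixes \<theta> :: "real^'l" and b :: ereal and x :: "real \<Rightarrow> real^'n" and u :: "real \<Rightarrow> real^'m"
    and \<eta> :: "real \<Rightarrow> real^'l" and \<tau> :: "nat \<Rightarrow> real"
  assumes hyb: "hybrid_solution f g k V Q a T Nt \<theta> b x u \<eta> \<tau>"
begin

lemma hybrid_times: "\<tau> 0 = 0" "strict_mono \<tau>" "0 < b" "0 \<le> \<tau> i"
proof -
  show "\<tau> 0 = 0" "strict_mono \<tau>" "0 < b"
    using hyb unfolding hybrid_solution_def by blast+
  then show "0 \<le> \<tau> i"
    using strict_mono_less_eq[of \<tau> 0 i] by simp
qed

lemma hybrid_times_less: "\<tau> i < \<tau> (Suc i)"
  using hybrid_times(2) by (simp add: strict_mono_Suc_iff)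

lemma hybrid_times_mono: "i \<le> j \<Longrightarrow> \<tau> i \<le> \<tau> j"
  using hybrid_times(2) by (simp add: strict_mono_less_eq)

lemma hybrid_times_before: "ereal (\<tau> j) < b \<Longrightarrow> i \<le> j \<Longrightarrow> ereal (\<tau> i) < b"
  using hybrid_times_mono[of i j] by (rule ereal_less_downward[rotated])

lemma hybrid_interval_exists:
  assumes "t \<ge> 0" "ereal t < b"
  obtains i where "\<tau> i \<le> t" "t < \<tau> (Suc i)" "ereal (\<tau> i) < b"
proof -
  obtain n where n: "t < \<tau> n"
    using hyb assms unfolding hybrid_solution_def by blast
  obtain i where i: "\<tau> i \<le> t" "t < \<tau> (Suc i)"
    using sampling_interval_exists[of \<tau> t n] n assms(1) hybrid_times(1) by metis
  moreover have "ereal (\<tau> i) < b"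
    using assms(2) i(1) by (rule ereal_less_downward)
  ultimately show thesis by (rule that)
qed

lemma hybrid_continuous: "continuous_on {t. 0 \<le> t \<and> ereal t < b} x"
  using hyb unfolding hybrid_solution_def by blast

lemma hybrid_continuous_Icc: "ereal t < b \<Longrightarrow> 0 \<le> s \<Longrightarrow> continuous_on {s..t} x"
  by (rule continuous_on_subset[OF hybrid_continuous])
     (auto intro: ereal_less_downward)

lemma hybrid_control:
  assumes "ereal (\<tau> i) < b" "t \<in> {\<tau> i..<\<tau> (Suc i)}" "ereal t < b"
  shows "u t = k (\<eta> (\<tau> i)) (x t)" "\<eta> t = \<eta> (\<tau> i)"
    "(x has_vector_derivative F \<theta> (\<eta> (\<tau> i)) (x t)) (at t within {t. \<tau> i \<le> t \<and> t < \<tau> (Suc i) \<and> ereal t < b})"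
proof -
  have "\<forall>t\<in>{t. \<tau> i \<le> t \<and> t < \<tau> (Suc i) \<and> ereal t < b}. u t = k (\<eta> (\<tau> i)) (x t) \<and> \<eta> t = \<eta> (\<tau> i) \<and>
    (x has_vector_derivative f (x t) (u t) + g (x t) (u t) *v \<theta>)
      (at t within {t. \<tau> i \<le> t \<and> t < \<tau> (Suc i) \<and> ereal t < b})"
    using hyb assms(1) unfolding hybrid_solution_def Let_def by blast
  then show "u t = k (\<eta> (\<tau> i)) (x t)" "\<eta> t = \<eta> (\<tau> i)"
    "(x has_vector_derivative F \<theta> (\<eta> (\<tau> i)) (x t)) (at t within {t. \<tau> i \<le> t \<and> t < \<tau> (Suc i) \<and> ereal t < b})"
    using assms(2,3) by (auto simp: closed_loop_def)
qed

lemma hybrid_next_time: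
  assumes "ereal (\<tau> i) < b"
  shows "\<tau> (Suc i) = \<tau> i + step_length \<theta> (\<eta> (\<tau> i)) (x (\<tau> i))"
proof -
  have "ereal (\<tau> (Suc i)) = min (ereal (\<tau> i + T)) (trigger_time f g k V Q a T \<theta> (\<eta> (\<tau> i)) (\<tau> i) (x (\<tau> i)))"
    using hyb assms unfolding hybrid_solution_def by blast
  then show ?thesis
    using step_length_trigger[of "\<tau> i" \<theta> "\<eta> (\<tau> i)" "x (\<tau> i)"] by (metis ereal.inject)
qed

lemma hybrid_next_time_le: "ereal (\<tau> i) < b \<Longrightarrow> \<tau> (Suc i) \<le> \<tau> i + T"
  using hybrid_next_time[of i] step_length_le[of \<theta> "\<eta> (\<tau> i)" "x (\<tau> i)"] by simp

lemma hybrid_times_le: "ereal (\<tau> i) < b \<Longrightarrow> \<tau> i \<le> real i * T"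
proof (induction i)
  case (Suc i)
  then show ?case
    using hybrid_times_before[of "Suc i" i] hybrid_next_time_le[of i] by (simp add: algebra_simps)
qed (simp add: hybrid_times(1))

text \<open>On its sampling interval the state is the motion chosen above, by uniqueness for the initial value
  problem; at the right end point by continuity.\<close>

lemma hybrid_flow:
  assumes i: "ereal (\<tau> i) < b" and t: "t \<in> {\<tau> i..\<tau> (Suc i)}" "ereal t < b"
  shows "x t = step_flow \<theta> (\<eta> (\<tau> i)) (x (\<tau> i)) (t - \<tau> i)"
proof -
  let ?z = "step_flow \<theta> (\<eta> (\<tau> i)) (x (\<tau> i))"
  have z: "ode_solution_on (F \<theta> (\<eta> (\<tau> i))) {\<tau> i..\<tau> (Suc i)} (\<lambda>r. ?z (r + - \<tau> i))"
    by (rule ode_solution_on_shift[OF step_flow_solution]) (use hybrid_next_time[OF i] in auto)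
  have before: "x s = ?z (s - \<tau> i)" if s: "s \<in> {\<tau> i..<\<tau> (Suc i)}" "ereal s < b" for s
  proof -
    have "ode_solution_on (F \<theta> (\<eta> (\<tau> i))) {\<tau> i..s} x"
      unfolding ode_solution_on_def
    proof
      fix r assume r: "r \<in> {\<tau> i..s}"
      have sub: "{\<tau> i..s} \<subseteq> {t. \<tau> i \<le> t \<and> t < \<tau> (Suc i) \<and> ereal t < b}"
        using s by (auto intro: ereal_less_downward)
      with r have "r \<in> {\<tau> i..<\<tau> (Suc i)}" "ereal r < b" by auto
      from hybrid_control(3)[OF i this] sub
      show "(x has_vector_derivative F \<theta> (\<eta> (\<tau> i)) (x r)) (at r within {\<tau> i..s})"
        by (rule has_vector_derivative_within_subset)
    qed
    moreover have "ode_solution_on (F \<theta> (\<eta> (\<tau> i))) {\<tau> i..s} (\<lambda>r. ?z (r + - \<tau> i))"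
      using z by (rule ode_solution_on_subset) (use s in auto)
    ultimately have "x s = ?z (s + - \<tau> i)"
      using s ode_solution_on_unique[OF F_lipschitz, of "\<tau> i" s _ _ x "\<lambda>r. ?z (r + - \<tau> i)"]
      by (simp add: step_flow_start)
    then show ?thesis by simp
  qed
  show ?thesis
  proof (cases "t < \<tau> (Suc i)")
    case True
    then show ?thesis using before t by simp
  next
    case False
    with t have t_eq: "t = \<tau> (Suc i)" by simp
    have "x t = ?z (t + - \<tau> i)"
      unfolding t_eq
    proof (rule continuous_agree_at_right_end[OF hybrid_times_less])
      show "continuous_on {\<tau> i..\<tau> (Suc i)} x"
        using t(2) hybrid_times(4)[of i] t_eq by (intro hybrid_continuous_Icc) auto
      show "continuous_on {\<tau> i..\<tau> (Suc i)} (\<lambda>r. ?z (r + - \<tau> i))"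
        using z by (rule ode_solution_on_continuous)
      show "x s = ?z (s + - \<tau> i)" if "s \<in> {\<tau> i..<\<tau> (Suc i)}" for s
        using before[of s] that ereal_less_downward[OF t(2), of s] t_eq by simp
    qed
    then show ?thesis by simp
  qed
qed

lemma hybrid_level:
  assumes "ereal (\<tau> i) < b" "t \<in> {\<tau> i..\<tau> (Suc i)}" "ereal t < b"
  shows "V (\<eta> (\<tau> i)) (x t) \<le> level (\<eta> (\<tau> i)) (x (\<tau> i))"
  unfolding hybrid_flow[OF assms]
  using assms hybrid_next_time[OF assms(1)] by (intro step_flow_level) auto

lemma hybrid_sampled:
  assumes "ereal (\<tau> n) < b"
  shows "sampled_solution f g k \<theta> \<tau> (\<lambda>i. \<eta> (\<tau> i)) n x u"
  unfolding sampled_solution_def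
proof (intro conjI allI impI ballI)
  show "\<tau> 0 = 0" by (rule hybrid_times)
  show "\<tau> i < \<tau> (Suc i)" for i by (rule hybrid_times_less)
  show "continuous_on {0..\<tau> n} x"
    using assms by (intro hybrid_continuous_Icc) auto
  fix i t assume i: "i < n" and t: "t \<in> {\<tau> i..<\<tau> (Suc i)}"
  have le: "ereal (\<tau> (Suc i)) < b"
    using hybrid_times_before[OF assms] i by simp
  have *: "ereal s < b" if "s < \<tau> (Suc i)" for s
    using ereal_less_downward[OF le] that by simp
  then have "{t. \<tau> i \<le> t \<and> t < \<tau> (Suc i) \<and> ereal t < b} = {\<tau> i..<\<tau> (Suc i)}"
    by auto
  then show "u t = k (\<eta> (\<tau> i)) (x t)"
    "(x has_vector_derivative F \<theta> (\<eta> (\<tau> i)) (x t)) (at t within {\<tau> i..<\<tau> (Suc i)})"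
    using hybrid_control[of i t] t * hybrid_times_less[of i] by auto
qed

lemma hybrid_window:
  assumes "ereal (\<tau> i) < b"
  shows "0 \<le> window_start T Nt \<tau> i" "window_start T Nt \<tau> i \<le> \<tau> i"
proof -
  have "T \<le> real Nt * T"
    using Nt_gt T_pos by simp
  then have "\<tau> (Suc i) \<le> \<tau> i + real Nt * T"
    using hybrid_next_time_le[OF assms] by simp
  then obtain j where "j \<le> i" "window_start T Nt \<tau> i = \<tau> j"
    by (rule window_start_cases)
  then show "0 \<le> window_start T Nt \<tau> i" "window_start T Nt \<tau> i \<le> \<tau> i"
    using hybrid_times(4) hybrid_times_mono by simp_all
qed

text \<open>The new error lies in the kernel of \<open>G\<close> because both the new estimate and \<open>\<theta>\<close> solve the normal
  equation.\<close>

lemma hybrid_update: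
  assumes i: "ereal (\<tau> (Suc i)) < b"
  defines "\<mu> \<equiv> window_start T Nt \<tau> i"
  shows "G_matrix g x u (\<tau> (Suc i)) \<mu> *v (\<eta> (\<tau> (Suc i)) - \<theta>) = 0"
    and "norm (\<eta> (\<tau> (Suc i)) - \<theta>) \<le> norm (\<eta> (\<tau> i) - \<theta>)"
proof -
  let ?G = "G_matrix g x u (\<tau> (Suc i)) \<mu>" and ?Z = "Z_vector f g x u (\<tau> (Suc i)) \<mu>"
  let ?p = "\<eta> (\<tau> (Suc i))"
  have i': "ereal (\<tau> i) < b" using hybrid_times_before[OF i] by simp
  have Z: "?Z = ?G *v \<theta>"
    using hybrid_window[OF i'] hybrid_times_less[of i] unfolding \<mu>_def
    by (intro true_parameter_solves_normal_equation[OF f_cont g_cont k_cont hybrid_sampled[OF i]]) auto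
  have "{\<zeta>. is_arg_min (\<lambda>\<zeta>. (norm (\<zeta> - \<eta> (\<tau> i)))\<^sup>2) (\<lambda>\<zeta>. ?Z = ?G *v \<zeta>) \<zeta>} = {?p}"
    using hyb i unfolding hybrid_solution_def Let_def \<mu>_def by blast
  then have "is_arg_min (\<lambda>\<zeta>. (norm (\<zeta> - \<eta> (\<tau> i)))\<^sup>2) (\<lambda>\<zeta>. ?Z = ?G *v \<zeta>) ?p"
    by blast
  then have p: "?Z = ?G *v ?p" "\<And>\<zeta>. ?Z = ?G *v \<zeta> \<Longrightarrow> norm (?p - \<eta> (\<tau> i)) \<le> norm (\<zeta> - \<eta> (\<tau> i))"
    unfolding is_arg_min_distance_iff by blast+
  show "?G *v (?p - \<theta>) = 0"
    using p(1) Z by (simp add: matrix_vector_mult_diff_distrib)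
  show "norm (?p - \<theta>) \<le> norm (\<eta> (\<tau> i) - \<theta>)"
  proof (rule minimizer_nonexpansive[OF affine_solution_set[of ?Z ?G]])
    show "norm (?p - \<eta> (\<tau> i)) \<le> norm (z - \<eta> (\<tau> i))" if "z \<in> {\<zeta>. ?Z = ?G *v \<zeta>}" for z
      using p(2) that by simp
  qed (use p(1) Z in simp_all)
qed

lemma hybrid_error_decreasing:
  "i \<le> j \<Longrightarrow> ereal (\<tau> j) < b \<Longrightarrow> norm (\<eta> (\<tau> j) - \<theta>) \<le> norm (\<eta> (\<tau> i) - \<theta>)"
proof (induction rule: dec_induct)
  case (step j)
  then show ?case
    using hybrid_update(2)[of j] hybrid_times_before[of "Suc j" j] by simp
qed simp

lemma hybrid_identified_forever:
  "i \<le> j \<Longrightarrow> ereal (\<tau> j) < b \<Longrightarrow> \<eta> (\<tau> i) = \<theta> \<Longrightarrow> \<eta> (\<tau> j) = \<theta>"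
  using hybrid_error_decreasing[of i j] by simp

text \<open>The triggering level at the state \<open>0\<close> is \<open>0\<close>, and \<open>V \<le> 0\<close> only at \<open>0\<close>.\<close>

lemma hybrid_zero_state:
  assumes "x 0 = 0" "t \<ge> 0" "ereal t < b"
  shows "x t = 0"
proof -
  have zero: "x s = 0" if "x (\<tau> i) = 0" "ereal (\<tau> i) < b" "s \<in> {\<tau> i..\<tau> (Suc i)}" "ereal s < b" for i s
    using hybrid_level[OF that(2-4)] that(1) by (simp add: level_zero V_zero_iff)
  have "ereal (\<tau> i) < b \<longrightarrow> x (\<tau> i) = 0" for i
  proof (induction i)
    case (Suc i)
    then show ?case
      using zero[of i "\<tau> (Suc i)"] hybrid_times_before[of "Suc i" i] hybrid_times_less[of i] by auto
  qed (simp add: hybrid_times(1) assms(1))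
  then show ?thesis
    using zero hybrid_interval_exists[OF assms(2,3)] assms(3) by (metis atLeastAtMost_iff less_imp_le)
qed

text \<open>Errors never grow, so if the error at the event \<open>\<tau> N\<close> is nonzero then so are all earlier ones. The
  first \<open>N\<close> windows all start at \<open>0\<close>, hence each error after an update annihilates the regressor on
  all sampling intervals so far. This is the situation of the observability hypothesis, whose
  conclusion contradicts \<open>x 0 \<noteq> 0\<close>.\<close>

lemma hybrid_identification:
  assumes "x 0 \<noteq> 0" and N: "ereal (\<tau> N) < b"
  shows "\<eta> (\<tau> N) = \<theta>"
proof (rule ccontr)
  assume not: "\<eta> (\<tau> N) \<noteq> \<theta>"
  define d where "d i = \<eta> (\<tau> i) - \<theta>" for i
  have d: "d i \<noteq> 0" if "i \<le> N" for i
    using hybrid_identified_forever[OF that N] not by (auto simp: d_def)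
  note sol = hybrid_sampled[OF N]
  have deriv: "(x has_vector_derivative F \<theta> (\<theta> + d i) (x t)) (at t within {\<tau> i..<\<tau> (Suc i)})"
    if "i < N" "t \<in> {\<tau> i..<\<tau> (Suc i)}" for i t
    using sampled_derivative[OF f_cont g_cont k_cont sol that] by (simp add: d_def)
  have right: "(x has_vector_derivative F \<theta> (\<theta> + d i) (x t)) (at_right t)"
    if "i < N" "t \<in> {\<tau> i..<\<tau> (Suc i)}" for i t
  proof -
    have "(x has_vector_derivative F \<theta> (\<theta> + d i) (x t)) (at t within {t<..<\<tau> (Suc i)})"
      using deriv[OF that] by (rule has_vector_derivative_within_subset) (use that in auto)
    moreover have "at t within {t<..<\<tau> (Suc i)} = at_right t"
      using that by (intro at_within_nhd[of t "{..<\<tau> (Suc i)}"]) auto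
    ultimately show ?thesis by simp
  qed
  have window: "window_start T Nt \<tau> i = 0" if "i < N" for i
  proof -
    have "\<tau> (Suc i) \<le> real (Suc i) * T"
      using hybrid_times_le[OF hybrid_times_before[OF N, of "Suc i"]] that by simp
    also have "\<dots> \<le> real Nt * T"
      using that Nt_gt T_pos by (intro mult_right_mono) auto
    finally show ?thesis
      using window_start_eq_first[of \<tau> i Nt T] hybrid_times by simp
  qed
  have kernel: "g (x t) (k (\<theta> + d j) (x t)) *v d (Suc i) = 0"
    if "i < N" "j \<le> i" "t \<in> {\<tau> j..\<tau> (Suc j)}" for i j t
  proof -
    have Si: "ereal (\<tau> (Suc i)) < b" using hybrid_times_before[OF N] that by simp
    have "g (x t) (k (\<eta> (\<tau> j)) (x t)) *v d (Suc i) = 0"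
    proof (rule normal_equation_kernel[OF f_cont g_cont k_cont hybrid_sampled[OF Si], where \<mu> = 0])
      show "G_matrix g x u (\<tau> (Suc i)) 0 *v d (Suc i) = 0"
        using hybrid_update(1)[OF Si] window[OF that(1)] by (simp add: d_def)
    qed (use that hybrid_times(4) in \<open>auto intro: hybrid_times_mono\<close>)
    then show ?thesis by (simp add: d_def)
  qed
  have cont: "continuous_on {0..\<tau> N} x"
    using N by (intro hybrid_continuous_Icc) auto
  have interval: "\<exists>i<N. t \<in> {\<tau> i..<\<tau> (Suc i)}" if "t \<in> {0..<\<tau> N}" for t
    using sampling_interval_exists[of \<tau> t N] that hybrid_times(1) by (metis atLeastLessThan_iff)
  have C1: "x C1_differentiable_on ({0..\<tau> N} - \<tau> ` {0..N})"
  proof -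
    \<comment> \<open>the derivative of \<open>x\<close> away from the events\<close>
    define D where "D t = F \<theta> (\<eta> t) (x t)" for t
    let ?S = "{0..\<tau> N} - \<tau> ` {0..N}"
    have inside: "\<exists>i<N. t \<in> {\<tau> i<..<\<tau> (Suc i)}" if t: "t \<in> ?S" for t
    proof -
      have "t \<noteq> \<tau> N" using t by auto
      with t obtain i where i: "i < N" "t \<in> {\<tau> i..<\<tau> (Suc i)}"
        using interval[of t] by force
      with t have "t \<noteq> \<tau> i" by auto
      with i show ?thesis by force
    qed
    have D: "D t = F \<theta> (\<theta> + d i) (x t)" if "i < N" "t \<in> {\<tau> i<..<\<tau> (Suc i)}" for i t
    proof -
      have "ereal t < b"
        using that ereal_less_downward[OF hybrid_times_before[OF N, of "Suc i"], of t] by simp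
      then show ?thesis
        using hybrid_control(2)[of i t] hybrid_times_before[OF N, of i] that by (simp add: D_def d_def)
    qed
    have "(x has_vector_derivative D t) (at t)" if t: "t \<in> ?S" for t
    proof -
      obtain i where i: "i < N" "t \<in> {\<tau> i<..<\<tau> (Suc i)}" using inside[OF t] by blast
      then show ?thesis
        unfolding D[OF i] using deriv[of i t]
        by (intro has_vector_derivative_interior_of_Ico[of x _ t "\<tau> i" "\<tau> (Suc i)"]) auto
    qed
    moreover have "continuous_on ?S D"
      unfolding continuous_on_eq_continuous_within
    proof
      fix t assume "t \<in> ?S"
      from inside[OF this] obtain i where i: "i < N" "t \<in> {\<tau> i<..<\<tau> (Suc i)}" by blast
      have "continuous_on {\<tau> i<..<\<tau> (Suc i)} x"
        using cont by (rule continuous_on_subset)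
          (use i hybrid_times(4)[of i] hybrid_times_mono[of "Suc i" N] in auto)
      then have "continuous_on {\<tau> i<..<\<tau> (Suc i)} (\<lambda>t. F \<theta> (\<theta> + d i) (x t))"
        using continuous_on_compose2[OF lipschitz_on_balls_continuous[OF F_lipschitz]] by blast
      then have "continuous_on {\<tau> i<..<\<tau> (Suc i)} D"
        by (rule continuous_on_eq) (simp add: D[OF i(1)])
      then have "isCont D t"
        using i(2) by (simp add: continuous_on_eq_continuous_at)
      then show "continuous (at t within ?S) D"
        by (rule continuous_at_imp_continuous_at_within)
    qed
    ultimately show ?thesis
      unfolding C1_differentiable_on_def by blast
  qed
  have "\<forall>t\<in>{0..\<tau> N}. x t = 0"
  proof (rule obs[unfolded parameter_observable_def, THEN spec[of _ \<tau>], THEN spec[of _ \<theta>],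
        THEN spec[of _ d], THEN spec[of _ x], THEN mp], intro conjI allI impI ballI)
    show "\<exists>D. (x has_vector_derivative D) (at_right t)" if t: "t \<in> {0..<\<tau> N}" for t
    proof -
      obtain i where "i < N" "t \<in> {\<tau> i..<\<tau> (Suc i)}" using interval[OF t] by (elim exE conjE)
      from right[OF this] show ?thesis ..
    qed
  qed (rule hybrid_times(1) hybrid_times_less cont C1 d right kernel; assumption)+
  then show False
    using assms(1) hybrid_times(4)[of N] by auto
qed

lemma hybrid_period_after_identification:
  assumes "ereal (\<tau> i) < b" "\<eta> (\<tau> i) = \<theta> \<or> x (\<tau> i) = 0"
  shows "\<tau> (Suc i) = \<tau> i + T"
  using hybrid_next_time[OF assms(1)] assms(2) step_length_true_parameter step_length_zero_state by auto

text \<open>Later events still restart the motion, but with an exact estimate every piece solves the same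
  autonomous equation, so the pieces join to a single nominal trajectory.\<close>

lemma hybrid_nominal_after_identification:
  assumes m: "ereal (\<tau> m) < b" "\<eta> (\<tau> m) = \<theta>" and w: "ode_solution_on (F \<theta> \<theta>) {0..} w" "w 0 = x (\<tau> m)"
    and t: "\<tau> m \<le> t" "ereal t < b"
  shows "x t = w (t - \<tau> m)"
proof -
  have one_step: "x s = w (s - \<tau> m)"
    if i: "m \<le> i" "ereal (\<tau> i) < b" "x (\<tau> i) = w (\<tau> i - \<tau> m)" and s: "s \<in> {\<tau> i..\<tau> (Suc i)}" "ereal s < b" for i s
  proof -
    have \<eta>: "\<eta> (\<tau> i) = \<theta>" using hybrid_identified_forever[OF i(1,2) m(2)] .
    let ?z = "step_flow \<theta> \<theta> (x (\<tau> i))"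
    have len: "\<tau> (Suc i) = \<tau> i + step_length \<theta> \<theta> (x (\<tau> i))"
      using hybrid_next_time[OF i(2)] \<eta> by simp
    have "ode_solution_on (F \<theta> \<theta>) {0..s - \<tau> i} ?z"
      using step_flow_solution by (rule ode_solution_on_subset) (use s len in auto)
    moreover have "ode_solution_on (F \<theta> \<theta>) {0..s - \<tau> i} (\<lambda>r. w (r + (\<tau> i - \<tau> m)))"
      by (rule ode_solution_on_shift[OF w(1)]) (use hybrid_times_mono[OF i(1)] in auto)
    ultimately have "?z (s - \<tau> i) = w (s - \<tau> i + (\<tau> i - \<tau> m))"
      using s i(3) ode_solution_on_unique[OF F_lipschitz, of 0 "s - \<tau> i" _ _ ?z "\<lambda>r. w (r + (\<tau> i - \<tau> m))"]
      by (simp add: step_flow_start)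
    then show ?thesis
      using hybrid_flow[OF i(2) s] \<eta> by simp
  qed
  have at_times: "ereal (\<tau> i) < b \<longrightarrow> x (\<tau> i) = w (\<tau> i - \<tau> m)" if "m \<le> i" for i
    using that
  proof (induction rule: dec_induct)
    case (step i)
    then show ?case
      using one_step[of i "\<tau> (Suc i)"] hybrid_times_before[of "Suc i" i] hybrid_times_less[of i] by auto
  qed (simp add: w(2))
  have "t \<ge> 0" using t(1) hybrid_times(4)[of m] by linarith
  then obtain i where i: "\<tau> i \<le> t" "t < \<tau> (Suc i)" "ereal (\<tau> i) < b"
    using hybrid_interval_exists t(2) by blast
  have "m \<le> i"
    using hybrid_times_mono[of "Suc i" m] i(2) t(1) by (cases "m \<le> i") auto
  then show ?thesis
    using one_step[of i t] at_times[of i] i t by auto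
qed

end

text \<open>Solutions whose intervals of definition differ are compared on the shorter one.\<close>

lemma hybrid_solution_restrict:
  assumes "hybrid_solution f g k V Q a T Nt \<theta> b' x u \<eta> \<tau>" "0 < b" "b \<le> b'"
  shows "hybrid_solution f g k V Q a T Nt \<theta> b x u \<eta> \<tau>"
proof -
  note x = assms(1)
  have b': "r < b'" if "r < b" for r
    using that assms(3) by (rule less_le_trans)
  show ?thesis
    unfolding hybrid_solution_def
  proof (intro conjI allI impI)
    show "0 < b" "\<tau> 0 = 0" "strict_mono \<tau>"
      using assms(2) hybrid_times[OF x] by blast+
    show "\<exists>i. t < \<tau> i" if "0 \<le> t" "ereal t < b" for t
      using hybrid_interval_exists[OF x that(1) b'[OF that(2)]] by blast
    show "continuous_on {t. 0 \<le> t \<and> ereal t < b} x"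
      using hybrid_continuous[OF x] by (rule continuous_on_subset) (use b' in auto)
    fix i
    show "let I = {t. \<tau> i \<le> t \<and> t < \<tau> (Suc i) \<and> ereal t < b} in
           \<forall>t\<in>I. u t = k (\<eta> (\<tau> i)) (x t) \<and> \<eta> t = \<eta> (\<tau> i) \<and>
             (x has_vector_derivative f (x t) (u t) + g (x t) (u t) *v \<theta>) (at t within I)"
      if "ereal (\<tau> i) < b"
      unfolding Let_def
    proof
      fix t assume t: "t \<in> {t. \<tau> i \<le> t \<and> t < \<tau> (Suc i) \<and> ereal t < b}"
      then have t': "t \<in> {\<tau> i..<\<tau> (Suc i)}" "ereal t < b'" using b' by auto
      note control = hybrid_control[OF x b'[OF that] t']
      have "(x has_vector_derivative F \<theta> (\<eta> (\<tau> i)) (x t))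
          (at t within {t. \<tau> i \<le> t \<and> t < \<tau> (Suc i) \<and> ereal t < b})"
        using control(3) by (rule has_vector_derivative_within_subset) (use b' in auto)
      then show "u t = k (\<eta> (\<tau> i)) (x t) \<and> \<eta> t = \<eta> (\<tau> i) \<and>
          (x has_vector_derivative f (x t) (u t) + g (x t) (u t) *v \<theta>)
            (at t within {t. \<tau> i \<le> t \<and> t < \<tau> (Suc i) \<and> ereal t < b})"
        using control(1,2) by (simp add: closed_loop_def)
    qed
    show "ereal (\<tau> (Suc i)) =
        min (ereal (\<tau> i + T)) (trigger_time f g k V Q a T \<theta> (\<eta> (\<tau> i)) (\<tau> i) (x (\<tau> i)))"
      if "ereal (\<tau> i) < b"
      using x b'[OF that] unfolding hybrid_solution_def by blast
    show "let \<mu> = window_start T Nt \<tau> i in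
           {\<zeta>. is_arg_min (\<lambda>\<zeta>. (norm (\<zeta> - \<eta> (\<tau> i)))\<^sup>2)
                 (\<lambda>\<zeta>. Z_vector f g x u (\<tau> (Suc i)) \<mu> = G_matrix g x u (\<tau> (Suc i)) \<mu> *v \<zeta>) \<zeta>}
           = {\<eta> (\<tau> (Suc i))}"
      if "ereal (\<tau> (Suc i)) < b"
      using x b'[OF that] unfolding hybrid_solution_def by blast
  qed
qed

text \<open>Induction over the events: state and estimate at an event determine the motion up to the next
  event, and the motion up to there determines the window, \<open>G\<close>, \<open>Z\<close> and with them the next estimate.\<close>

lemma hybrid_solution_unique:
  assumes longer: "hybrid_solution f g k V Q a T Nt \<theta> b' x u \<eta> \<tau>" "b \<le> b'"
    and y: "hybrid_solution f g k V Q a T Nt \<theta> b y v \<zeta> \<rho>"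
    and init: "y 0 = x 0" "\<zeta> 0 = \<eta> 0"
  shows "t \<ge> 0 \<Longrightarrow> ereal t < b \<Longrightarrow> y t = x t \<and> v t = u t \<and> \<zeta> t = \<eta> t"
    and "ereal (\<tau> i) < b \<Longrightarrow> \<rho> i = \<tau> i"
proof -
  have x: "hybrid_solution f g k V Q a T Nt \<theta> b x u \<eta> \<tau>"
    using longer(1) hybrid_times(3)[OF y] longer(2) by (rule hybrid_solution_restrict)
  have piece: "\<rho> (Suc i) = \<tau> (Suc i) \<and>
      (\<forall>t\<in>{\<tau> i..\<tau> (Suc i)}. ereal t < b \<longrightarrow> y t = x t) \<and>
      (\<forall>t\<in>{\<tau> i..<\<tau> (Suc i)}. ereal t < b \<longrightarrow> v t = u t \<and> \<zeta> t = \<eta> t)"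
    if i: "ereal (\<tau> i) < b" "\<rho> i = \<tau> i" "y (\<tau> i) = x (\<tau> i)" "\<zeta> (\<tau> i) = \<eta> (\<tau> i)" for i
  proof -
    have i': "ereal (\<rho> i) < b" using i by simp
    have \<rho>: "\<rho> (Suc i) = \<tau> (Suc i)"
      using hybrid_next_time[OF x i(1)] hybrid_next_time[OF y i'] i by simp
    have state: "y t = x t" if "t \<in> {\<tau> i..\<tau> (Suc i)}" "ereal t < b" for t
      using hybrid_flow[OF x i(1) that] hybrid_flow[OF y i', of t] that i \<rho> by simp
    moreover have "v t = u t \<and> \<zeta> t = \<eta> t" if "t \<in> {\<tau> i..<\<tau> (Suc i)}" "ereal t < b" for t
      using hybrid_control(1,2)[OF x i(1) that] hybrid_control(1,2)[OF y i', of t] that i \<rho> state[of t] by simp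
    ultimately show ?thesis using \<rho> by blast
  qed
  have main: "ereal (\<tau> i) < b \<longrightarrow> (\<forall>j\<le>i. \<rho> j = \<tau> j) \<and> \<zeta> (\<tau> i) = \<eta> (\<tau> i) \<and>
      (\<forall>t\<in>{0..\<tau> i}. y t = x t) \<and> (\<forall>t\<in>{0..<\<tau> i}. v t = u t)" for i
  proof (induction i)
    case 0
    then show ?case using init hybrid_times(1)[OF x] hybrid_times(1)[OF y] by simp
  next
    case (Suc i)
    show ?case
    proof
      assume Si: "ereal (\<tau> (Suc i)) < b"
      have i: "ereal (\<tau> i) < b" using hybrid_times_before[OF x Si] by simp
      with Suc have IH: "\<forall>j\<le>i. \<rho> j = \<tau> j" "\<zeta> (\<tau> i) = \<eta> (\<tau> i)"
        "\<forall>t\<in>{0..\<tau> i}. y t = x t" "\<forall>t\<in>{0..<\<tau> i}. v t = u t" by auto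
      have below: "ereal t < b" if "t \<le> \<tau> (Suc i)" for t
        using Si that by (rule ereal_less_downward)
      have P: "\<rho> (Suc i) = \<tau> (Suc i)" "\<And>t. t \<in> {\<tau> i..\<tau> (Suc i)} \<Longrightarrow> y t = x t"
        "\<And>t. t \<in> {\<tau> i..<\<tau> (Suc i)} \<Longrightarrow> v t = u t"
        using piece[OF i] IH hybrid_times(4)[OF x, of i] below by auto
      have state: "\<forall>t\<in>{0..\<tau> (Suc i)}. y t = x t" and input: "\<forall>t\<in>{0..<\<tau> (Suc i)}. v t = u t"
        using IH P by (metis atLeastAtMost_iff atLeastLessThan_iff linorder_not_le less_imp_le)+
      have times: "\<forall>j\<le>Suc i. \<rho> j = \<tau> j" using IH(1) P(1) by (simp add: le_Suc_eq)
      have window: "window_start T Nt \<rho> i = window_start T Nt \<tau> i"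
        using times by (intro window_start_cong) simp
      let ?\<mu> = "window_start T Nt \<tau> i"
      have "0 \<le> ?\<mu>" "?\<mu> \<le> \<tau> (Suc i)"
        using hybrid_window[OF x i] hybrid_times_less[OF x, of i] by auto
      then have eq: "G_matrix g y v (\<tau> (Suc i)) ?\<mu> = G_matrix g x u (\<tau> (Suc i)) ?\<mu>"
        "Z_vector f g y v (\<tau> (Suc i)) ?\<mu> = Z_vector f g x u (\<tau> (Suc i)) ?\<mu>"
        using state input by (auto intro!: normal_equation_cong)
      have "{\<zeta>. is_arg_min (\<lambda>\<zeta>. (norm (\<zeta> - \<eta> (\<tau> i)))\<^sup>2)
            (\<lambda>\<zeta>. Z_vector f g x u (\<tau> (Suc i)) ?\<mu> = G_matrix g x u (\<tau> (Suc i)) ?\<mu> *v \<zeta>) \<zeta>} = {\<eta> (\<tau> (Suc i))}"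
        using x Si unfolding hybrid_solution_def Let_def by blast
      moreover have "ereal (\<rho> (Suc i)) < b" using Si P(1) by simp
      then have "{z. is_arg_min (\<lambda>z. (norm (z - \<zeta> (\<rho> i)))\<^sup>2)
            (\<lambda>z. Z_vector f g y v (\<rho> (Suc i)) (window_start T Nt \<rho> i)
              = G_matrix g y v (\<rho> (Suc i)) (window_start T Nt \<rho> i) *v z) z} = {\<zeta> (\<rho> (Suc i))}"
        using y unfolding hybrid_solution_def Let_def by blast
      ultimately have "{\<zeta> (\<tau> (Suc i))} = {\<eta> (\<tau> (Suc i))}"
        using IH(1,2) P(1) by (simp add: window eq)
      then show "(\<forall>j\<le>Suc i. \<rho> j = \<tau> j) \<and> \<zeta> (\<tau> (Suc i)) = \<eta> (\<tau> (Suc i)) \<and>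
        (\<forall>t\<in>{0..\<tau> (Suc i)}. y t = x t) \<and> (\<forall>t\<in>{0..<\<tau> (Suc i)}. v t = u t)"
        using times state input by simp
    qed
  qed
  show "\<rho> i = \<tau> i" if "ereal (\<tau> i) < b" for i
    using main that by blast
  show "y t = x t \<and> v t = u t \<and> \<zeta> t = \<eta> t" if t: "t \<ge> 0" "ereal t < b" for t
  proof -
    obtain i where i: "\<tau> i \<le> t" "t < \<tau> (Suc i)" "ereal (\<tau> i) < b"
      using hybrid_interval_exists[OF x t] by blast
    then show ?thesis
      using piece[of i] main[of i] hybrid_times(4)[OF x, of i] t(2) by auto
  qed
qed

end

section \<open>Existence of hybrid solutions\<close>

text \<open>Course-of-values recursion: each element of the sequence may depend on all earlier ones, as the
  parameter update depends on the recorded signals. The auxiliary sequence \<open>H\<close> stores in \<open>H i\<close> the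
  elements up to index \<open>i\<close>.\<close>

lemma causal_recursion_exists:
  fixes nxt :: "nat \<Rightarrow> (nat \<Rightarrow> 's) \<Rightarrow> 's"
  assumes causal: "\<And>i S S'. (\<And>j. j \<le> i \<Longrightarrow> S j = S' j) \<Longrightarrow> nxt i S = nxt i S'"
  obtains S where "S 0 = s0" "\<And>i. S (Suc i) = nxt i S"
proof -
  define H where "H = rec_nat (\<lambda>_ :: nat. s0) (\<lambda>i h. h(Suc i := nxt i h))"
  have H_Suc: "H (Suc i) = (H i)(Suc i := nxt i (H i))" for i
    by (simp add: H_def)
  define S where "S i = H i i" for i
  have "H i j = S j" if "j \<le> i" for i j
    using that by (induction rule: dec_induct) (simp_all add: S_def H_Suc)
  then have "nxt i (H i) = nxt i S" for i
    by (intro causal) simp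
  then have "S (Suc i) = nxt i S" for i
    by (simp add: S_def H_Suc)
  moreover have "S 0 = s0"
    by (simp add: S_def H_def)
  ultimately show thesis using that by blast
qed

context adaptive_loop
begin

context
  fixes \<theta> :: "real^'l"
begin

text \<open>A run is recorded as a sequence of triples: event time, state and estimate at that time. Such a
  record determines the signals, and up to the end of the \<open>i\<close>-th sampling interval they depend on
  its first \<open>i + 1\<close> entries only, as the \<open>LEAST\<close> in the sampling index finds the interval without
  looking at later entries.\<close>

definition end_time :: "(nat \<Rightarrow> real \<times> (real^'n) \<times> (real^'l)) \<Rightarrow> nat \<Rightarrow> real" where
  "end_time S i = (case S i of (t, \<xi>, e) \<Rightarrow> t + step_length \<theta> e \<xi>)"

definition sampling_index :: "(nat \<Rightarrow> real \<times> (real^'n) \<times> (real^'l)) \<Rightarrow> real \<Rightarrow> nat" where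
  "sampling_index S t = (LEAST i. t < end_time S i)"

definition run_state :: "(nat \<Rightarrow> real \<times> (real^'n) \<times> (real^'l)) \<Rightarrow> real \<Rightarrow> real^'n" where
  "run_state S t = (case S (sampling_index S t) of (s, \<xi>, e) \<Rightarrow> step_flow \<theta> e \<xi> (t - s))"

definition run_estimate :: "(nat \<Rightarrow> real \<times> (real^'n) \<times> (real^'l)) \<Rightarrow> real \<Rightarrow> real^'l" where
  "run_estimate S t = (case S (sampling_index S t) of (s, \<xi>, e) \<Rightarrow> e)"

definition run_input :: "(nat \<Rightarrow> real \<times> (real^'n) \<times> (real^'l)) \<Rightarrow> real \<Rightarrow> real^'m" where
  "run_input S t = k (run_estimate S t) (run_state S t)"

text \<open>For an arbitrary sequence of triples the window might start after its end, where the signals are not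
  yet determined; the minimum rules this out and does not change anything along an actual run.\<close>

definition run_window :: "(nat \<Rightarrow> real \<times> (real^'n) \<times> (real^'l)) \<Rightarrow> nat \<Rightarrow> real" where
  "run_window S i = min (end_time S i) (window_start T Nt ((\<lambda>j. fst (S j))(Suc i := end_time S i)) i)"

definition next_event :: "nat \<Rightarrow> (nat \<Rightarrow> real \<times> (real^'n) \<times> (real^'l)) \<Rightarrow> real \<times> (real^'n) \<times> (real^'l)" where
  "next_event i S = (case S i of (t, \<xi>, e) \<Rightarrow>
     (end_time S i, step_flow \<theta> e \<xi> (step_length \<theta> e \<xi>),
      closest_point {\<zeta>. Z_vector f g (run_state S) (run_input S) (end_time S i) (run_window S i)
         = G_matrix g (run_state S) (run_input S) (end_time S i) (run_window S i) *v \<zeta>} e))"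

lemma next_event_causal:
  assumes eq: "\<And>j. j \<le> i \<Longrightarrow> S j = S' j"
  shows "next_event i S = next_event i S'"
proof -
  have end_time: "end_time S j = end_time S' j" if "j \<le> i" for j
    using eq[OF that] by (simp add: end_time_def)
  have index: "sampling_index S t = sampling_index S' t \<and> sampling_index S t \<le> i" if t: "t < end_time S i" for t
  proof -
    have le: "sampling_index S t \<le> i" "t < end_time S (sampling_index S t)"
      unfolding sampling_index_def using t by (rule Least_le, rule LeastI)
    have t': "t < end_time S' i" using t end_time by simp
    have le': "sampling_index S' t \<le> i" "t < end_time S' (sampling_index S' t)"
      unfolding sampling_index_def using t' by (rule Least_le, rule LeastI)
    have "sampling_index S t \<le> sampling_index S' t"
      unfolding sampling_index_def[of S] using le' end_time by (intro Least_le) simp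
    moreover have "sampling_index S' t \<le> sampling_index S t"
      unfolding sampling_index_def[of S'] using le end_time by (intro Least_le) simp
    ultimately show ?thesis using le by simp
  qed
  have signals: "run_state S t = run_state S' t \<and> run_input S t = run_input S' t" if "t < end_time S i" for t
    using index[OF that] eq by (simp add: run_state_def run_input_def run_estimate_def)
  have window: "run_window S i = run_window S' i"
    unfolding run_window_def using end_time[of i] eq
    by (simp, intro arg_cong2[where f = min] refl window_start_cong) (auto simp: le_Suc_eq)
  have "run_window S i \<le> end_time S i"
    by (simp add: run_window_def)
  then have "G_matrix g (run_state S) (run_input S) (end_time S i) (run_window S i) =
      G_matrix g (run_state S') (run_input S') (end_time S i) (run_window S i)"
    "Z_vector f g (run_state S) (run_input S) (end_time S i) (run_window S i) =
      Z_vector f g (run_state S') (run_input S') (end_time S i) (run_window S i)"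
    using signals by (auto intro!: normal_equation_cong)
  then show ?thesis
    unfolding next_event_def using eq[of i] end_time[of i] window by simp
qed

text \<open>The recursion always yields infinitely many events, but their supremum \<open>b\<close> might be finite. The
  run is a hybrid solution on \<open>[0,b)\<close>, so the identification argument applies to it: from some
  event on the estimate is exact or the state is zero, the events are \<open>T\<close> apart, and \<open>b = \<infinity>\<close>.\<close>

lemma hybrid_solution_exists:
  obtains x u \<eta> \<tau> where "hybrid_solution f g k V Q a T Nt \<theta> \<infinity> x u \<eta> \<tau>" "x 0 = x0" "\<eta> 0 = \<eta>0"
proof -
  obtain S where S: "S 0 = (0, x0, \<eta>0)" "\<And>i. S (Suc i) = next_event i S"
    using causal_recursion_exists[of next_event, OF next_event_causal] by metis
  define \<tau> \<xi> E where "\<tau> i = fst (S i)" and "\<xi> i = fst (snd (S i))" and "E i = snd (snd (S i))" for i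
  let ?len = "\<lambda>i. step_length \<theta> (E i) (\<xi> i)" and ?z = "\<lambda>i. step_flow \<theta> (E i) (\<xi> i)"
  define x where "x = run_state S"
  define u where "u = run_input S"
  define \<eta> where "\<eta> = run_estimate S"
  have S_eq: "S i = (\<tau> i, \<xi> i, E i)" for i
    by (simp add: \<tau>_def \<xi>_def E_def)
  have end_time: "end_time S i = \<tau> i + ?len i" for i
    by (simp add: end_time_def S_eq)
  have init: "\<tau> 0 = 0" "\<xi> 0 = x0" "E 0 = \<eta>0"
    by (simp_all add: \<tau>_def \<xi>_def E_def S(1))
  have step: "\<tau> (Suc i) = \<tau> i + ?len i" "\<xi> (Suc i) = ?z i (?len i)"
    "E (Suc i) = closest_point {\<zeta>. Z_vector f g x u (\<tau> (Suc i)) (run_window S i)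
         = G_matrix g x u (\<tau> (Suc i)) (run_window S i) *v \<zeta>} (E i)" for i
    using S(2)[of i] S_eq[of "Suc i"] end_time[of i] by (simp_all add: next_event_def S_eq x_def u_def)
  have less: "\<tau> i < \<tau> (Suc i)" for i
    using step(1)[of i] step_length_pos by simp
  have mono: "strict_mono \<tau>" using less by (simp add: strict_mono_Suc_iff)
  have nonneg: "0 \<le> \<tau> i" for i
    using strict_mono_less_eq[OF mono, of 0 i] init(1) by simp
  have index: "sampling_index S t = i" if "t \<in> {\<tau> i..<\<tau> (Suc i)}" for i t
    unfolding sampling_index_def
  proof (rule Least_equality)
    show "t < end_time S i" using that end_time step(1) by simp
    fix j assume "t < end_time S j"
    then have "\<tau> i < \<tau> (Suc j)" using that end_time step(1) by simp
    then show "i \<le> j" using strict_mono_less[OF mono] by (simp add: less_Suc_eq_le)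
  qed
  have signals: "x t = ?z i (t - \<tau> i)" "\<eta> t = E i" "u t = k (E i) (x t)" if "t \<in> {\<tau> i..<\<tau> (Suc i)}" for i t
    using index[OF that] by (simp_all add: x_def u_def \<eta>_def run_state_def run_estimate_def run_input_def S_eq)
  have at_events: "x (\<tau> i) = \<xi> i" "\<eta> (\<tau> i) = E i" for i
    using signals[of "\<tau> i" i] less[of i] by (simp_all add: step_flow_start)
  have closed_piece: "x t = ?z i (t - \<tau> i)" if "t \<in> {\<tau> i..\<tau> (Suc i)}" for i t
  proof (cases "t = \<tau> (Suc i)")
    case True
    then show ?thesis using at_events(1)[of "Suc i"] step[of i] by simp
  qed (use signals(1)[of t i] that in auto)
  have ode: "ode_solution_on (F \<theta> (E i)) {\<tau> i..\<tau> (Suc i)} x" for i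
  proof (rule ode_solution_on_cong)
    show "ode_solution_on (F \<theta> (E i)) {\<tau> i..\<tau> (Suc i)} (\<lambda>t. ?z i (t + - \<tau> i))"
      by (rule ode_solution_on_shift[OF step_flow_solution]) (use step(1)[of i] in auto)
  qed (simp add: closed_piece)
  have cont: "continuous_on {0..\<tau> n} x" for n
  proof (induction n)
    case (Suc n)
    have "continuous_on ({0..\<tau> n} \<union> {\<tau> n..\<tau> (Suc n)}) x"
      by (intro continuous_on_closed_Un Suc ode_solution_on_continuous[OF ode]) auto
    then show ?case
      using ivl_disj_un_two_touch(4)[OF nonneg[of n] less_imp_le[OF less[of n]]] by simp
  qed (simp add: init(1))
  have deriv: "(x has_vector_derivative F \<theta> (E i) (x t)) (at t within {\<tau> i..<\<tau> (Suc i)})"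
    if "t \<in> {\<tau> i..<\<tau> (Suc i)}" for i t
  proof -
    have "ode_solution_on (F \<theta> (E i)) {\<tau> i..<\<tau> (Suc i)} x"
      using ode by (rule ode_solution_on_subset) auto
    then show ?thesis using that unfolding ode_solution_on_def by blast
  qed
  have sampled: "sampled_solution f g k \<theta> \<tau> E n x u" for n
    unfolding sampled_solution_def using init(1) less cont deriv signals(3) by blast
  \<comment> \<open>possible accumulation point of the events\<close>
  define b where "b = (SUP i. ereal (\<tau> i))"
  have below: "ereal (\<tau> i) < b" for i
  proof -
    have "ereal (\<tau> i) < ereal (\<tau> (Suc i))" using less by simp
    also have "\<dots> \<le> b" unfolding b_def by (rule SUP_upper) simp
    finally show ?thesis .
  qed
  have hyb: "hybrid_solution f g k V Q a T Nt \<theta> b x u \<eta> \<tau>"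
    unfolding hybrid_solution_def
  proof (intro conjI allI impI)
    show "0 < b" using below[of 0] init(1) by (simp add: zero_ereal_def)
    show "\<tau> 0 = 0" "strict_mono \<tau>" by (fact init(1), fact mono)
    show ex: "\<exists>i. t < \<tau> i" if "ereal t < b" for t
      using that unfolding b_def by (simp add: less_SUP_iff)
    show "continuous_on {t. 0 \<le> t \<and> ereal t < b} x"
      unfolding continuous_on_eq_continuous_within
    proof
      fix t assume t: "t \<in> {t. 0 \<le> t \<and> ereal t < b}"
      then obtain n where n: "t < \<tau> n" using ex by blast
      have sub: "ereal s < b" if "s < \<tau> n" for s
        using ereal_less_downward[OF below[of n]] that by simp
      have "at t within {t. 0 \<le> t \<and> ereal t < b} = at t within {0..\<tau> n}"
        by (rule at_within_nhd[of t "{..<\<tau> n}"]) (use n sub in auto)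
      then show "continuous (at t within {t. 0 \<le> t \<and> ereal t < b}) x"
        using cont[of n] t n by (simp add: continuous_on_eq_continuous_within)
    qed
    fix i
    show "let I = {t. \<tau> i \<le> t \<and> t < \<tau> (Suc i) \<and> ereal t < b} in
           \<forall>t\<in>I. u t = k (\<eta> (\<tau> i)) (x t) \<and> \<eta> t = \<eta> (\<tau> i) \<and>
             (x has_vector_derivative f (x t) (u t) + g (x t) (u t) *v \<theta>) (at t within I)"
    proof -
      have "{t. \<tau> i \<le> t \<and> t < \<tau> (Suc i) \<and> ereal t < b} = {\<tau> i..<\<tau> (Suc i)}"
        using ereal_less_downward[OF below[of "Suc i"]] by auto
      then show ?thesis
        using signals[of _ i] at_events(2)[of i] deriv[of _ i] by (simp add: closed_loop_def)
    qed
    show "ereal (\<tau> (Suc i)) =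
        min (ereal (\<tau> i + T)) (trigger_time f g k V Q a T \<theta> (\<eta> (\<tau> i)) (\<tau> i) (x (\<tau> i)))"
      unfolding at_events step(1) by (rule step_length_trigger)
    show "let \<mu> = window_start T Nt \<tau> i in
           {\<zeta>. is_arg_min (\<lambda>\<zeta>. (norm (\<zeta> - \<eta> (\<tau> i)))\<^sup>2)
                 (\<lambda>\<zeta>. Z_vector f g x u (\<tau> (Suc i)) \<mu> = G_matrix g x u (\<tau> (Suc i)) \<mu> *v \<zeta>) \<zeta>}
           = {\<eta> (\<tau> (Suc i))}"
    proof -
      have "T \<le> real Nt * T" using Nt_gt T_pos by simp
      moreover have "\<tau> (Suc i) \<le> \<tau> i + T"
        using step(1)[of i] step_length_le by simp
      ultimately have "\<tau> (Suc i) \<le> \<tau> i + real Nt * T" by simp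
      then obtain j where j: "j \<le> i" "window_start T Nt \<tau> i = \<tau> j"
        by (rule window_start_cases)
      then have \<mu>: "0 \<le> window_start T Nt \<tau> i" "window_start T Nt \<tau> i \<le> \<tau> (Suc i)"
        using nonneg strict_mono_less_eq[OF mono, of j "Suc i"] by simp_all
      have "(\<lambda>j. fst (S j))(Suc i := end_time S i) = \<tau>"
        using end_time[of i] step(1)[of i] by (simp add: fun_eq_iff S_eq)
      then have window: "run_window S i = window_start T Nt \<tau> i"
        unfolding run_window_def using \<mu>(2) end_time[of i] step(1)[of i] by simp
      show ?thesis
        unfolding Let_def at_events step(3) window
        by (rule least_squares_update_unique)
          (rule true_parameter_solves_normal_equation[OF f_cont g_cont k_cont sampled[of "Suc i"] \<mu> order_refl])
    qed
  qed
  have x_init: "x 0 = x0" "\<eta> 0 = \<eta>0" using at_events[of 0] init by simp_all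
  obtain m where m: "\<And>i. m \<le> i \<Longrightarrow> \<eta> (\<tau> i) = \<theta> \<or> x (\<tau> i) = 0"
  proof (cases "x0 = 0")
    case True
    then show thesis
      using that[of 0] hybrid_zero_state[OF hyb _ nonneg below] x_init by blast
  next
    case False
    then show thesis
      using that[of N] hybrid_identification[OF hyb _ below] hybrid_identified_forever[OF hyb _ below] x_init by blast
  qed
  have periodic: "\<tau> (m + i) = \<tau> m + real i * T" for i
  proof (induction i)
    case (Suc i)
    then show ?case
      using hybrid_period_after_identification[OF hyb below m[of "m + i"]] by (simp add: algebra_simps)
  qed simp
  have "b = \<infinity>"
  proof (rule ccontr)
    assume "b \<noteq> \<infinity>"
    moreover have "b \<noteq> - \<infinity>" using below[of 0] by auto
    ultimately obtain r where r: "b = ereal r" by (cases b) auto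
    obtain i :: nat where "(r - \<tau> m) / T < real i" using reals_Archimedean2 by blast
    then have "r < \<tau> m + real i * T" using T_pos by (simp add: field_simps)
    then have "r < \<tau> (m + i)" by (simp only: periodic)
    then show False using below[of "m + i"] r by simp
  qed
  then show thesis using that hyb x_init by blast
qed

end

end

section \<open>Uniform stability and attraction\<close>

context adaptive_loop
begin

text \<open>A bound \<open>r\<close> on the state at an event yields the bound \<open>r'\<close> up to the next event whenever the
  estimate lies in \<open>\<Theta>\<close>, because of the triggering rule. Chains of such pairs of radii lead over
  finitely many events.\<close>

definition transfers_bound :: "(real^'l) set \<Rightarrow> real \<Rightarrow> real \<Rightarrow> bool" where
  "transfers_bound \<Theta> r r' \<longleftrightarrow>
     (\<forall>\<eta>\<in>\<Theta>. \<forall>y z. norm y \<le> r \<longrightarrow> V \<eta> z \<le> level \<eta> y \<longrightarrow> norm z \<le> r')"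

lemma continuous_on_level: "continuous_on UNIV (\<lambda>(\<eta>, y). level \<eta> y)"
proof -
  have "continuous_on UNIV (\<lambda>p. a (snd p) :: real)"
    by (rule continuous_on_compose2[OF a_cont]) (auto intro!: continuous_intros)
  then show ?thesis
    using continuous_on_add[OF Q_cont] by (simp add: case_prod_unfold)
qed

lemma transfers_bound_large:
  assumes "compact \<Theta>" "\<Theta> \<noteq> {}"
  shows "\<exists>r'. transfers_bound \<Theta> r r'"
proof -
  have "compact ((\<lambda>(\<eta>, y). level \<eta> y) ` (\<Theta> \<times> cball 0 r))"
    by (intro compact_continuous_image compact_Times assms compact_cball continuous_on_subset[OF continuous_on_level]) auto
  then have "bounded ((\<lambda>(\<eta>, y). level \<eta> y) ` (\<Theta> \<times> cball 0 r))"
    by (rule compact_imp_bounded)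
  then obtain M where "\<forall>v\<in>(\<lambda>(\<eta>, y). level \<eta> y) ` (\<Theta> \<times> cball 0 r). norm v \<le> M"
    unfolding bounded_iff by blast
  then have M: "level \<eta> y \<le> \<bar>M\<bar>" if "\<eta> \<in> \<Theta>" "norm y \<le> r" for \<eta> y
    using that by (force simp: abs_le_iff)
  obtain r' where "\<And>\<eta> z. \<eta> \<in> \<Theta> \<Longrightarrow> V \<eta> z \<le> \<bar>M\<bar> \<Longrightarrow> norm z \<le> r'"
    using V_unif[OF assms(2,1), of "\<bar>M\<bar>"] by auto
  then have "transfers_bound \<Theta> r r'"
    unfolding transfers_bound_def using M order_trans by blast
  then show ?thesis ..
qed

text \<open>On \<open>\<Theta>\<close> times the compact set of all \<open>z\<close> with \<open>\<epsilon> \<le> \<bar>z\<bar> \<le> R\<close>, \<open>V\<close> is bounded away from zero; beyond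
  radius \<open>R\<close> it exceeds \<open>1\<close>. The triggering level is uniformly continuous near \<open>\<Theta> \<times> {0}\<close>, where it
  vanishes, so it stays below both for small states.\<close>

lemma transfers_bound_small:
  assumes "compact \<Theta>" "\<Theta> \<noteq> {}" "\<epsilon> > 0"
  shows "\<exists>\<delta>>0. \<delta> \<le> \<epsilon> \<and> transfers_bound \<Theta> \<delta> \<epsilon>"
proof -
  obtain R where R: "\<And>\<eta> z. \<eta> \<in> \<Theta> \<Longrightarrow> V \<eta> z \<le> 1 \<Longrightarrow> norm z \<le> R"
    using V_unif[OF assms(2,1), of 1] by auto
  have "\<exists>c>0. c \<le> 1 \<and> (\<forall>\<eta>\<in>\<Theta>. \<forall>z. V \<eta> z < c \<longrightarrow> norm z \<le> \<epsilon>)"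
  proof -
    let ?K = "\<Theta> \<times> (cball 0 R \<inter> {z :: real^'n. \<epsilon> \<le> norm z})"
    have "closed {z :: real^'n. \<epsilon> \<le> norm z}"
      by (intro closed_Collect_le continuous_intros)
    then have "compact (cball 0 R \<inter> {z :: real^'n. \<epsilon> \<le> norm z})"
      by (rule compact_Int_closed[OF compact_cball])
    then have K: "compact ?K"
      by (rule compact_Times[OF assms(1)])
    show ?thesis
    proof (cases "?K = {}")
      case True
      then have "norm z \<le> \<epsilon>" if "\<eta> \<in> \<Theta>" "V \<eta> z < 1" for \<eta> z
        using R[OF that(1), of z] that by (cases "\<epsilon> \<le> norm z") auto
      then show ?thesis by (intro exI[of _ 1]) auto
    next
      case False
      have "continuous_on ?K (\<lambda>(\<eta>, z). V \<eta> z)"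
        by (rule continuous_on_subset[OF V_cont]) auto
      from continuous_attains_inf[OF K False this] obtain \<eta>1 z1 where
        1: "(\<eta>1, z1) \<in> ?K" "\<And>\<eta> z. (\<eta>, z) \<in> ?K \<Longrightarrow> V \<eta>1 z1 \<le> V \<eta> z"
        by auto
      have "z1 \<noteq> 0" using 1(1) assms(3) by auto
      then have pos: "V \<eta>1 z1 > 0" using V_zero_iff[of \<eta>1 z1] by auto
      have "norm z \<le> \<epsilon>" if "\<eta> \<in> \<Theta>" "V \<eta> z < min 1 (V \<eta>1 z1)" for \<eta> z
      proof (rule ccontr)
        assume "\<not> norm z \<le> \<epsilon>"
        moreover have "norm z \<le> R" using R[OF that(1), of z] that(2) by simp
        ultimately have "(\<eta>, z) \<in> ?K" using that(1) by simp
        from 1(2)[OF this] that(2) show False by simp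
      qed
      then show ?thesis
        using pos by (intro exI[of _ "min 1 (V \<eta>1 z1)"]) auto
    qed
  qed
  then obtain c where c: "c > 0" "\<And>\<eta> z. \<eta> \<in> \<Theta> \<Longrightarrow> V \<eta> z < c \<Longrightarrow> norm z \<le> \<epsilon>" by blast
  have "uniformly_continuous_on (\<Theta> \<times> cball 0 1) (\<lambda>(\<eta>, y). level \<eta> y)"
    by (intro compact_uniformly_continuous compact_Times assms compact_cball continuous_on_subset[OF continuous_on_level]) auto
  from this[unfolded uniformly_continuous_on_def, rule_format, OF c(1)] obtain d where d: "d > 0"
    "\<forall>p\<in>\<Theta> \<times> cball 0 1. \<forall>p'\<in>\<Theta> \<times> cball 0 1. dist p' p < d \<longrightarrow>
       dist (case p' of (\<eta>, y) \<Rightarrow> level \<eta> y) (case p of (\<eta>, y) \<Rightarrow> level \<eta> y) < c"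
    by (elim exE conjE)
  define \<delta> where "\<delta> = min (min \<epsilon> 1) (d / 2)"
  have \<delta>: "\<delta> > 0" "\<delta> \<le> \<epsilon>" "\<delta> \<le> 1" "\<delta> < d"
    using assms(3) d(1) by (auto simp: \<delta>_def)
  have "level \<eta> y < c" if "\<eta> \<in> \<Theta>" "norm y \<le> \<delta>" for \<eta> y
    using d(2)[rule_format, of "(\<eta>, 0)" "(\<eta>, y)"] that \<delta> by (simp add: dist_Pair_Pair level_zero dist_real_def)
  then have "transfers_bound \<Theta> \<delta> \<epsilon>"
    unfolding transfers_bound_def using c(2) order_le_less_trans by blast
  with \<delta> show ?thesis by blast
qed

text \<open>Each nominal trajectory from the ball enters the \<open>\<delta>\<close>-ball of Lyapunov stability at some time,
  and by Lipschitz dependence on the initial state so do all trajectories from a neighbourhood.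
  Finitely many neighbourhoods cover the ball.\<close>

lemma nominal_uniform_attraction:
  assumes "\<epsilon> > 0"
  shows "\<exists>t0. \<forall>w t. ode_solution_on (F \<theta> \<theta>) {0..} w \<longrightarrow> norm (w 0) \<le> R \<longrightarrow> t0 \<le> t \<longrightarrow> 0 \<le> t \<longrightarrow> norm (w t) \<le> \<epsilon>"
proof -
  let ?sol = "ode_solution_on (F \<theta> \<theta>) {0..}"
  obtain \<delta> where \<delta>: "\<delta> > 0" "\<And>w t. ?sol w \<Longrightarrow> norm (w 0) < \<delta> \<Longrightarrow> t \<ge> 0 \<Longrightarrow> norm (w t) < \<epsilon>"
    using gas[of \<theta>] assms unfolding globally_asymptotically_stable_def by blast
  have shift: "?sol (\<lambda>r. w (r + s))" if "?sol w" "s \<ge> 0" for w s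
    by (rule ode_solution_on_shift[OF that(1)]) (use that(2) in auto)
  obtain B where B: "transfers_bound {\<theta>} (R + 1) B"
    using transfers_bound_large[of "{\<theta>}" "R + 1"] by auto
  have in_B: "norm (w t) \<le> B" if "?sol w" "norm (w 0) \<le> R + 1" "t \<ge> 0" for w t
    using B V_le_Q[OF that(1,3)] a_nonneg[of "w 0"] that(2) unfolding transfers_bound_def by force
  obtain L where L: "L-lipschitz_on (cball 0 B) (F \<theta> \<theta>)"
    using F_lipschitz unfolding lipschitz_on_balls_def by blast
  have "\<exists>s r. 0 \<le> s \<and> 0 < r \<and> (\<forall>w t. ?sol w \<longrightarrow> norm (w 0) \<le> R \<longrightarrow> dist \<xi> (w 0) < r \<longrightarrow> s \<le> t \<longrightarrow> norm (w t) < \<epsilon>)"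
    if \<xi>: "\<xi> \<in> cball 0 R" for \<xi>
  proof -
    obtain v where v: "?sol v" "v 0 = \<xi>" by (rule nominal_solution_exists)
    have "(v \<longlongrightarrow> 0) at_top"
      using gas[of \<theta>] v(1) unfolding globally_asymptotically_stable_def by blast
    then have "\<forall>\<^sub>F t in at_top. dist (v t) 0 < \<delta> / 2"
      using \<delta>(1) by (intro tendstoD) auto
    then have "\<forall>\<^sub>F t in at_top. dist (v t) 0 < \<delta> / 2 \<and> t \<ge> 0"
      using eventually_ge_at_top by (rule eventually_conj)
    then obtain s where s: "norm (v s) < \<delta> / 2" "s \<ge> 0"
      using eventually_happens by fastforce
    define r where "r = \<delta> / 2 * exp (- (L * s))"
    have "norm (w t) < \<epsilon>" if w: "?sol w" "norm (w 0) \<le> R" "dist \<xi> (w 0) < r" "s \<le> t" for w t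
    proof -
      have "norm (w s - v s) \<le> exp (L * (s - 0)) * norm (w 0 - v 0)"
        using s(2) w(2) \<xi> v(2)
        by (intro ode_solutions_separate_exponentially[OF L] ode_solution_on_subset[OF w(1)]
            ode_solution_on_subset[OF v(1)]) (auto intro: in_B[OF w(1)] in_B[OF v(1)])
      also have "\<dots> < exp (L * s) * r"
        using w(3) v(2) by (simp add: dist_norm norm_minus_commute)
      also have "\<dots> = \<delta> / 2"
        by (simp add: r_def exp_minus)
      finally have "norm (w s) < \<delta>"
        using s(1) norm_triangle_sub[of "w s" "v s"] by linarith
      then have "norm (w (t - s + s)) < \<epsilon>"
        using \<delta>(2)[OF shift[OF w(1) s(2)], of "t - s"] w(4) by simp
      then show ?thesis by simp
    qed
    moreover have "r > 0" using \<delta>(1) by (simp add: r_def)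
    ultimately show ?thesis using s(2) by blast
  qed
  then obtain s r where sr: "\<And>\<xi>. \<xi> \<in> cball 0 R \<Longrightarrow> 0 \<le> s \<xi> \<and> 0 < r \<xi> \<and>
      (\<forall>w t. ?sol w \<longrightarrow> norm (w 0) \<le> R \<longrightarrow> dist \<xi> (w 0) < r \<xi> \<longrightarrow> s \<xi> \<le> t \<longrightarrow> norm (w t) < \<epsilon>)"
    by metis
  obtain C where C: "C \<subseteq> cball 0 R" "finite C" "cball 0 R \<subseteq> (\<Union>\<xi>\<in>C. ball \<xi> (r \<xi>))"
  proof (rule compactE_image[OF compact_cball, of "cball 0 R" "\<lambda>\<xi>. ball \<xi> (r \<xi>)"])
    show "cball 0 R \<subseteq> (\<Union>\<xi>\<in>cball 0 R. ball \<xi> (r \<xi>))" using sr by force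
  qed auto
  \<comment> \<open>the sum of the finitely many nonnegative entry times is an upper bound for all of them\<close>
  have "norm (w t) \<le> \<epsilon>" if "?sol w" "norm (w 0) \<le> R" "(\<Sum>\<xi>\<in>C. s \<xi>) \<le> t" for w t
  proof -
    have "w 0 \<in> cball 0 R" using that(2) by simp
    then obtain \<xi> where \<xi>: "\<xi> \<in> C" "dist \<xi> (w 0) < r \<xi>" using C(3) by auto
    have "s \<xi> \<le> (\<Sum>\<xi>\<in>C. s \<xi>)"
      using \<xi>(1) C(1,2) sr by (intro member_le_sum) auto
    then show ?thesis
      using sr[of \<xi>] \<xi> C(1) that by (meson less_imp_le order_trans subsetD)
  qed
  then show ?thesis by blast
qed

text \<open>All estimates stay in the compact ball \<open>\<Theta>\<close> around \<open>\<theta>\<close>, so chains of transferred bounds over the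
  first \<open>N\<close> events give boundedness and stability up to \<open>\<tau> N\<close>. From then on the state follows the
  nominal closed loop, to which one further transfer and uniform attractivity apply.\<close>

lemma hybrid_solution_estimate:
  fixes x :: "real^'n \<Rightarrow> real \<Rightarrow> real^'n"
  assumes sol: "\<And>x0. hybrid_solution f g k V Q a T Nt \<theta> \<infinity> (x x0) (u x0) (\<eta> x0) (\<tau> x0)"
    and init: "\<And>x0. x x0 0 = x0" "\<And>x0. \<eta> x0 0 = \<eta>0"
  obtains \<sigma> where "class_KL \<sigma>" "\<And>x0 t. t \<ge> 0 \<Longrightarrow> norm (x x0 t) \<le> \<sigma> (norm x0) t"
proof -
  define \<Theta> where "\<Theta> = cball \<theta> (norm (\<eta>0 - \<theta>))"
  have \<Theta>: "compact \<Theta>" "\<Theta> \<noteq> {}" by (auto simp: \<Theta>_def)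
  have \<theta>: "\<theta> \<in> \<Theta>" by (simp add: \<Theta>_def)
  have estimate: "\<eta> x0 (\<tau> x0 i) \<in> \<Theta>" for x0 i
    using hybrid_error_decreasing[OF sol, of 0 i x0] hybrid_times(1)[OF sol, of x0] init(2)[of x0]
    by (simp add: \<Theta>_def dist_norm norm_minus_commute)
  have identified: "\<eta> x0 (\<tau> x0 N) = \<theta>" if "x0 \<noteq> 0" for x0
    using hybrid_identification[OF sol] that init(1) by simp
  have tail: "x x0 t = w (t - \<tau> x0 N)"
    if "x0 \<noteq> 0" "ode_solution_on (F \<theta> \<theta>) {0..} w" "w 0 = x x0 (\<tau> x0 N)" "\<tau> x0 N \<le> t" for x0 w t
    using hybrid_nominal_after_identification[OF sol _ identified that(2-4)] that(1) by simp
  define bounded_until where "bounded_until n r r' \<longleftrightarrow>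
      (\<forall>x0 t. norm x0 \<le> r \<longrightarrow> t \<in> {0..\<tau> x0 n} \<longrightarrow> norm (x x0 t) \<le> r')" for n r r'
  have bounded_until_0: "bounded_until 0 r r" for r
    unfolding bounded_until_def using hybrid_times(1)[OF sol] init(1) by auto
  have bounded_until_Suc: "bounded_until (Suc n) r r'"
    if n: "bounded_until n r s" and s: "transfers_bound \<Theta> s r'" "s \<le> r'" for n r s r'
    unfolding bounded_until_def
  proof (intro allI impI)
    fix x0 t assume x0: "norm x0 \<le> r" and t: "t \<in> {0..\<tau> x0 (Suc n)}"
    show "norm (x x0 t) \<le> r'"
    proof (cases "t \<le> \<tau> x0 n")
      case True
      then have "norm (x x0 t) \<le> s"
        using n x0 t unfolding bounded_until_def by auto
      then show ?thesis using s(2) by linarith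
    next
      case False
      have "norm (x x0 (\<tau> x0 n)) \<le> s"
        using n x0 hybrid_times(4)[OF sol] unfolding bounded_until_def by auto
      then show ?thesis
        using s(1) estimate[of x0 n] hybrid_level[OF sol, of x0 n t] False t
        unfolding transfers_bound_def by auto
    qed
  qed
  have after: "norm (x x0 t) \<le> r'"
    if r: "bounded_until N r s" "transfers_bound \<Theta> s r'" "0 \<le> s" "s \<le> r'" and x0: "norm x0 \<le> r" and t: "0 \<le> t" for r s r' x0 t
  proof (cases "t \<le> \<tau> x0 N \<or> x0 = 0")
    case True
    then have "norm (x x0 t) \<le> s"
      using r(1,3) x0 t hybrid_zero_state[OF sol, of 0 t] init(1)[of 0] unfolding bounded_until_def by auto
    then show ?thesis using r(4) by linarith
  next
    case False
    obtain w where w: "ode_solution_on (F \<theta> \<theta>) {0..} w" "w 0 = x x0 (\<tau> x0 N)"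
      by (rule nominal_solution_exists)
    have "V \<theta> (x x0 t) \<le> level \<theta> (x x0 (\<tau> x0 N))"
      using tail[OF _ w, of t] V_le_Q[OF w(1), of "t - \<tau> x0 N"] w(2) a_nonneg[of "x x0 (\<tau> x0 N)"] False by simp
    moreover have "norm (x x0 (\<tau> x0 N)) \<le> s"
      using r(1) x0 hybrid_times(4)[OF sol] unfolding bounded_until_def by auto
    ultimately show ?thesis
      using r(2) \<theta> unfolding transfers_bound_def by blast
  qed
  have large: "\<exists>r'\<ge>0. bounded_until n r r'" for n r
  proof (induction n)
    case 0
    have "bounded_until 0 r \<bar>r\<bar>"
      using bounded_until_0[of r] unfolding bounded_until_def by force
    then show ?case by (intro exI[of _ "\<bar>r\<bar>"]) simp
  next
    case (Suc n)
    then obtain s where s: "s \<ge> 0" "bounded_until n r s" by blast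
    obtain r' where "transfers_bound \<Theta> s r'" using transfers_bound_large[OF \<Theta>] by blast
    then have "transfers_bound \<Theta> s (max s r')" unfolding transfers_bound_def by (meson le_max_iff_disj)
    then have "bounded_until (Suc n) r (max s r')" using bounded_until_Suc[OF s(2)] by simp
    then show ?case using s(1) by (intro exI[of _ "max s r'"]) simp
  qed
  have small: "\<exists>\<delta>>0. bounded_until n \<delta> \<epsilon>" if "\<epsilon> > 0" for n \<epsilon>
    using that
  proof (induction n arbitrary: \<epsilon>)
    case 0
    then show ?case using bounded_until_0 by blast
  next
    case (Suc n)
    obtain s where s: "s > 0" "s \<le> \<epsilon>" "transfers_bound \<Theta> s \<epsilon>"
      using transfers_bound_small[OF \<Theta> Suc.prems] by blast
    then show ?case using Suc.IH[OF s(1)] bounded_until_Suc by blast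
  qed
  show thesis
  proof (rule class_KL_majorant[of norm "\<lambda>x0 t. norm (x x0 t)"])
    fix R :: real
    obtain s where s: "s \<ge> 0" "bounded_until N R s" using large by blast
    obtain r' where "transfers_bound \<Theta> s r'" using transfers_bound_large[OF \<Theta>] by blast
    then have "transfers_bound \<Theta> s (max s r')" unfolding transfers_bound_def by (meson le_max_iff_disj)
    then show "\<exists>M. \<forall>x0 t. t \<ge> 0 \<longrightarrow> norm x0 \<le> R \<longrightarrow> norm (x x0 t) \<le> M"
      using after[OF s(2) _ s(1)] by (intro exI[of _ "max s r'"]) simp
    fix \<epsilon> :: real assume \<epsilon>: "\<epsilon> > 0"
    show "\<exists>\<delta>>0. \<forall>x0 t. t \<ge> 0 \<longrightarrow> norm x0 \<le> \<delta> \<longrightarrow> norm (x x0 t) \<le> \<epsilon>"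
    proof -
      obtain s where s: "s > 0" "s \<le> \<epsilon>" "transfers_bound \<Theta> s \<epsilon>"
        using transfers_bound_small[OF \<Theta> \<epsilon>] by blast
      obtain \<delta> where "\<delta> > 0" "bounded_until N \<delta> s" using small[OF s(1)] by blast
      then show ?thesis using after[of \<delta> s \<epsilon>] s by (intro exI[of _ \<delta>]) simp
    qed
    obtain t0 where t0: "\<And>w t. ode_solution_on (F \<theta> \<theta>) {0..} w \<Longrightarrow> norm (w 0) \<le> s \<Longrightarrow> t0 \<le> t \<Longrightarrow> 0 \<le> t \<Longrightarrow> norm (w t) \<le> \<epsilon>"
      using nominal_uniform_attraction[OF \<epsilon>, of \<theta> s] by blast
    have "norm (x x0 t) \<le> \<epsilon>" if t: "t \<ge> real N * T + max 0 t0" and t': "t \<ge> 0" and x0: "norm x0 \<le> R" for x0 t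
    proof (cases "x0 = 0")
      case True
      then show ?thesis using hybrid_zero_state[OF sol, of 0 t] init(1)[of 0] t' \<epsilon> by simp
    next
      case False
      have \<tau>N: "\<tau> x0 N \<le> real N * T" using hybrid_times_le[OF sol] by simp
      obtain w where w: "ode_solution_on (F \<theta> \<theta>) {0..} w" "w 0 = x x0 (\<tau> x0 N)"
        by (rule nominal_solution_exists)
      have "norm (x x0 (\<tau> x0 N)) \<le> s"
        using s(2) x0 hybrid_times(4)[OF sol] unfolding bounded_until_def by auto
      then have "norm (w (t - \<tau> x0 N)) \<le> \<epsilon>"
        using t0[OF w(1)] w(2) t \<tau>N by simp
      then show ?thesis using tail[OF False w, of t] t \<tau>N by simp
    qed
    then show "\<exists>t0. \<forall>x0 t. t \<ge> t0 \<longrightarrow> t \<ge> 0 \<longrightarrow> norm x0 \<le> R \<longrightarrow> norm (x x0 t) \<le> \<epsilon>"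
      by blast
  next
    fix \<sigma> assume "class_KL \<sigma>" "\<And>x0 t. t \<ge> 0 \<Longrightarrow> norm (x x0 t) \<le> \<sigma> (norm x0) t"
    then show thesis by (rule that)
  qed auto
qed

lemma hybrid_estimate_identified:
  assumes sol: "hybrid_solution f g k V Q a T Nt \<theta> \<infinity> x u \<eta> \<tau>" and "x 0 \<noteq> 0" "t \<ge> real N * T"
  shows "\<eta> t = \<theta>"
proof -
  have "\<tau> N \<le> t" using hybrid_times_le[OF sol, of N] assms(3) by simp
  moreover have "t \<ge> 0" using calculation hybrid_times(4)[OF sol, of N] by linarith
  then obtain i where i: "\<tau> i \<le> t" "t < \<tau> (Suc i)"
    using hybrid_interval_exists[OF sol, of t] by auto
  ultimately have "N \<le> i"
    using hybrid_times_mono[OF sol, of "Suc i" N] by (cases "N \<le> i") auto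
  then have "\<eta> (\<tau> i) = \<theta>"
    using hybrid_identified_forever[OF sol, of N i] hybrid_identification[OF sol assms(2)] by simp
  then show ?thesis
    using hybrid_control(2)[OF sol, of i t] i by simp
qed

end

section \<open>The closed-loop theorem\<close>

context adaptive_loop
begin

text \<open>One function of class \<open>KL\<close> has to serve all initial states, so a run is chosen for each of them
  before the majorant is formed.\<close>

lemma hybrid_solutions_with_KL_estimate:
  "\<exists>\<sigma>. class_KL \<sigma> \<and> (\<forall>x0. \<exists>x u \<eta> \<tau>. hybrid_solution f g k V Q a T Nt \<theta> \<infinity> x u \<eta> \<tau> \<and>
     x 0 = x0 \<and> \<eta> 0 = \<eta>0 \<and> (\<forall>t\<ge>0. norm (x t) \<le> \<sigma> (norm x0) t))"
proof -
  let ?P = "\<lambda>x0 p. hybrid_solution f g k V Q a T Nt \<theta> \<infinity> (fst p) (fst (snd p)) (fst (snd (snd p))) (snd (snd (snd p)))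
      \<and> fst p 0 = x0 \<and> fst (snd (snd p)) 0 = \<eta>0"
  have "\<exists>p. ?P x0 p" for x0
  proof -
    obtain x u \<eta> \<tau> where "hybrid_solution f g k V Q a T Nt \<theta> \<infinity> x u \<eta> \<tau>" "x 0 = x0" "\<eta> 0 = \<eta>0"
      by (rule hybrid_solution_exists)
    then show ?thesis by (intro exI[of _ "(x, u, \<eta>, \<tau>)"]) simp
  qed
  from choice[OF allI[OF this]] obtain p where p: "\<forall>x0. ?P x0 (p x0)" ..
  define X U H S where "X x0 = fst (p x0)" and "U x0 = fst (snd (p x0))"
    and "H x0 = fst (snd (snd (p x0)))" and "S x0 = snd (snd (snd (p x0)))" for x0
  have sol: "hybrid_solution f g k V Q a T Nt \<theta> \<infinity> (X x0) (U x0) (H x0) (S x0)" "X x0 0 = x0" "H x0 0 = \<eta>0" for x0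
    using p by (simp_all add: X_def U_def H_def S_def)
  obtain \<sigma> where \<sigma>: "class_KL \<sigma>" "\<And>x0 t. t \<ge> 0 \<Longrightarrow> norm (X x0 t) \<le> \<sigma> (norm x0) t"
    using hybrid_solution_estimate[of \<theta> X U H S \<eta>0] sol by blast
  show ?thesis
  proof (intro exI[of _ \<sigma>] conjI allI)
    show "\<exists>x u \<eta> \<tau>. hybrid_solution f g k V Q a T Nt \<theta> \<infinity> x u \<eta> \<tau> \<and>
        x 0 = x0 \<and> \<eta> 0 = \<eta>0 \<and> (\<forall>t\<ge>0. norm (x t) \<le> \<sigma> (norm x0) t)" for x0
      using sol[of x0] \<sigma>(2)
      by (intro exI[of _ "X x0"] exI[of _ "U x0"] exI[of _ "H x0"] exI[of _ "S x0"]) simp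
  qed (rule \<sigma>(1))
qed

lemma regulation:
  "\<exists>\<sigma> :: real^'l \<Rightarrow> real^'l \<Rightarrow> real \<Rightarrow> real \<Rightarrow> real.
     (\<forall>\<theta> \<eta>0. class_KL (\<sigma> \<theta> \<eta>0)) \<and>
     (\<forall>\<theta> x0 \<eta>0. \<exists>x u \<eta> \<tau>.
        hybrid_solution f g k V Q a T Nt \<theta> \<infinity> x u \<eta> \<tau> \<and> x 0 = x0 \<and> \<eta> 0 = \<eta>0 \<and>
        (\<forall>b y v \<zeta> \<rho>.
           hybrid_solution f g k V Q a T Nt \<theta> b y v \<zeta> \<rho> \<and> y 0 = x0 \<and> \<zeta> 0 = \<eta>0 \<longrightarrow>
           (\<forall>t\<ge>0. ereal t < b \<longrightarrow> y t = x t \<and> v t = u t \<and> \<zeta> t = \<eta> t) \<and>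
           (\<forall>i. ereal (\<tau> i) < b \<longrightarrow> \<rho> i = \<tau> i)) \<and>
        (\<forall>t\<ge>0. norm (x t) \<le> \<sigma> \<theta> \<eta>0 (norm x0) t) \<and>
        (x0 \<noteq> 0 \<longrightarrow> (\<forall>t\<ge>real N * T. \<eta> t = \<theta>)))"
proof -
  let ?hyb = "hybrid_solution f g k V Q a T Nt"
  define \<sigma> where "\<sigma> \<theta> \<eta>0 = (SOME \<sigma>. class_KL \<sigma> \<and> (\<forall>x0. \<exists>x u \<eta> \<tau>. ?hyb \<theta> \<infinity> x u \<eta> \<tau> \<and>
     x 0 = x0 \<and> \<eta> 0 = \<eta>0 \<and> (\<forall>t\<ge>0. norm (x t) \<le> \<sigma> (norm x0) t)))" for \<theta> \<eta>0
  have \<sigma>: "class_KL (\<sigma> \<theta> \<eta>0) \<and> (\<forall>x0. \<exists>x u \<eta> \<tau>. ?hyb \<theta> \<infinity> x u \<eta> \<tau> \<and>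
     x 0 = x0 \<and> \<eta> 0 = \<eta>0 \<and> (\<forall>t\<ge>0. norm (x t) \<le> \<sigma> \<theta> \<eta>0 (norm x0) t))" for \<theta> \<eta>0
    unfolding \<sigma>_def by (rule someI_ex[OF hybrid_solutions_with_KL_estimate])
  show ?thesis
  proof (intro exI[of _ \<sigma>] conjI allI)
    show "class_KL (\<sigma> \<theta> \<eta>0)" for \<theta> \<eta>0 using \<sigma> by blast
    fix \<theta> :: "real^'l" and x0 :: "real^'n" and \<eta>0 :: "real^'l"
    obtain x u \<eta> \<tau> where sol: "?hyb \<theta> \<infinity> x u \<eta> \<tau>" and init: "x 0 = x0" "\<eta> 0 = \<eta>0"
      and bound: "\<forall>t\<ge>0. norm (x t) \<le> \<sigma> \<theta> \<eta>0 (norm x0) t"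
      using conjunct2[OF \<sigma>[of \<theta> \<eta>0], THEN spec[of _ x0]] by (elim exE conjE)
    have unique: "(\<forall>t\<ge>0. ereal t < b \<longrightarrow> y t = x t \<and> v t = u t \<and> \<zeta> t = \<eta> t) \<and>
        (\<forall>i. ereal (\<tau> i) < b \<longrightarrow> \<rho> i = \<tau> i)"
      if y: "?hyb \<theta> b y v \<zeta> \<rho> \<and> y 0 = x0 \<and> \<zeta> 0 = \<eta>0" for b y v \<zeta> \<rho>
      using hybrid_solution_unique[OF sol _ conjunct1[OF y]] y init by simp
    have identified: "\<forall>t\<ge>real N * T. \<eta> t = \<theta>" if "x0 \<noteq> 0"
      using hybrid_estimate_identified[OF sol] init(1) that by simp
    show "\<exists>x u \<eta> \<tau>. ?hyb \<theta> \<infinity> x u \<eta> \<tau> \<and> x 0 = x0 \<and> \<eta> 0 = \<eta>0 \<and>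
        (\<forall>b y v \<zeta> \<rho>. ?hyb \<theta> b y v \<zeta> \<rho> \<and> y 0 = x0 \<and> \<zeta> 0 = \<eta>0 \<longrightarrow>
           (\<forall>t\<ge>0. ereal t < b \<longrightarrow> y t = x t \<and> v t = u t \<and> \<zeta> t = \<eta> t) \<and>
           (\<forall>i. ereal (\<tau> i) < b \<longrightarrow> \<rho> i = \<tau> i)) \<and>
        (\<forall>t\<ge>0. norm (x t) \<le> \<sigma> \<theta> \<eta>0 (norm x0) t) \<and>
        (x0 \<noteq> 0 \<longrightarrow> (\<forall>t\<ge>real N * T. \<eta> t = \<theta>))"
      by (rule exI[of _ x], rule exI[of _ u], rule exI[of _ \<eta>], rule exI[of _ \<tau>],
          rule conjI[OF sol], rule conjI[OF init(1)], rule conjI[OF init(2)],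
          rule conjI[OF _ conjI[OF bound]], intro allI impI, rule unique, assumption,
          rule impI, rule identified)
  qed
qed

end

theorem theorem4p1:
  fixes f :: "real^'n \<Rightarrow> real^'m \<Rightarrow> real^'n"
    and g :: "real^'n \<Rightarrow> real^'m \<Rightarrow> real^'l^'n"
    and k :: "real^'l \<Rightarrow> real^'n \<Rightarrow> real^'m"
    and V Q :: "real^'l \<Rightarrow> real^'n \<Rightarrow> real"
    and a :: "real^'n \<Rightarrow> real"
    and T :: real
    and N Nt :: nat
  assumes f_smooth: "smooth (\<lambda>(x, u). f x u)" and f_zero: "f 0 0 = 0"
    and g_smooth: "smooth (\<lambda>(x, u). g x u)" and g_zero: "g 0 0 = 0"
    and k_smooth: "smooth (\<lambda>(\<theta>, x). k \<theta> x)" and k_zero: "\<And>\<theta>. k \<theta> 0 = 0"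
    and V_fun: "\<And>\<theta>. continuous_on UNIV (V \<theta>) \<and> positive_definite (V \<theta>) \<and> radially_unbounded (V \<theta>)"
    and Q_fun: "\<And>\<theta>. continuous_on UNIV (Q \<theta>) \<and> positive_definite (Q \<theta>) \<and> radially_unbounded (Q \<theta>)"
    and V_cont: "continuous_on UNIV (\<lambda>(\<theta>, x). V \<theta> x)"
    and Q_cont: "continuous_on UNIV (\<lambda>(\<theta>, x). Q \<theta> x)"
    and gas: "\<And>\<theta>. globally_asymptotically_stable (closed_loop f g k \<theta> \<theta>)"
    and V_le_Q: "\<And>\<theta> x t. ode_solution_on (closed_loop f g k \<theta> \<theta>) {0..} x \<Longrightarrow> t \<ge> 0 \<Longrightarrow>
                   V \<theta> (x t) \<le> Q \<theta> (x 0)"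
    and V_unif: "\<And>\<Theta> M. \<Theta> \<noteq> {} \<Longrightarrow> compact \<Theta> \<Longrightarrow> M \<ge> 0 \<Longrightarrow>
                   \<exists>R>0. \<forall>\<theta>\<in>\<Theta>. \<forall>x. V \<theta> x \<le> M \<longrightarrow> norm x \<le> R"
    and N_pos: "N > 0" and obs: "parameter_observable f g k N"
    and T_pos: "T > 0"
    and a_cont: "continuous_on UNIV a" and a_pd: "positive_definite a"
    and Nt_gt: "Nt > N"
  shows "\<exists>\<sigma> :: real^'l \<Rightarrow> real^'l \<Rightarrow> real \<Rightarrow> real \<Rightarrow> real.
           (\<forall>\<theta> \<eta>0. class_KL (\<sigma> \<theta> \<eta>0)) \<and>
           (\<forall>\<theta> x0 \<eta>0. \<exists>x u \<eta> \<tau>.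
              hybrid_solution f g k V Q a T Nt \<theta> \<infinity> x u \<eta> \<tau> \<and> x 0 = x0 \<and> \<eta> 0 = \<eta>0 \<and>
              (\<forall>b y v \<zeta> \<rho>.
                 hybrid_solution f g k V Q a T Nt \<theta> b y v \<zeta> \<rho> \<and> y 0 = x0 \<and> \<zeta> 0 = \<eta>0 \<longrightarrow>
                 (\<forall>t\<ge>0. ereal t < b \<longrightarrow> y t = x t \<and> v t = u t \<and> \<zeta> t = \<eta> t) \<and>
                 (\<forall>i. ereal (\<tau> i) < b \<longrightarrow> \<rho> i = \<tau> i)) \<and>
              (\<forall>t\<ge>0. norm (x t) \<le> \<sigma> \<theta> \<eta>0 (norm x0) t) \<and>
              (x0 \<noteq> 0 \<longrightarrow> (\<forall>t\<ge>real N * T. \<eta> t = \<theta>)))"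
  by (rule adaptive_loop.regulation, rule adaptive_loop.intro[OF f_smooth f_zero g_smooth g_zero
        k_smooth k_zero V_fun Q_fun V_cont Q_cont gas V_le_Q V_unif N_pos obs T_pos a_cont a_pd Nt_gt])

end
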